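(* Let $G$ be a finite group and suppose $G=G_1G_2\cdots G_n$, where $G_1,\dots,G_n$ are subgroups of $G$ that are pairwise permutable (i.e. $G_iG_j=G_jG_i$ for all $i,j$) and pairwise $\mathfrak{N}$-connected. Then $$\Gamma_s(G)=\bigcup_{i=1}^n\Gamma_s(G_i),\qquad \Gamma_H(G)=\bigcup_{i=1}^n\Gamma_H(G_i),\qquad \Gamma_{Nc}(G)=\bigcup_{i=1}^n\Gamma_{Nc}(G_i).$$
   Context: All groups are finite; $\pi(G)$ denotes the set of prime divisors of $|G|$, and $\pi(n)$ the set of prime divisors of an integer $n$. Graphs are directed: a graph $\Gamma$ consists of a vertex set $V(\Gamma)$ and an edge set $E(\Gamma)$ of ordered pairs of vertices (loops allowed). The union $\Gamma_1\cup\Gamma_2$ has vertex set $V(\Gamma_1)\cup V(\Gamma_2)$ and edge set $E(\Gamma_1)\cup E(\Gamma_2)$; equality of graphs means equality of vertex sets and edge sets. $O_{p',p}(G)$ is the largest normal $p$-nilpotent subgroup of $G$, i.e. $O_{p',p}(G)/O_{p'}(G)=O_p(G/O_{p'}(G))$. The Hawkes graph $\Gamma_H(G)$ has vertex set $\pi(G)$ and an edge $(p,q)$ whenever $q\in\pi(G/O_{p',p}(G))$. The Sylow graph $\Gamma_s(G)$ has vertex set $\pi(G)$ and an edge $(p,q)$ whenever $q\in\pi(N_G(P)/PC_G(P))$ for some Sylow $p$-subgroup $P$ of $G$. A Schmidt group is a non-nilpotent group all of whose proper subgroups are nilpotent; a Schmidt $(p,q)$-group is a Schmidt group $S$ with $\pi(S)=\{p,q\}$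 and a normal Sylow $p$-subgroup. The $N$-critical graph $\Gamma_{Nc}(G)$ has vertex set $\pi(G)$ and an edge $(p,q)$ whenever $G$ contains a Schmidt $(p,q)$-subgroup. Subgroups $H,K$ of $G$ are $\mathfrak{N}$-connected if $\langle x,y\rangle$ is nilpotent for every $x\in H$, $y\in K$. *)

theory Defs
  imports "HOL-Algebra.Algebra" "HOL-Computational_Algebra.Primes"
begin

definition pi_grp :: "('a, 'b) monoid_scheme \<Rightarrow> nat set" where
  "pi_grp G = {p. Factorial_Ring.prime p \<and> p dvd order G}"

definition centralizer :: "('a, 'b) monoid_scheme \<Rightarrow> 'a set \<Rightarrow> 'a set" where
  "centralizer G P = {g \<in> carrier G. \<forall>h \<in> P. g \<otimes>\<^bsub>G\<^esub> h = h \<otimes>\<^bsub>G\<^esub> g}"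

definition Sylow_subgroup :: "('a, 'b) monoid_scheme \<Rightarrow> nat \<Rightarrow> 'a set \<Rightarrow> bool" where
  "Sylow_subgroup G p P \<longleftrightarrow>
     subgroup P G \<and> (\<exists>k. card P = p ^ k) \<and> \<not> p dvd (order G div card P)"

definition comm_subgroup :: "('a, 'b) monoid_scheme \<Rightarrow> 'a set \<Rightarrow> 'a set \<Rightarrow> 'a set" where
  "comm_subgroup G H K = generate G
     {h \<otimes>\<^bsub>G\<^esub> k \<otimes>\<^bsub>G\<^esub> inv\<^bsub>G\<^esub> h \<otimes>\<^bsub>G\<^esub> inv\<^bsub>G\<^esub> k | h k. h \<in> H \<and> k \<in> K}"

definition lower_central :: "('a, 'b) monoid_scheme \<Rightarrow> nat \<Rightarrow> 'a set" where
  "lower_central G n = ((\<lambda>K. comm_subgroup G (carrier G) K) ^^ n) (carrier G)"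

definition nilpotent_grp :: "('a, 'b) monoid_scheme \<Rightarrow> bool" where
  "nilpotent_grp G \<longleftrightarrow> (\<exists>n. lower_central G n = {\<one>\<^bsub>G\<^esub>})"

definition p_nilpotent :: "('a, 'b) monoid_scheme \<Rightarrow> nat \<Rightarrow> bool" where
  "p_nilpotent G p \<longleftrightarrow>
     (\<exists>N. N \<lhd> G \<and> \<not> p dvd card N \<and> (\<exists>k. order (G Mod N) = p ^ k))"

text \<open>O_{p',p}(G): the largest normal p-nilpotent subgroup of G, i.e. the subgroup
  generated by all normal p-nilpotent subgroups.\<close>
definition O_pp :: "('a, 'b) monoid_scheme \<Rightarrow> nat \<Rightarrow> 'a set" where
  "O_pp G p = generate G (\<Union> {N. N \<lhd> G \<and> p_nilpotent (G\<lparr>carrier := N\<rparr>) p})"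

definition schmidt_grp :: "('a, 'b) monoid_scheme \<Rightarrow> bool" where
  "schmidt_grp G \<longleftrightarrow> \<not> nilpotent_grp G \<and>
     (\<forall>H. subgroup H G \<and> H \<noteq> carrier G \<longrightarrow> nilpotent_grp (G\<lparr>carrier := H\<rparr>))"

definition schmidt_pq_subgroup :: "('a, 'b) monoid_scheme \<Rightarrow> nat \<Rightarrow> nat \<Rightarrow> 'a set \<Rightarrow> bool" where
  "schmidt_pq_subgroup G p q S \<longleftrightarrow>
     subgroup S G \<and> schmidt_grp (G\<lparr>carrier := S\<rparr>) \<and> pi_grp (G\<lparr>carrier := S\<rparr>) = {p, q} \<and>
     (\<exists>P. Sylow_subgroup (G\<lparr>carrier := S\<rparr>) p P \<and> P \<lhd> G\<lparr>carrier := S\<rparr>)"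

definition N_connected :: "('a, 'b) monoid_scheme \<Rightarrow> 'a set \<Rightarrow> 'a set \<Rightarrow> bool" where
  "N_connected G H K \<longleftrightarrow>
     (\<forall>x \<in> H. \<forall>y \<in> K. nilpotent_grp (G\<lparr>carrier := generate G {x, y}\<rparr>))"

primrec set_prod_seq :: "('a, 'b) monoid_scheme \<Rightarrow> (nat \<Rightarrow> 'a set) \<Rightarrow> nat \<Rightarrow> 'a set" where
  "set_prod_seq G Gs 0 = {\<one>\<^bsub>G\<^esub>}"
| "set_prod_seq G Gs (Suc n) = set_prod_seq G Gs n <#>\<^bsub>G\<^esub> Gs (Suc n)"

type_synonym pgraph = "nat set \<times> (nat \<times> nat) set"

definition graph_Union :: "'i set \<Rightarrow> ('i \<Rightarrow> pgraph) \<Rightarrow> pgraph" where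
  "graph_Union I f = ((\<Union>i\<in>I. fst (f i)), (\<Union>i\<in>I. snd (f i)))"

definition sylow_graph :: "('a, 'b) monoid_scheme \<Rightarrow> pgraph" where
  "sylow_graph G = (pi_grp G,
     {(p, q). p \<in> pi_grp G \<and> q \<in> pi_grp G \<and>
        (\<exists>P. Sylow_subgroup G p P \<and> Factorial_Ring.prime q \<and>
           q dvd order ((G\<lparr>carrier := normalizer G P\<rparr>) Mod (P <#>\<^bsub>G\<^esub> centralizer G P)))})"

definition hawkes_graph :: "('a, 'b) monoid_scheme \<Rightarrow> pgraph" where
  "hawkes_graph G = (pi_grp G,
     {(p, q). p \<in> pi_grp G \<and> q \<in> pi_grp G \<and> Factorial_Ring.prime q \<and> q dvd order (G Mod O_pp G p)})"

definition Nc_graph :: "('a, 'b) monoid_scheme \<Rightarrow> pgraph" where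
  "Nc_graph G = (pi_grp G,
     {(p, q). p \<in> pi_grp G \<and> q \<in> pi_grp G \<and> (\<exists>S. schmidt_pq_subgroup G p q S)})"

end

(* Of the N-connectedness only one consequence is used: elements of coprime orders of different
   factors commute. This property is inherited by the pair G_1...G_k, G_(k+1), so everything reduces
   to a product G = AB of two subgroups whose elements of coprime orders commute.

   Let R_H be the nilpotent residual of H, generated by the commutators [x, y] of elements x, y of H
   of coprime orders. Given b in B, the part of b coprime to the order of x commutes with x and its
   conjugates, the remaining part commutes with y and its conjugates; hence R_A centralises B.
   So R_A, R_B and R = R_A R_B are normal in G, and commutators of elements of coprime orders of G
   already lie in R.

   An edge (p,q) of the Schmidt or the Sylow graph amounts to a q-element y normalising but not
   centralising a (Sylow) p-subgroup P. Coprime action moves the non-trivial action to P \<inter> R, hence to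
   p-elements of R_A or R_B, and on R_A the element y = y_1 y_2 acts as its component y_1 in A.
   For the Hawkes graph one shows that O_{p',p}(A) is contained in O_{p',p}(G): the normal subgroup M of
   elements acting on R_A and R_B like elements of O_{p',p}(A) and O_{p',p}(B) is p-nilpotent, because
   the p-elements of O^p(M) turn out to be central in O^p(M), and transfer applies. *)
theory Submission
  imports Defs "HOL-Number_Theory.Cong"
begin

hide_const (open) Divisibility.prime

section \<open>Elements of finite groups\<close>

text \<open>The factors A and B need be neither normal nor meet trivially, so nothing in G can be
  projected to A except its action on R_A: as B centralises R_A, an element ab acts there as a. And
  G/R is nilpotent, so every coprime action leaves a trace in R. Each edge of the Schmidt or the
  Sylow graph is therefore transported through R.

  Two obstacles shape the rest. If v = ab lies in P with a in R_A and b in R_B, then a need not lie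
  in P. For the Schmidt graph P gives way to a Sylow p-subgroup of the intersection of R_A with P
  R_B; for the Sylow graph, orders show that the intersection of P with R is the product of those
  with R_A and R_B, so a can be chosen in P. Moreover O_{p',p}(A) need not be normal in G;
  multiplied by the centraliser of R_A, which contains B, it becomes normal, and intersecting with
  the analogue for B restores p-nilpotency.

  Quotients are mostly replaced by orders: x to the index of a normal subgroup N lies in N, so x
  itself does if its order is prime to that index.\<close>

locale fin_group = group G for G :: "('a, 'b) monoid_scheme" (structure) +
  assumes fin: "finite (carrier G)"
begin

abbreviation cnj :: "'a \<Rightarrow> 'a \<Rightarrow> 'a" where
  "cnj g x \<equiv> g \<otimes> x \<otimes> inv g"

abbreviation cmt :: "'a \<Rightarrow> 'a \<Rightarrow> 'a" where
  "cmt x y \<equiv> x \<otimes> y \<otimes> inv x \<otimes> inv y"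

text \<open>Inclusion instead of equality of \<open>K\<close> and its conjugates suffices, as all groups are finite.\<close>

definition normalizes :: "'a set \<Rightarrow> 'a set \<Rightarrow> bool" where
  "normalizes S K \<longleftrightarrow> (\<forall>s\<in>S. \<forall>k\<in>K. cnj s k \<in> K)"

abbreviation Sub :: "'a set \<Rightarrow> ('a, 'b) monoid_scheme" where
  "Sub H \<equiv> G\<lparr>carrier := H\<rparr>"

lemma inv_cancel:
  assumes "x \<in> carrier G" "y \<in> carrier G"
  shows "inv x \<otimes> (x \<otimes> y) = y" "x \<otimes> (inv x \<otimes> y) = y"
  using assms by (simp_all flip: m_assoc)

lemmas word_simps = m_assoc inv_mult_group inv_cancel

lemma sub_in: "subgroup H G \<Longrightarrow> x \<in> H \<Longrightarrow> x \<in> carrier G"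
  by (rule subgroup.mem_carrier)

lemma sub_fin: "subgroup H G \<Longrightarrow> finite H"
  using fin finite_subset subgroup.subset by blast

lemma sub_card_pos: "subgroup H G \<Longrightarrow> 0 < card H"
  using fin subgroup.finite_imp_card_positive by blast

lemma fin_sub: "subgroup H G \<Longrightarrow> fin_group (Sub H)"
  by (simp add: fin_group_axioms_def fin_group_def sub_fin subgroup_imp_group)

lemma sub_Int: "subgroup H G \<Longrightarrow> subgroup K G \<Longrightarrow> subgroup (H \<inter> K) G"
  by (rule subgroups_Inter_pair)

lemma pow_sub:
  assumes "subgroup H G" "x \<in> H"
  shows "x [^] (n::nat) \<in> H"
  using assms by (induction n) (auto simp: subgroup.one_closed subgroup.m_closed)

lemma cnj_sub: "subgroup H G \<Longrightarrow> h \<in> H \<Longrightarrow> x \<in> H \<Longrightarrow> cnj h x \<in> H"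
  by (simp add: subgroup.m_closed subgroup.m_inv_closed)

lemma cmt_sub: "subgroup H G \<Longrightarrow> h \<in> H \<Longrightarrow> x \<in> H \<Longrightarrow> cmt h x \<in> H"
  by (simp add: subgroup.m_closed subgroup.m_inv_closed)

text \<open>In a finite group inverses are powers: the inverse of \<open>x\<close> is
  \<open>x\<close> to the exponent |G| - 1.\<close>

lemma sub_closedI:
  assumes H: "H \<subseteq> carrier G" and one: "\<one> \<in> H"
    and mult: "\<And>x y. x \<in> H \<Longrightarrow> y \<in> H \<Longrightarrow> x \<otimes> y \<in> H"
  shows "subgroup H G"
proof (rule subgroupI)
  show "H \<noteq> {}" using one by blast
  fix x assume x: "x \<in> H"
  then have xc: "x \<in> carrier G" using H by blast
  have pow: "x [^] n \<in> H" for n :: nat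
    by (induction n) (auto simp: one mult x)
  have "0 < order G" using fin order_gt_0_iff_finite by blast
  then obtain n where n: "order G = Suc n" using gr0_implies_Suc by blast
  have "x [^] n \<otimes> x = \<one>" using pow_order_eq_1[OF xc] n by simp
  then have "inv x = x [^] n" using inv_equality xc by simp
  then show "inv x \<in> H" using pow by simp
qed (use assms in auto)

lemma one_pow_dvd:
  assumes "x \<in> carrier G" "x [^] (m::nat) = \<one>" "m dvd n"
  shows "x [^] n = \<one>"
  using assms nat_pow_pow[of x m] by (auto simp: dvd_def)

lemma one_pow_gcd:
  assumes x: "x \<in> carrier G" and m: "x [^] (m::nat) = \<one>" and n: "x [^] (n::nat) = \<one>"
  shows "x [^] gcd m n = \<one>"
proof -
  have "ord x dvd gcd m n" using pow_eq_id[OF x] m n by simp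
  then show ?thesis using pow_eq_id[OF x] by simp
qed

lemma one_pow_coprime:
  assumes "x \<in> carrier G" "x [^] (m::nat) = \<one>" "x [^] (n::nat) = \<one>" "coprime m n"
  shows "x = \<one>"
  using one_pow_gcd[OF assms(1-3)] assms by simp

lemma pow_card:
  assumes H: "subgroup H G" and x: "x \<in> H"
  shows "x [^] card H = \<one>"
proof -
  interpret H: fin_group "Sub H" using fin_sub[OF H] .
  have "x [^]\<^bsub>Sub H\<^esub> order (Sub H) = \<one>"
    using H.pow_order_eq_1[of x] x by simp
  then show ?thesis by (simp add: order_def nat_pow_consistent[symmetric])
qed

lemma cong_pow:
  assumes x: "x \<in> carrier G" and n: "x [^] (n::nat) = \<one>" and c: "[k = l] (mod n)"
  shows "x [^] k = x [^] l"
proof -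
  have "[k = l] (mod ord x)"
    using cong_dvd_modulus_nat[OF c] n pow_eq_id[OF x] by simp
  have mod: "x [^] k = x [^] (k mod ord x)" for k
  proof -
    have "x [^] k = x [^] (ord x * (k div ord x) + k mod ord x)" by simp
    also have "\<dots> = (x [^] ord x) [^] (k div ord x) \<otimes> x [^] (k mod ord x)"
      using x by (simp only: nat_pow_mult nat_pow_pow)
    finally show ?thesis using x pow_ord_eq_1 by simp
  qed
  show ?thesis using mod[of k] mod[of l] \<open>[k = l] (mod ord x)\<close> by (simp add: cong_def)
qed

text \<open>The Chinese remainder theorem gives \<open>s\<close> congruent to 1 modulo
  \<open>a\<close> and to 0 modulo \<open>b\<close>, and \<open>t\<close> the other way round. Both
  are independent of \<open>x\<close>, so one exponent extracts the parts of several elements at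
  once.\<close>

lemma part_exponents:
  assumes ab: "order G = a * b" and cop_orders: "coprime a b"
  obtains s t :: nat where
    "\<And>x. x \<in> carrier G \<Longrightarrow> x = x [^] s \<otimes> x [^] t"
    "\<And>x. x \<in> carrier G \<Longrightarrow> (x [^] s) [^] a = \<one>"
    "\<And>x. x \<in> carrier G \<Longrightarrow> (x [^] t) [^] b = \<one>"
    "\<And>x. x \<in> carrier G \<Longrightarrow> x [^] a = \<one> \<Longrightarrow> x [^] s = x"
    "\<And>x. x \<in> carrier G \<Longrightarrow> x [^] b = \<one> \<Longrightarrow> x [^] s = \<one>"
proof -
  obtain s where s: "[s = 1] (mod a)" "[s = 0] (mod b)"
    using binary_chinese_remainder_nat[OF cop_orders] by blast
  obtain t where t: "[t = 0] (mod a)" "[t = 1] (mod b)"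
    using binary_chinese_remainder_nat[OF cop_orders] by blast
  have "[s + t = 1 + 0] (mod a)" "[s + t = 0 + 1] (mod b)"
    using s t cong_add by blast+
  then have st: "[s + t = 1] (mod (a * b))"
    using coprime_cong_mult_nat cop_orders by simp
  have o: "x [^] (a * b) = \<one>" if "x \<in> carrier G" for x
    using pow_order_eq_1[OF that] ab by simp
  have "b dvd s" "a dvd t" using s t by (simp_all add: cong_0_iff)
  then have d: "a * b dvd s * a" "a * b dvd t * b" by (auto simp: mult.commute)
  show ?thesis
  proof (rule that)
    fix x assume x: "x \<in> carrier G"
    show "x = x [^] s \<otimes> x [^] t"
      using cong_pow[OF x o[OF x] st] x by (simp add: nat_pow_mult)
    show "(x [^] s) [^] a = \<one>" "(x [^] t) [^] b = \<one>"
      using one_pow_dvd[OF x o[OF x]] d x by (simp_all add: nat_pow_pow)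
    show "x [^] s = x" if "x [^] a = \<one>" using cong_pow[OF x that s(1)] x by simp
    show "x [^] s = \<one>" if "x [^] b = \<one>" using cong_pow[OF x that s(2)] x by simp
  qed
qed

text \<open>The factor \<open>a\<close> takes all primes of the group order that divide
  \<open>m\<close>; the induction splits off \<open>gcd m N\<close> until nothing is left. This
  replaces arbitrary coprime exponents by complementary divisors of the group order, as
  \<open>part_exponents\<close> needs.\<close>

lemma coprime_split:
  assumes "coprime m (n::nat)"
  obtains a b where "order G = a * b" "coprime a b" "coprime m b" "coprime n a"
proof -
  have "\<exists>a b. N = a * b \<and> coprime a b \<and> coprime m b \<and> coprime n a" if "N > 0" for N :: nat
    using that
  proof (induction N rule: less_induct)
    case (less N)
    show ?case
    proof (cases "coprime m N")
      case True
      then show ?thesis by (intro exI[of _ 1] exI[of _ N]) auto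
    next
      case False
      define g where "g = gcd m N"
      have g: "g > 1" using False less.prems
        by (simp add: g_def coprime_iff_gcd_eq_1 nat_neq_iff)
      obtain N' where N': "N = g * N'" unfolding g_def by (metis dvdE gcd_dvd2)
      then have "N' < N" "N' > 0" using less.prems g by auto
      then obtain a b where ab: "N' = a * b" "coprime a b" "coprime m b" "coprime n a"
        using less.IH by blast
      have "coprime g b" using ab(3) unfolding g_def
        by (meson coprime_divisors dvd_refl gcd_dvd1)
      moreover have "coprime n g" using assms unfolding g_def
        by (meson coprime_commute coprime_divisors dvd_refl gcd_dvd1)
      ultimately show ?thesis using ab N'
        by (intro exI[of _ "g * a"] exI[of _ b]) auto
    qed
  qed
  then show ?thesis using that fin order_gt_0_iff_finite by blast
qed

lemma one_pow_factor:
  assumes x: "x \<in> carrier G" "x [^] (a * b :: nat) = \<one>" "x [^] (m::nat) = \<one>" and c: "coprime m b"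
  shows "x [^] a = \<one>"
proof -
  have "x [^] gcd m (a * b) = \<one>" using one_pow_gcd[OF x(1,3,2)] .
  moreover have "gcd m (a * b) dvd a"
    using c by (metis coprime_dvd_mult_left_iff coprime_commute coprime_divisors dvd_refl gcd_dvd1 gcd_dvd2)
  ultimately show ?thesis using one_pow_dvd x(1) by blast
qed

lemma one_pow_part:
  assumes "order G = a * b" "x \<in> carrier G" "x [^] (m::nat) = \<one>" "coprime m b"
  shows "x [^] a = \<one>"
  using one_pow_factor[of x a b m] pow_order_eq_1 assms by simp

text \<open>Inverting \<open>k\<close> modulo \<open>m\<close> exhibits \<open>x\<close> as a power
  of \<open>x [^] k\<close>. Together with \<open>index_pow\<close> it takes the place of arguments
  in a quotient.\<close>

lemma mem_of_pow:
  assumes H: "subgroup H G" and x: "x \<in> carrier G" "x [^] (k::nat) \<in> H" "x [^] (m::nat) = \<one>"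
    and c: "coprime k m"
  shows "x \<in> H"
proof -
  obtain s where "[k * s = 1] (mod m)" using cong_solve_coprime_nat[OF c] by auto
  then have "x [^] (k * s) = x" using cong_pow[OF x(1,3)] x by fastforce
  then show ?thesis using pow_sub[OF H x(2), of s] x by (simp add: nat_pow_pow)
qed

lemma prime_power_coprime:
  assumes "prime (p::nat)" "\<not> p dvd m"
  shows "coprime (p ^ k) m" "coprime m (p ^ k)"
  using assms prime_imp_power_coprime coprime_commute by blast+

lemma prime_split:
  assumes "prime (p::nat)"
  obtains k b where "order G = p ^ k * b" "coprime (p ^ k) b" "\<not> p dvd b"
proof -
  have "order G > 0" using fin order_gt_0_iff_finite by blast
  then obtain b where "order G = p ^ multiplicity p (order G) * b" "\<not> p dvd b"
    using multiplicity_decompose'[of "order G" p] assms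
    by (metis not_prime_unit not_gr_zero)
  then show ?thesis using that assms prime_power_coprime by blast
qed

lemma commute_pow:
  assumes "x \<in> carrier G" "y \<in> carrier G" "x \<otimes> y = y \<otimes> x"
  shows "x [^] (n::nat) \<otimes> y = y \<otimes> x [^] n"
  using group_commutes_pow assms by metis

lemma cnj_pow:
  assumes "x \<in> carrier G" "y \<in> carrier G"
  shows "(cnj x y) [^] (n::nat) = cnj x (y [^] n)"
  using assms by (induction n) (simp_all add: word_simps)

lemma commute_iff_cnj:
  assumes "x \<in> carrier G" "y \<in> carrier G"
  shows "x \<otimes> y = y \<otimes> x \<longleftrightarrow> cnj x y = y"
  using assms by (metis inv_solve_right' m_closed)

lemma commute_iff_cmt:
  assumes "x \<in> carrier G" "y \<in> carrier G"
  shows "x \<otimes> y = y \<otimes> x \<longleftrightarrow> cmt x y = \<one>"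
  using assms by (metis commute_iff_cnj inv_closed inv_solve_right' l_one m_closed one_closed)

text \<open>Conjugation by \<open>x\<close> sends \<open>y\<close> to zy. Since \<open>z\<close>
  commutes with \<open>y\<close>, comparing n-th powers gives z^n = 1; symmetrically z^m =
  1.\<close>

lemma central_cmt_coprime:
  assumes x: "x \<in> carrier G" "x [^] (m::nat) = \<one>" and y: "y \<in> carrier G" "y [^] (n::nat) = \<one>"
    and c: "coprime m n" and z: "z = cmt x y" "z \<otimes> x = x \<otimes> z" "z \<otimes> y = y \<otimes> z"
  shows "x \<otimes> y = y \<otimes> x"
proof -
  have zc: "z \<in> carrier G" using x y z by simp
  have "cnj x y = z \<otimes> y" using x y z(1) by (simp add: word_simps)
  then have "(z \<otimes> y) [^] n = cnj x (y [^] n)" using cnj_pow x y by metis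
  then have zn: "z [^] n = \<one>" using x y zc z(3) by (simp add: pow_mult_distrib)
  have "cnj y x = inv z \<otimes> x" using x y z(1) by (simp add: word_simps)
  then have e: "(inv z \<otimes> x) [^] m = cnj y (x [^] m)" using cnj_pow x y by metis
  have "inv z \<otimes> x = x \<otimes> inv z" using z(2) x zc
    by (metis inv_closed inv_solve_left inv_solve_right' m_assoc m_closed)
  then have "inv z [^] m = \<one>" using e x y zc by (simp add: pow_mult_distrib)
  then have "z [^] m = \<one>" using zc by (metis inv_eq_1_iff nat_pow_closed nat_pow_inv)
  then have "z = \<one>" using one_pow_coprime[OF zc] zn c by blast
  then show ?thesis using commute_iff_cmt x y z by metis
qed

section \<open>Centralisers, normalisers and products of subgroups\<close>

lemma centralizer_sub: "S \<subseteq> carrier G \<Longrightarrow> subgroup (centralizer G S) G"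
proof (rule sub_closedI)
  assume S: "S \<subseteq> carrier G"
  show "\<one> \<in> centralizer G S" using S by (auto simp: centralizer_def)
  fix x y assume "x \<in> centralizer G S" "y \<in> centralizer G S"
  then have *: "x \<in> carrier G" "y \<in> carrier G" "\<And>s. s \<in> S \<Longrightarrow> x \<otimes> s = s \<otimes> x" "\<And>s. s \<in> S \<Longrightarrow> y \<otimes> s = s \<otimes> y"
    by (auto simp: centralizer_def)
  have "x \<otimes> y \<otimes> s = s \<otimes> (x \<otimes> y)" if "s \<in> S" for s
    using * that S by (metis m_assoc subsetD)
  then show "x \<otimes> y \<in> centralizer G S" using * by (simp add: centralizer_def)
qed (auto simp: centralizer_def)

lemma commute_generate:
  assumes S: "S \<subseteq> carrier G" and T: "T \<subseteq> carrier G"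
    and st: "\<And>s t. s \<in> S \<Longrightarrow> t \<in> T \<Longrightarrow> s \<otimes> t = t \<otimes> s"
    and x: "x \<in> generate G S" and y: "y \<in> generate G T"
  shows "x \<otimes> y = y \<otimes> x"
proof -
  have "S \<subseteq> centralizer G T" using S st by (auto simp: centralizer_def)
  then have "generate G S \<subseteq> centralizer G T"
    using generate_subgroup_incl centralizer_sub[OF T] by blast
  then have "T \<subseteq> centralizer G (generate G S)"
    using T by (auto simp: centralizer_def subset_iff)
  then have "generate G T \<subseteq> centralizer G (generate G S)"
    using generate_subgroup_incl centralizer_sub generate_incl[OF S] by blast
  then show ?thesis using x y by (auto simp: centralizer_def subset_iff)
qed

lemma normalizer_sub:
  assumes "K \<subseteq> carrier G"
  shows "subgroup {g \<in> carrier G. normalizes {g} K} G"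
proof (rule sub_closedI)
  show "\<one> \<in> {g \<in> carrier G. normalizes {g} K}"
    using assms by (auto simp: normalizes_def subset_iff)
  fix x y assume *: "x \<in> {g \<in> carrier G. normalizes {g} K}" "y \<in> {g \<in> carrier G. normalizes {g} K}"
  have "cnj (x \<otimes> y) k \<in> K" if k: "k \<in> K" for k
  proof -
    have kc: "k \<in> carrier G" using assms k by blast
    have "cnj (x \<otimes> y) k = cnj x (cnj y k)" using kc * by (simp add: word_simps)
    then show ?thesis using * k by (simp add: normalizes_def)
  qed
  then show "x \<otimes> y \<in> {g \<in> carrier G. normalizes {g} K}" using * by (simp add: normalizes_def)
qed auto

lemma normalizes_generate:
  assumes S: "S \<subseteq> carrier G" and T: "T \<subseteq> carrier G"
    and st: "\<And>t s. t \<in> T \<Longrightarrow> s \<in> S \<Longrightarrow> cnj t s \<in> generate G S"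
  shows "normalizes (generate G T) (generate G S)"
proof -
  have sg: "subgroup (generate G S) G" by (rule generate_is_subgroup[OF S])
  have gc: "generate G S \<subseteq> carrier G" by (rule generate_incl[OF S])
  have "cnj t x \<in> generate G S" if t: "t \<in> T" and x: "x \<in> generate G S" for t x
  proof -
    have tc: "t \<in> carrier G" using t T by blast
    show ?thesis using x
    proof (induction rule: generate.induct)
      case one then show ?case using tc generate.one by simp
    next
      case (incl h) then show ?case using st t by blast
    next
      case (inv h)
      have "h \<in> carrier G" using inv S by blast
      then have "cnj t (inv h) = inv (cnj t h)" using tc by (simp add: word_simps)
      then show ?case using st[OF t inv] sg by (simp add: subgroup.m_inv_closed)
    next
      case (eng h1 h2)
      have "h1 \<in> carrier G" "h2 \<in> carrier G" using eng gc by blast+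
      then have "cnj t (h1 \<otimes> h2) = cnj t h1 \<otimes> cnj t h2" using tc by (simp add: word_simps)
      then show ?case using eng sg by (simp add: subgroup.m_closed)
    qed
  qed
  then have "T \<subseteq> {g \<in> carrier G. normalizes {g} (generate G S)}"
    using T by (auto simp: normalizes_def)
  then have "generate G T \<subseteq> {g \<in> carrier G. normalizes {g} (generate G S)}"
    using generate_subgroup_incl normalizer_sub[OF gc] by blast
  then show ?thesis by (auto simp: normalizes_def)
qed

lemma normalizes_sub: "subgroup H G \<Longrightarrow> normalizes H H"
  by (simp add: normalizes_def cnj_sub)

lemma normalizes_mono: "normalizes S K \<Longrightarrow> T \<subseteq> S \<Longrightarrow> normalizes T K"
  by (auto simp: normalizes_def)

lemma normalizesD: "normalizes S K \<Longrightarrow> s \<in> S \<Longrightarrow> k \<in> K \<Longrightarrow> cnj s k \<in> K"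
  by (auto simp: normalizes_def)

lemma sub_sub_iff:
  assumes H: "subgroup H G"
  shows "subgroup N (Sub H) \<longleftrightarrow> subgroup N G \<and> N \<subseteq> H"
proof
  assume L: "subgroup N (Sub H)"
  show "subgroup N G \<and> N \<subseteq> H" using incl_subgroup[OF H L] subgroup.subset[OF L] by simp
qed (use subgroup_incl H in blast)

lemma normal_sub_iff:
  assumes H: "subgroup H G"
  shows "N \<lhd> Sub H \<longleftrightarrow> subgroup N G \<and> N \<subseteq> H \<and> normalizes H N"
proof -
  interpret H: fin_group "Sub H" using fin_sub[OF H] .
  show ?thesis using H
    by (auto simp: H.normal_inv_iff sub_sub_iff[OF H] normalizes_def m_inv_consistent)
qed

lemma set_multI: "x \<in> A \<Longrightarrow> y \<in> B \<Longrightarrow> x \<otimes> y \<in> A <#> B"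
  by (auto simp: set_mult_def)

lemma set_multE:
  assumes "g \<in> A <#> B"
  obtains x y where "x \<in> A" "y \<in> B" "g = x \<otimes> y"
  using assms by (auto simp: set_mult_def)

lemma sub_set_mult_left: "subgroup A G \<Longrightarrow> subgroup B G \<Longrightarrow> A \<subseteq> A <#> B"
  using set_multI[of _ A \<one> B] by (auto simp: subgroup.one_closed subgroup.mem_carrier)

lemma sub_set_mult_right: "subgroup A G \<Longrightarrow> subgroup B G \<Longrightarrow> B \<subseteq> A <#> B"
  using set_multI[of \<one> A _ B] by (auto simp: subgroup.one_closed subgroup.mem_carrier)

lemma set_mult_sub:
  assumes A: "subgroup A G" and B: "subgroup B G" and c: "B <#> A \<subseteq> A <#> B"
  shows "subgroup (A <#> B) G"
proof (rule sub_closedI)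
  show "A <#> B \<subseteq> carrier G" using A B by (simp add: setmult_subset_G subgroup.subset)
  show "\<one> \<in> A <#> B" using sub_set_mult_left[OF A B] subgroup.one_closed[OF A] by blast
  fix x y assume "x \<in> A <#> B" "y \<in> A <#> B"
  then obtain a b a' b' where e: "a \<in> A" "b \<in> B" "x = a \<otimes> b" "a' \<in> A" "b' \<in> B" "y = a' \<otimes> b'"
    by (meson set_multE)
  have "b \<otimes> a' \<in> A <#> B" using e c set_multI by blast
  then obtain a'' b'' where f: "a'' \<in> A" "b'' \<in> B" "b \<otimes> a' = a'' \<otimes> b''" by (meson set_multE)
  note ic = sub_in[OF A] sub_in[OF B]
  have "x \<otimes> y = a \<otimes> (b \<otimes> a') \<otimes> b'" using e ic by (simp add: m_assoc)
  also have "\<dots> = (a \<otimes> a'') \<otimes> (b'' \<otimes> b')" using e f ic by (simp add: m_assoc)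
  finally show "x \<otimes> y \<in> A <#> B"
    using e f A B by (simp add: set_multI subgroup.m_closed)
qed

lemma set_mult_sub_normalizes:
  assumes A: "subgroup A G" and N: "subgroup N G" and n: "normalizes A N"
  shows "subgroup (A <#> N) G"
proof (rule set_mult_sub[OF A N], rule subsetI)
  fix g assume "g \<in> N <#> A"
  then obtain x a where e: "x \<in> N" "a \<in> A" "g = x \<otimes> a" by (meson set_multE)
  have "cnj (inv a) x \<in> N" using e n A by (meson normalizesD subgroup.m_inv_closed)
  moreover have "g = a \<otimes> cnj (inv a) x"
    using e sub_in[OF A] sub_in[OF N] by (simp add: word_simps)
  ultimately show "g \<in> A <#> N" using e set_multI by blast
qed

lemma normalizes_set_mult:
  assumes "H \<subseteq> carrier G" "K \<subseteq> carrier G" "L \<subseteq> carrier G" "normalizes H K" "normalizes H L"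
  shows "normalizes H (K <#> L)"
  unfolding normalizes_def
proof (intro ballI)
  fix h x assume h: "h \<in> H" and "x \<in> K <#> L"
  then obtain a b where ab: "a \<in> K" "b \<in> L" "x = a \<otimes> b" by (meson set_multE)
  have "h \<in> carrier G" "a \<in> carrier G" "b \<in> carrier G" using h ab assms(1-3) by blast+
  then have "cnj h x = cnj h a \<otimes> cnj h b" using ab by (simp add: word_simps)
  then show "cnj h x \<in> K <#> L" using ab h normalizesD assms(4,5) set_multI by metis
qed

lemma set_mult_normalizes:
  assumes "A \<subseteq> carrier G" "B \<subseteq> carrier G" "K \<subseteq> carrier G" "normalizes A K" "normalizes B K"
  shows "normalizes (A <#> B) K"
  unfolding normalizes_def
proof (intro ballI)
  fix g k assume "g \<in> A <#> B" and k: "k \<in> K"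
  then obtain u v where uv: "u \<in> A" "v \<in> B" "g = u \<otimes> v" by (meson set_multE)
  have "u \<in> carrier G" "v \<in> carrier G" "k \<in> carrier G" using uv k assms(1-3) by blast+
  then have "cnj g k = cnj u (cnj v k)" using uv by (simp add: word_simps)
  then show "cnj g k \<in> K" using uv k normalizesD assms(4,5) by metis
qed

lemma centralizer_normal:
  assumes H: "subgroup H G" and K: "K \<subseteq> carrier G" and n: "normalizes H K"
  shows "normalizes H (centralizer G K)"
  unfolding normalizes_def
proof (intro ballI)
  fix g c assume g: "g \<in> H" and c: "c \<in> centralizer G K"
  have gc: "g \<in> carrier G" "c \<in> carrier G" using sub_in[OF H g] c by (auto simp: centralizer_def)
  have "cnj g c \<otimes> u = u \<otimes> cnj g c" if u: "u \<in> K" for u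
  proof -
    let ?v = "cnj (inv g) u"
    have uc: "u \<in> carrier G" using u K by blast
    have "?v \<in> K" by (rule normalizesD[OF n subgroup.m_inv_closed[OF H g] u])
    then have "c \<otimes> ?v = ?v \<otimes> c" using c by (auto simp: centralizer_def)
    then have "cnj g (c \<otimes> ?v) = cnj g (?v \<otimes> c)" by simp
    then show ?thesis using gc uc by (simp add: word_simps)
  qed
  then show "cnj g c \<in> centralizer G K" using gc by (simp add: centralizer_def)
qed

end

section \<open>Counting and Sylow subgroups\<close>

lemma card_fibres:
  assumes "finite A" "\<And>y. y \<in> f ` A \<Longrightarrow> card {x \<in> A. f x = y} = c"
  shows "card A = card (f ` A) * c"
proof -
  have "card A = (\<Sum>y\<in>f ` A. \<Sum>x\<in>{x \<in> A. f x = y}. 1)"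
    using sum.image_gen[OF assms(1), of "\<lambda>_. 1::nat" f] by simp
  also have "\<dots> = (\<Sum>y\<in>f ` A. c)" using assms(2) by (intro sum.cong) auto
  finally show ?thesis by simp
qed

context fin_group
begin

lemma set_mult_least: "subgroup H G \<Longrightarrow> A \<subseteq> H \<Longrightarrow> B \<subseteq> H \<Longrightarrow> A <#> B \<subseteq> H"
  by (auto simp: set_mult_def subgroup.m_closed subset_iff)

lemma card_cosets:
  assumes H: "subgroup H G" and K: "subgroup K G" "K \<subseteq> H"
  shows "card ((\<lambda>x. K #> x) ` H) * card K = card H"
proof -
  interpret H: fin_group "Sub H" using fin_sub[OF H] .
  have "rcosets\<^bsub>Sub H\<^esub> K = (\<lambda>x. K #> x) ` H"
    by (auto simp: RCOSETS_def)
  then show ?thesis using H.lagrange[of K] sub_sub_iff[OF H] K by (simp add: order_def)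
qed

lemma sub_index:
  assumes "subgroup H G" "subgroup K G" "K \<subseteq> H"
  obtains h where "card H = h * card K" "h > 0"
  using card_cosets[OF assms] sub_card_pos[OF assms(1)] by (metis mult_0 not_gr_zero)

lemma sub_card_dvd: "subgroup H G \<Longrightarrow> subgroup K G \<Longrightarrow> K \<subseteq> H \<Longrightarrow> card K dvd card H"
  by (metis sub_index dvd_triv_right)

lemma card_sub_order: "subgroup H G \<Longrightarrow> card H dvd order G"
  using sub_card_dvd[OF subgroup_self _ subgroup.subset] by (simp add: order_def)

lemma not_dvd_sub_index:
  assumes p: "prime (p::nat)" and H: "subgroup H G" "card H = p ^ k * r" "\<not> p dvd r"
    and U: "subgroup U G" "U \<subseteq> H" "card U = d * p ^ k"
  shows "\<not> p dvd d"
proof -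
  have "p ^ k * d dvd p ^ k * r" using sub_card_dvd[OF H(1) U(1,2)] U(3) H(2) by (simp add: mult.commute)
  then have "d dvd r" using p by (simp add: prime_gt_0_nat)
  then show ?thesis using H(3) dvd_trans by blast
qed

lemma card_set_mult:
  assumes A: "subgroup A G" and B: "subgroup B G"
  shows "card (A <#> B) * card (A \<inter> B) = card A * card B"
proof -
  let ?f = "\<lambda>(a, b). a \<otimes> b"
  note ic = sub_in[OF A] sub_in[OF B]
  have im: "?f ` (A \<times> B) = A <#> B" by (auto simp: set_mult_def)
  have "card (A \<times> B) = card (?f ` (A \<times> B)) * card (A \<inter> B)"
  proof (rule card_fibres)
    show "finite (A \<times> B)" using sub_fin A B by blast
    fix y assume "y \<in> ?f ` (A \<times> B)"
    then obtain a b where ab: "a \<in> A" "b \<in> B" "y = a \<otimes> b" by auto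
    \<comment> \<open>The factorisations of ab are exactly (ad, d^-1 b) with d in
      \<open>A \<inter> B\<close>.\<close>
    have "bij_betw (\<lambda>d. (a \<otimes> d, inv d \<otimes> b)) (A \<inter> B) {x \<in> A \<times> B. ?f x = y}"
    proof (rule bij_betwI')
      fix d e assume "d \<in> A \<inter> B" "e \<in> A \<inter> B"
      then show "((a \<otimes> d, inv d \<otimes> b) = (a \<otimes> e, inv e \<otimes> b)) = (d = e)"
        using ab ic by auto
    next
      fix d assume "d \<in> A \<inter> B"
      then show "(a \<otimes> d, inv d \<otimes> b) \<in> {x \<in> A \<times> B. ?f x = y}"
        using ab A B ic by (auto simp: subgroup.m_closed subgroup.m_inv_closed word_simps)
    next
      fix x assume "x \<in> {x \<in> A \<times> B. ?f x = y}"
      then obtain a' b' where x: "x = (a', b')" "a' \<in> A" "b' \<in> B" "a' \<otimes> b' = a \<otimes> b" using ab by auto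
      let ?d = "inv a \<otimes> a'"
      have d: "?d = b \<otimes> inv b'"
      proof -
        have "?d \<otimes> b' = b" using x ab ic by (simp add: word_simps)
        then show ?thesis using x ab ic by (metis inv_closed inv_solve_right m_closed)
      qed
      have "?d \<in> A \<inter> B" using x ab A B d by (metis IntI subgroup.m_closed subgroup.m_inv_closed)
      moreover have "x = (a \<otimes> ?d, inv ?d \<otimes> b)"
      proof -
        have "a' = a \<otimes> ?d" using x ab ic by (simp add: inv_cancel)
        moreover have "b' = inv ?d \<otimes> b" unfolding d using x ab ic by (simp add: word_simps)
        ultimately show ?thesis using x by blast
      qed
      ultimately show "\<exists>d\<in>A \<inter> B. x = (a \<otimes> d, inv d \<otimes> b)" by blast
    qed
    then show "card {x \<in> A \<times> B. ?f x = y} = card (A \<inter> B)" by (simp add: bij_betw_same_card)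
  qed
  then show ?thesis by (simp add: im card_cartesian_product)
qed

lemma sylow_exists:
  assumes p: "prime (p::nat)" and H: "subgroup H G"
  obtains P k r where "subgroup P G" "P \<subseteq> H" "card P = p ^ k" "card H = p ^ k * r" "\<not> p dvd r"
proof -
  interpret H: fin_group "Sub H" using fin_sub[OF H] .
  obtain k r where kr: "order (Sub H) = p ^ k * r" "\<not> p dvd r"
    using H.prime_split[OF p] by metis
  then obtain P where "subgroup P (Sub H)" "card P = p ^ k"
    using Sylow.sylow_thm[of p "Sub H"] p H.fin H.is_group by blast
  then show ?thesis using that[of P k r] kr sub_sub_iff[OF H] by (simp add: order_def)
qed

text \<open>For a prime \<open>q\<close> dividing both \<open>a\<close> and \<open>h\<close>, a
  Sylow \<open>q\<close>-subgroup of \<open>H\<close> has order dividing \<open>a\<close>, as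
  \<open>b\<close> has no factor \<open>q\<close>. So it lies in \<open>K\<close>, and
  \<open>q\<close> cannot divide the index.\<close>

lemma coprime_index:
  assumes H: "subgroup H G" and K: "subgroup K G" "K \<subseteq> H"
    and ab: "order G = a * b" "coprime a b"
    and x: "\<And>x. x \<in> H \<Longrightarrow> x [^] a = \<one> \<Longrightarrow> x \<in> K" and h: "card H = h * card K"
  shows "coprime a h"
proof (rule ccontr)
  assume "\<not> coprime a h"
  then obtain q where q: "prime q" "q dvd a" "q dvd h"
    by (metis coprime_iff_gcd_eq_1 dvd_trans gcd_dvd1 gcd_dvd2 prime_factor_nat)
  obtain Q m r where Q: "subgroup Q G" "Q \<subseteq> H" "card Q = q ^ m" "card H = q ^ m * r" "\<not> q dvd r"
    using sylow_exists[OF q(1) H] .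
  have "q ^ m dvd a * b" using card_sub_order[OF Q(1)] Q(3) ab(1) by simp
  moreover have "coprime (q ^ m) b" using q(2) ab(2)
    by (meson coprime_divisors coprime_power_left_iff dvd_refl)
  ultimately have qa: "q ^ m dvd a" using coprime_dvd_mult_left_iff by blast
  have "Q \<subseteq> K"
  proof
    fix y assume y: "y \<in> Q"
    have "y [^] a = \<one>" using one_pow_dvd[OF sub_in[OF Q(1) y]] pow_card[OF Q(1) y] Q(3) qa by simp
    then show "y \<in> K" using x y Q(2) by blast
  qed
  then have "q ^ m dvd card K" using sub_card_dvd[OF K(1) Q(1)] Q(3) by simp
  then have "q * q ^ m dvd h * card K" using q(3) mult_dvd_mono by blast
  then have "q ^ m * q dvd q ^ m * r" using h Q(4) by (simp add: mult.commute)
  then show False using Q(5) q(1) by (simp add: prime_gt_0_nat)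
qed

text \<open>Lagrange's theorem in the quotient of \<open>H\<close> by \<open>N\<close>, brought back
  to elements.\<close>

lemma index_pow:
  assumes H: "subgroup H G" and N: "subgroup N G" "N \<subseteq> H" "normalizes H N"
    and h: "card H = h * card N" and x: "x \<in> H"
  shows "x [^] h \<in> N"
proof -
  interpret H: fin_group "Sub H" using fin_sub[OF H] .
  have nN: "N \<lhd> Sub H" using normal_sub_iff[OF H] N by blast
  then interpret N: normal N "Sub H" .
  let ?Q = "Sub H Mod N"
  interpret Q: group ?Q by (rule N.factorgroup_is_group)
  have "order ?Q * card N = card H"
    using H.lagrange[OF N.subgroup_axioms] by (simp add: order_def FactGroup_def)
  then have o: "order ?Q = h" using h sub_card_pos[OF N(1)] by simp
  have "N #>\<^bsub>Sub H\<^esub> x \<in> carrier ?Q" using x by (auto simp: carrier_FactGroup)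
  then have "(N #>\<^bsub>Sub H\<^esub> x) [^]\<^bsub>?Q\<^esub> h = N" using Q.pow_order_eq_1 o by simp
  then have "N #> (x [^] h) = N" using N.FactGroup_pow[of x h] x by (simp add: nat_pow_consistent[symmetric])
  then show ?thesis using coset_join1 N(1) sub_in[OF H x] by simp
qed

text \<open>Counting in place of passing to the quotient by \<open>N\<close>.\<close>

lemma factor_part_mem:
  assumes A: "subgroup A G" and B: "subgroup B G" and AB: "subgroup (A <#> B) G"
    and N: "subgroup N G" "N \<subseteq> A <#> B" "normalizes A N" "normalizes B N"
    and ab: "order G = a * b" "coprime a b"
    and xA: "\<And>x. x \<in> A \<Longrightarrow> x [^] a = \<one> \<Longrightarrow> x \<in> N"
    and xB: "\<And>x. x \<in> B \<Longrightarrow> x [^] a = \<one> \<Longrightarrow> x \<in> N"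
    and x: "x \<in> A <#> B" "x [^] a = \<one>"
  shows "x \<in> N"
proof -
  let ?H = "A <#> B" let ?U = "A <#> N" let ?V = "B <#> N"
  have A1: "A \<subseteq> ?H" and B1: "B \<subseteq> ?H" using sub_set_mult_left sub_set_mult_right A B by blast+
  have U: "subgroup ?U G" and V: "subgroup ?V G"
    using set_mult_sub_normalizes A B N by blast+
  have UH: "?U \<subseteq> ?H" "?V \<subseteq> ?H"
    using A1 B1 N(2) AB by (simp_all add: set_mult_least)
  obtain \<alpha> where \<alpha>: "card A = \<alpha> * card (A \<inter> N)"
    using sub_index[OF A sub_Int[OF A N(1)]] by blast
  obtain \<beta> where \<beta>: "card B = \<beta> * card (B \<inter> N)"
    using sub_index[OF B sub_Int[OF B N(1)]] by blast
  have c\<alpha>: "coprime a \<alpha>"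
    using coprime_index[OF A sub_Int[OF A N(1)] _ ab _ \<alpha>] xA by blast
  have c\<beta>: "coprime a \<beta>"
    using coprime_index[OF B sub_Int[OF B N(1)] _ ab _ \<beta>] xB by blast
  have "card ?U * card (A \<inter> N) = \<alpha> * card N * card (A \<inter> N)"
    using card_set_mult[OF A N(1)] unfolding \<alpha> by auto
  then have cU: "card ?U = \<alpha> * card N" 
    using sub_card_pos[OF sub_Int[OF A N(1)]] by (metis mult_cancel2 less_not_refl)
  have "card ?V * card (B \<inter> N) = \<beta> * card N * card (B \<inter> N)"
    using card_set_mult[OF B N(1)] unfolding \<beta> by auto
  then have cV: "card ?V = \<beta> * card N" 
    using sub_card_pos[OF sub_Int[OF B N(1)]] by (metis mult_cancel2 less_not_refl)
  have "N \<subseteq> ?U \<inter> ?V" using sub_set_mult_right A B N(1) by blast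
  then obtain k where k: "card (?U \<inter> ?V) = k * card N" "k > 0"
    using sub_index[OF sub_Int[OF U V] N(1)] by blast
  obtain h where h: "card ?H = h * card N" using sub_index[OF AB N(1,2)] by blast
  have "?U <#> ?V = ?H"
  proof
    show "?U <#> ?V \<subseteq> ?H" using UH AB by (simp add: set_mult_least)
    have "A \<subseteq> ?U" "B \<subseteq> ?V" using sub_set_mult_left A B N(1) by blast+
    then show "?H \<subseteq> ?U <#> ?V" by (rule mono_set_mult)
  qed
  \<comment> \<open>Over \<open>N\<close> this reads |H:N| |AN \<inter> BN : N| = |AN:N| |BN:N|.
    Both indices on the right are prime to \<open>a\<close>, hence so is |H:N|.\<close>
  then have "h * card N * (k * card N) = \<alpha> * card N * (\<beta> * card N)"
    using card_set_mult[OF U V] h k(1) cU cV by simp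
  then have "h * k = \<alpha> * \<beta>" using sub_card_pos[OF N(1)] by (simp add: ac_simps)
  then have "coprime a (h * k)" using c\<alpha> c\<beta> by simp
  then have ch: "coprime h a" by (simp add: coprime_commute)
  have "normalizes ?H N"
    by (rule set_mult_normalizes) (use A B N subgroup.subset in auto)
  then have "x [^] h \<in> N" using index_pow[OF AB N(1,2) _ h x(1)] by blast
  then show ?thesis using mem_of_pow[OF N(1) sub_in[OF AB x(1)] _ x(2) ch] by blast
qed

text \<open>An orbit with more than one point has length divisible by \<open>p\<close>; the
  induction removes one such orbit at a time. The action is a plain function \<open>f\<close>, so
  that both translation and conjugation of cosets fit.\<close>

lemma p_group_fixed:
  assumes p: "prime (p::nat)" and P: "subgroup P G" "card P = p ^ k" and fin\<Omega>: "finite \<Omega>"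
    and cl: "\<And>u w. u \<in> P \<Longrightarrow> w \<in> \<Omega> \<Longrightarrow> f u w \<in> \<Omega>" and one: "\<And>w. w \<in> \<Omega> \<Longrightarrow> f \<one> w = w"
    and mult: "\<And>u v w. u \<in> P \<Longrightarrow> v \<in> P \<Longrightarrow> w \<in> \<Omega> \<Longrightarrow> f (u \<otimes> v) w = f u (f v w)"
  shows "[card {w \<in> \<Omega>. \<forall>u\<in>P. f u w = w} = card \<Omega>] (mod p)"
  using fin\<Omega> cl one mult
proof (induction \<Omega> rule: finite_psubset_induct)
  case (psubset \<Omega>)
  note cl = psubset.prems(1) and one = psubset.prems(2) and mult = psubset.prems(3)
  show ?case
  proof (cases "\<forall>w\<in>\<Omega>. \<forall>u\<in>P. f u w = w")
    case True
    then have "{w \<in> \<Omega>. \<forall>u\<in>P. f u w = w} = \<Omega>" by blast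
    then show ?thesis by simp
  next
    case False
    then obtain w where w: "w \<in> \<Omega>" "\<not> (\<forall>u\<in>P. f u w = w)" by blast
    let ?O = "(\<lambda>u. f u w) ` P"
    let ?S = "{u \<in> P. f u w = w}"
    have inv_f: "f (inv u) (f u v) = v" if "u \<in> P" "v \<in> \<Omega>" for u v
      using mult[of "inv u" u v] that P one sub_in[OF P(1)] by (simp add: subgroup.m_inv_closed)
    \<comment> \<open>Orbit-stabiliser theorem: the fibre of the orbit map over \<open>f v w\<close>
      is the stabiliser multiplied by \<open>v\<close>.\<close>
    have "card P = card ?O * card ?S"
    proof (rule card_fibres)
      show "finite P" by (rule sub_fin[OF P(1)])
      fix y assume "y \<in> ?O"
      then obtain v where v: "v \<in> P" "y = f v w" by blast
      have "bij_betw (\<lambda>u. v \<otimes> u) ?S {u \<in> P. f u w = y}"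
      proof (rule bij_betwI')
        fix u u' assume "u \<in> ?S" "u' \<in> ?S"
        then show "(v \<otimes> u = v \<otimes> u') = (u = u')" using v sub_in[OF P(1)] by simp
      next
        fix u assume "u \<in> ?S"
        then show "v \<otimes> u \<in> {u \<in> P. f u w = y}"
          using v mult w P(1) by (simp add: subgroup.m_closed)
      next
        fix u assume u: "u \<in> {u \<in> P. f u w = y}"
        then have "inv v \<otimes> u \<in> ?S"
          using mult[of "inv v" u w] v w P(1) inv_f by (simp add: subgroup.m_closed subgroup.m_inv_closed)
        moreover have "u = v \<otimes> (inv v \<otimes> u)" using u v sub_in[OF P(1)] by (simp add: inv_cancel)
        ultimately show "\<exists>z\<in>?S. u = v \<otimes> z" by blast
      qed
      then show "card {u \<in> P. f u w = y} = card ?S" by (simp add: bij_betw_same_card)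
    qed
    then have "card ?O dvd p ^ k" using P(2) by (metis dvd_triv_left)
    then obtain i where i: "card ?O = p ^ i" using p divides_primepow_nat by blast
    have oneP: "\<one> \<in> P" by (rule subgroup.one_closed[OF P(1)])
    have "i \<noteq> 0"
    proof
      assume "i = 0"
      then have "card ?O = 1" using i by simp
      then obtain z where z: "?O = {z}" using card_1_singletonE by blast
      then have "f u w = f \<one> w" if "u \<in> P" for u 
      proof -
        have "f u w \<in> ?O" "f \<one> w \<in> ?O" using that oneP by blast+
        then show ?thesis using z by simp
      qed
      then have "\<forall>u\<in>P. f u w = w" using one[OF w(1)] by simp
      then show False using w(2) by blast
    qed
    then have pO: "p dvd card ?O" using i by simp
    have Osub: "?O \<subseteq> \<Omega>" using cl w by blast
    have wO: "w \<in> ?O" using one[OF w(1)] oneP by force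
    have stab: "f u v \<in> \<Omega> - ?O" if "u \<in> P" "v \<in> \<Omega> - ?O" for u v
    proof -
      have "f u v \<notin> ?O"
      proof
        assume "f u v \<in> ?O"
        then obtain z where z: "z \<in> P" "f u v = f z w" by blast
        have "v = f (inv u) (f u v)" using inv_f that by simp
        also have "\<dots> = f (inv u \<otimes> z) w" using mult[of "inv u" z w] z w that(1) P(1) by (simp add: subgroup.m_inv_closed)
        finally show False using that z P(1) by (simp add: subgroup.m_closed subgroup.m_inv_closed)
      qed
      then show ?thesis using cl that by blast
    qed
    have "[card {v \<in> \<Omega> - ?O. \<forall>u\<in>P. f u v = v} = card (\<Omega> - ?O)] (mod p)"
      by (rule psubset.IH) (use wO w stab one mult in auto)
    moreover have "{v \<in> \<Omega> - ?O. \<forall>u\<in>P. f u v = v} = {v \<in> \<Omega>. \<forall>u\<in>P. f u v = v}"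
    proof -
      have "v \<notin> ?O" if v: "v \<in> \<Omega>" "\<forall>u\<in>P. f u v = v" for v
      proof
        assume "v \<in> ?O"
        then obtain u where u: "u \<in> P" "v = f u w" by blast
        have "f (inv u) v = v" using v u P(1) by (simp add: subgroup.m_inv_closed)
        then have "v = w" using inv_f u w by simp
        then show False using v w by blast
      qed
      then show ?thesis by blast
    qed
    moreover have "card \<Omega> = card (\<Omega> - ?O) + card ?O"
      using Osub psubset.hyps(1) by (metis card_Diff_subset card_mono finite_subset le_add_diff_inverse2)
    moreover have "[card (\<Omega> - ?O) + card ?O = card (\<Omega> - ?O) + 0] (mod p)"
      using pO by (intro cong_add) (simp_all add: cong_0_iff)
    ultimately show ?thesis by (simp add: cong_def)
  qed
qed

text \<open>\<open>P\<close> acts on the cosets of \<open>Q\<close> in \<open>H\<close> by right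
  translation with inverses. Their number \<open>r\<close> is prime to \<open>p\<close>, so some
  coset Qx is fixed, and then x conjugates \<open>P\<close> into \<open>Q\<close>.\<close>

lemma sylow_conj:
  assumes p: "prime (p::nat)" and H: "subgroup H G"
    and P: "subgroup P G" "P \<subseteq> H" "card P = p ^ j"
    and Q: "subgroup Q G" "Q \<subseteq> H" "card Q = p ^ k" "card H = p ^ k * r" "\<not> p dvd r"
  obtains h where "h \<in> H" "\<And>u. u \<in> P \<Longrightarrow> cnj h u \<in> Q"
proof -
  let ?\<Omega> = "(\<lambda>x. Q #> x) ` H" let ?f = "\<lambda>u C. C #> inv u"
  note ic = sub_in[OF P(1)] sub_in[OF Q(1)] sub_in[OF H]
  have Qc: "Q \<subseteq> carrier G" using ic by blast
  have HP: "u \<in> P \<Longrightarrow> u \<in> H" for u using P by blast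
  have "card ?\<Omega> * p ^ k = p ^ k * r" using card_cosets[OF H Q(1,2)] Q by simp
  then have c: "card ?\<Omega> = r" using p by (simp add: prime_gt_0_nat)
  have fx: "?f u (Q #> x) = Q #> (x \<otimes> inv u)" if "u \<in> P" "x \<in> H" for u x
    using coset_mult_assoc[OF Qc, of x "inv u"] ic that by simp
  have "[card {w \<in> ?\<Omega>. \<forall>u\<in>P. ?f u w = w} = card ?\<Omega>] (mod p)"
  proof (rule p_group_fixed[OF p P(1,3)])
    show "finite ?\<Omega>" using sub_fin[OF H] by blast
    fix u w assume u: "u \<in> P" and w: "w \<in> ?\<Omega>"
    then obtain x where x: "x \<in> H" "w = Q #> x" by blast
    show "?f u w \<in> ?\<Omega>"
      using fx u x H HP by (simp add: subgroup.m_closed subgroup.m_inv_closed)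
    fix v assume v: "v \<in> P"
    have "x \<otimes> inv v \<in> H" using x v H HP by (simp add: subgroup.m_closed subgroup.m_inv_closed)
    then show "?f (u \<otimes> v) w = ?f u (?f v w)"
      using fx[of "u \<otimes> v" x] fx[OF v x(1)] fx[OF u, of "x \<otimes> inv v"] x u v ic
        subgroup.m_closed[OF P(1) u v]
      by (simp add: inv_mult_group m_assoc)
  next
    fix w assume "w \<in> ?\<Omega>"
    then obtain x where x: "x \<in> H" "w = Q #> x" by blast
    then show "?f \<one> w = w" using coset_mult_one r_coset_subset_G Qc ic by simp
  qed
  then have "card {w \<in> ?\<Omega>. \<forall>u\<in>P. ?f u w = w} \<noteq> 0"
    using Q(5) c by (metis cong_0_iff cong_sym)
  then have "{w \<in> ?\<Omega>. \<forall>u\<in>P. ?f u w = w} \<noteq> {}" by (metis card.empty)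
  then obtain w where w: "w \<in> ?\<Omega>" "\<forall>u\<in>P. ?f u w = w" by blast
  then obtain x where x: "x \<in> H" "w = Q #> x" by blast
  have "cnj x u \<in> Q" if u: "u \<in> P" for u
  proof -
    have "Q #> (x \<otimes> u) = Q #> x"
      using fx[of "inv u" x] bspec[OF w(2), of "inv u"] x u P(1) ic by (simp add: subgroup.m_inv_closed)
    then have "x \<otimes> u \<in> Q #> x" using rcos_self[of "x \<otimes> u" Q] Q(1) x u ic by simp
    then obtain q where "q \<in> Q" "x \<otimes> u = q \<otimes> x" by (auto simp: r_coset_def)
    then show ?thesis using x u ic by (simp add: m_assoc)
  qed
  then show ?thesis using that x by blast
qed

end

section \<open>Nilpotency and elements of coprime orders\<close>

text \<open>Stated with powers rather than with \<open>ord\<close>, so that it does not depend on the carrier.\<close>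

definition cop_orders :: "('a, 'b) monoid_scheme \<Rightarrow> 'a \<Rightarrow> 'a \<Rightarrow> bool" where
  "cop_orders G x y \<longleftrightarrow> (\<exists>m n :: nat. coprime m n \<and> x [^]\<^bsub>G\<^esub> m = \<one>\<^bsub>G\<^esub> \<and> y [^]\<^bsub>G\<^esub> n = \<one>\<^bsub>G\<^esub>)"

lemma pow_carrier_update [simp]: "x [^]\<^bsub>G\<lparr>carrier := H\<rparr>\<^esub> (n::nat) = x [^]\<^bsub>G\<^esub> n"
  by (simp add: nat_pow_def)

lemma cop_orders_carrier_update [simp]: "cop_orders (G\<lparr>carrier := H\<rparr>) x y = cop_orders G x y"
  by (simp add: cop_orders_def)

context fin_group
begin

lemma cop_ordersI: "x [^] (m::nat) = \<one> \<Longrightarrow> y [^] (n::nat) = \<one> \<Longrightarrow> coprime m n \<Longrightarrow> cop_orders G x y"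
  by (auto simp: cop_orders_def)

lemma cop_orders_sym: "cop_orders G x y \<Longrightarrow> cop_orders G y x"
  by (metis cop_orders_def coprime_commute)

lemma cop_orders_parts:
  assumes c: "cop_orders G x y" and x: "x \<in> carrier G" and y: "y \<in> carrier G"
  obtains a b where "order G = a * b" "coprime a b" "x [^] a = \<one>" "y [^] b = \<one>"
proof -
  obtain m n :: nat where mn: "coprime m n" "x [^] m = \<one>" "y [^] n = \<one>"
    using c by (auto simp: cop_orders_def)
  obtain a b where ab: "order G = a * b" "coprime a b" "coprime m b" "coprime n a"
    using coprime_split[OF mn(1)] .
  have "order G = b * a" using ab by simp
  then show ?thesis using that ab one_pow_part mn x y by blast
qed

section \<open>The lower central series and nilpotency in terms of coprime orders\<close>

lemma comm_set_conj_closed: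
  assumes K: "K \<lhd> G" and g: "g \<in> carrier G"
    and c: "c \<in> {h \<otimes> k \<otimes> inv h \<otimes> inv k | h k. h \<in> carrier G \<and> k \<in> K}"
  shows "cnj g c \<in> {h \<otimes> k \<otimes> inv h \<otimes> inv k | h k. h \<in> carrier G \<and> k \<in> K}"
proof -
  obtain h k where hk: "h \<in> carrier G" "k \<in> K" "c = cmt h k" using c by blast
  have "k \<in> carrier G" using K hk normal_imp_subgroup sub_in by blast
  then have "cnj g c = cmt (cnj g h) (cnj g k)" using hk g by (simp add: word_simps)
  moreover have "cnj g k \<in> K" using K hk g by (simp add: normal.inv_op_closed2)
  ultimately show ?thesis using hk g by blast
qed

lemma comm_subgroup_normal:
  assumes K: "K \<lhd> G"
  shows "comm_subgroup G (carrier G) K \<lhd> G"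
  unfolding comm_subgroup_def
proof (rule normal_generateI)
  have "K \<subseteq> carrier G" using K normal_imp_subgroup subgroup.subset by blast
  then show "{h \<otimes> k \<otimes> inv h \<otimes> inv k | h k. h \<in> carrier G \<and> k \<in> K} \<subseteq> carrier G" by auto
qed (use comm_set_conj_closed[OF K] in blast)

lemma lower_central_Suc: "lower_central G (Suc n) = comm_subgroup G (carrier G) (lower_central G n)"
  by (simp add: lower_central_def)

lemma lower_central_normal: "lower_central G n \<lhd> G"
proof (induction n)
  case 0 then show ?case using normal_self by (simp add: lower_central_def)
next
  case (Suc n) then show ?case using comm_subgroup_normal lower_central_Suc by simp
qed

text \<open>In the quotient by [G, K] the image of \<open>cmt x y\<close> is central because
  \<open>cmt x y\<close> lies in \<open>K\<close>, and a central commutator of elements of coprime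
  orders is trivial. So such commutators descend the lower central series.\<close>

lemma cop_orders_cmt_descend:
  assumes K: "K \<lhd> G" and x: "x \<in> carrier G" and y: "y \<in> carrier G" and c: "cop_orders G x y"
    and xy: "cmt x y \<in> K"
  shows "cmt x y \<in> comm_subgroup G (carrier G) K"
proof -
  let ?N = "comm_subgroup G (carrier G) K" let ?z = "cmt x y" let ?h = "\<lambda>a. ?N #> a"
  have N: "?N \<lhd> G" by (rule comm_subgroup_normal[OF K])
  interpret N: normal ?N G by (rule N)
  interpret Q: group "G Mod ?N" by (rule N.factorgroup_is_group)
  interpret Q: fin_group "G Mod ?N"
    by unfold_locales (simp add: carrier_FactGroup fin)
  interpret h: group_hom G "G Mod ?N" ?h
    by (simp add: group_hom_def group_hom_axioms_def N.r_coset_hom_Mod Q.is_group)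
  have ker: "a \<in> ?N \<longleftrightarrow> ?h a = \<one>\<^bsub>G Mod ?N\<^esub>" if "a \<in> carrier G" for a
    using that coset_join1[of ?N a] coset_join2[of a ?N] N.subgroup_axioms by (auto simp: N.subset)
  have zc: "?z \<in> carrier G" using x y by simp
  have comm_z: "?h ?z \<otimes>\<^bsub>G Mod ?N\<^esub> ?h g = ?h g \<otimes>\<^bsub>G Mod ?N\<^esub> ?h ?z" if g: "g \<in> carrier G" for g
  proof -
    have "cmt g ?z \<in> ?N" unfolding comm_subgroup_def using g xy by (blast intro: generate.incl)
    then have "?h (cmt g ?z) = \<one>\<^bsub>G Mod ?N\<^esub>" using ker g zc by (metis inv_closed m_closed)
    moreover have "?h (cmt g ?z) = Q.cmt (?h g) (?h ?z)"
      using g zc h.hom_mult h.hom_inv by (metis inv_closed m_closed)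
    ultimately show ?thesis using Q.commute_iff_cmt h.hom_closed g zc by metis
  qed
  obtain m n :: nat where mn: "coprime m n" "x [^] m = \<one>" "y [^] n = \<one>"
    using c by (auto simp: cop_orders_def)
  have "?h ?z = Q.cmt (?h x) (?h y)"
    using x y h.hom_mult h.hom_inv by (metis inv_closed m_closed)
  moreover have "?h x [^]\<^bsub>G Mod ?N\<^esub> m = \<one>\<^bsub>G Mod ?N\<^esub>" "?h y [^]\<^bsub>G Mod ?N\<^esub> n = \<one>\<^bsub>G Mod ?N\<^esub>"
    using x y mn h.hom_nat_pow h.hom_one by metis+
  ultimately have "?h x \<otimes>\<^bsub>G Mod ?N\<^esub> ?h y = ?h y \<otimes>\<^bsub>G Mod ?N\<^esub> ?h x"
    using Q.central_cmt_coprime[of "?h x" m "?h y" n "?h ?z"] comm_z x y mn(1) h.hom_closed by blast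
  then have "?h ?z = \<one>\<^bsub>G Mod ?N\<^esub>"
    using Q.commute_iff_cmt x y h.hom_closed \<open>?h ?z = Q.cmt (?h x) (?h y)\<close> by metis
  then show ?thesis using ker zc by blast
qed

lemma nilpotent_cop_commute:
  assumes nil: "nilpotent_grp G" and x: "x \<in> carrier G" and y: "y \<in> carrier G" and c: "cop_orders G x y"
  shows "x \<otimes> y = y \<otimes> x"
proof -
  have "cmt x y \<in> lower_central G n" for n
  proof (induction n)
    case 0 then show ?case using x y by (simp add: lower_central_def)
  next
    case (Suc n)
    then show ?case using cop_orders_cmt_descend[OF lower_central_normal x y c] lower_central_Suc by simp
  qed
  then have "cmt x y = \<one>" using nil by (auto simp: nilpotent_grp_def)
  then show ?thesis using commute_iff_cmt x y by blast
qed

text \<open>The index of \<open>T\<close> divides \<open>b\<close> because \<open>a\<close> divides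
  \<open>card T\<close>, and is prime to \<open>b\<close> because \<open>T\<close> contains every
  element killed by \<open>b\<close>. This serves to recognise a normaliser, or a centraliser modulo
  a subgroup, as the whole group.\<close>

lemma eq_carrier_of_parts:
  assumes T: "subgroup T G" and ab: "order G = a * b" "coprime a b" and a: "a dvd card T"
    and b: "\<And>x. x \<in> carrier G \<Longrightarrow> x [^] b = \<one> \<Longrightarrow> x \<in> T"
  shows "T = carrier G"
proof -
  have Tc: "T \<subseteq> carrier G" by (rule subgroup.subset[OF T])
  obtain h where h: "card (carrier G) = h * card T" using sub_index[OF subgroup_self T Tc] .
  have ba: "order G = b * a" "coprime b a" using ab by (simp_all add: coprime_commute)
  have "coprime b h" by (rule coprime_index[OF subgroup_self T Tc ba b h])
  moreover obtain c where "card T = a * c" using a by blast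
  then have "a * b = a * (c * h)" using h ab by (metis mult.assoc mult.commute order_def)
  moreover have "0 < a * b" using ab fin order_gt_0_iff_finite by metis
  ultimately have "coprime (c * h) h" by auto
  then have "h = 1" by simp
  then show ?thesis using h card_subset_eq[OF fin Tc] by simp
qed

text \<open>Sylow subgroups of the nilpotent quotient by \<open>N\<close> are normal, phrased
  upstairs. The normaliser of \<open>P <#> N\<close> contains \<open>P\<close>, and also every
  \<open>v\<close> killed by \<open>b\<close>, since v u v^-1 = [v, u] u with [v, u] in
  \<open>N\<close>.\<close>

lemma sylow_mod:
  assumes p: "prime (p::nat)" and o: "order G = p ^ k * b" "\<not> p dvd b"
    and P: "subgroup P G" "card P = p ^ k"
    and N: "subgroup N G" "normalizes (carrier G) N"
    and c: "\<And>u v. u \<in> carrier G \<Longrightarrow> v \<in> carrier G \<Longrightarrow> cop_orders G u v \<Longrightarrow> cmt u v \<in> N"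
  shows "subgroup (P <#> N) G" "normalizes (carrier G) (P <#> N)"
    "\<And>x. x \<in> carrier G \<Longrightarrow> x [^] (p ^ j) = \<one> \<Longrightarrow> x \<in> P <#> N"
proof -
  have cop_orders: "coprime (p ^ k) b" using p o(2) prime_power_coprime by blast
  let ?U = "P <#> N"
  show U: "subgroup ?U G"
    using set_mult_sub_normalizes[OF P(1) N(1) normalizes_mono[OF N(2)]] P(1) subgroup.subset by blast
  have PU: "P \<subseteq> ?U" and NU: "N \<subseteq> ?U" using sub_set_mult_left sub_set_mult_right P N by blast+
  let ?T = "{g \<in> carrier G. normalizes {g} ?U}"
  have T: "subgroup ?T G" by (rule normalizer_sub[OF subgroup.subset[OF U]])
  have "P \<subseteq> ?T" using PU sub_in[OF P(1)] cnj_sub[OF U] by (auto simp: normalizes_def)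
  then have "p ^ k dvd card ?T" using sub_card_dvd[OF T P(1)] P(2) by simp
  moreover have "v \<in> ?T" if v: "v \<in> carrier G" "v [^] b = \<one>" for v
  proof -
    have "cnj v w \<in> ?U" if "w \<in> ?U" for w
    proof -
      obtain u n where un: "u \<in> P" "n \<in> N" "w = u \<otimes> n" using \<open>w \<in> ?U\<close> by (rule set_multE)
      have uc: "u \<in> carrier G" "n \<in> carrier G" using un sub_in P(1) N(1) by auto
      have "cop_orders G v u" using cop_ordersI[OF v(2), of u "p ^ k"] pow_card[OF P(1) un(1)] P(2) cop_orders
        by (simp add: coprime_commute)
      then have "cmt v u \<in> ?U" using c v uc NU by blast
      moreover have "cnj v n \<in> ?U" using normalizesD[OF N(2) v(1) un(2)] NU by blast
      moreover have "cnj v w = cmt v u \<otimes> u \<otimes> cnj v n" using un uc v by (simp add: word_simps)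
      ultimately show ?thesis
        using subgroup.m_closed[OF U subgroup.m_closed[OF U _ subsetD[OF PU un(1)]]] by simp
    qed
    then show ?thesis using v by (simp add: normalizes_def)
  qed
  ultimately have "?T = carrier G" using eq_carrier_of_parts[OF T o(1) cop_orders] by blast
  then show n: "normalizes (carrier G) ?U" by (auto simp: normalizes_def)
  fix x assume x: "x \<in> carrier G" "x [^] (p ^ j) = \<one>"
  obtain h where h: "card (carrier G) = h * card ?U"
    using sub_index[OF subgroup_self U subgroup.subset[OF U]] .
  have "p ^ k dvd card ?U" using sub_card_dvd[OF U P(1) PU] P(2) by simp
  then obtain e where "card ?U = p ^ k * e" by blast
  then have "b = h * e" using h o(1) p by (simp add: order_def prime_gt_0_nat)
  then have "\<not> p dvd h" using o(2) by auto
  then have "coprime h (p ^ j)" using p prime_power_coprime by blast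
  moreover have "x [^] h \<in> ?U" using index_pow[OF subgroup_self U subgroup.subset[OF U] n h x(1)] .
  ultimately show "x \<in> ?U" using mem_of_pow[OF U x(1) _ x(2)] by blast
qed

lemma normalizes_one: "normalizes (carrier G) {\<one>}"
  by (simp add: normalizes_def)

lemma cop_orders_commute_sylow:
  assumes c: "\<And>x y. x \<in> carrier G \<Longrightarrow> y \<in> carrier G \<Longrightarrow> cop_orders G x y \<Longrightarrow> x \<otimes> y = y \<otimes> x"
    and p: "prime (p::nat)" and o: "order G = p ^ k * b" "\<not> p dvd b"
    and P: "subgroup P G" "card P = p ^ k"
  shows "normalizes (carrier G) P" "\<And>x. x \<in> carrier G \<Longrightarrow> x [^] (p ^ j) = \<one> \<Longrightarrow> x \<in> P"
proof -
  have "P <#> {\<one>} = P" 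
    using coset_mult_one[OF subgroup.subset[OF P(1)]] by (simp add: r_coset_eq_set_mult)
  moreover have "cmt u v \<in> {\<one>}" if "u \<in> carrier G" "v \<in> carrier G" "cop_orders G u v" for u v
    using commute_iff_cmt c that by simp
  ultimately show "normalizes (carrier G) P" "\<And>x. x \<in> carrier G \<Longrightarrow> x [^] (p ^ j) = \<one> \<Longrightarrow> x \<in> P"
    using sylow_mod[OF p o P triv_subgroup normalizes_one] by metis+
qed

text \<open>The quotient by \<open>K\<close> has a non-trivial centre. For a prime \<open>p\<close>
  dividing the index of \<open>K\<close>, the Sylow subgroup \<open>P\<close> acts by conjugation on
  the cosets of \<open>P \<inter> K\<close> in \<open>P\<close>. The number of fixed cosets is
  divisible by \<open>p\<close>, so a non-trivial one is fixed. Its representative is centralised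
  modulo \<open>K\<close> by \<open>P\<close>, and by the p'-elements by hypothesis.\<close>

lemma cop_orders_commute_central_mod:
  assumes c: "\<And>x y. x \<in> carrier G \<Longrightarrow> y \<in> carrier G \<Longrightarrow> cop_orders G x y \<Longrightarrow> x \<otimes> y = y \<otimes> x"
    and K: "subgroup K G" "normalizes (carrier G) K" "K \<noteq> carrier G"
  obtains x where "x \<in> carrier G" "x \<notin> K" "\<And>g. g \<in> carrier G \<Longrightarrow> cmt g x \<in> K"
proof -
  obtain h where h: "card (carrier G) = h * card K"
    using sub_index[OF subgroup_self K(1) subgroup.subset[OF K(1)]] .
  have "h \<noteq> 1" using h K card_subset_eq[OF fin subgroup.subset[OF K(1)]] by auto
  then obtain p where p: "prime p" "p dvd h" using prime_factor_nat by blast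
  obtain P k b where P: "subgroup P G" "card P = p ^ k" and o: "order G = p ^ k * b" "\<not> p dvd b"
    using sylow_exists[OF p(1) subgroup_self] unfolding order_def by metis
  have cop_orders: "coprime (p ^ k) b" using p(1) o(2) prime_power_coprime by blast
  let ?D = "P \<inter> K" let ?\<Omega> = "(\<lambda>x. ?D #> x) ` P" let ?f = "\<lambda>u C. cnj u ` C"
  have D: "subgroup ?D G" by (rule sub_Int[OF P(1) K(1)])
  note ic = sub_in[OF P(1)] sub_in[OF K(1)]
  have PK: "\<not> P \<subseteq> K"
  proof
    assume "P \<subseteq> K"
    then have "p ^ k dvd card K" using sub_card_dvd[OF K(1) P(1)] P(2) by simp
    then have "p * p ^ k dvd h * card K" using p(2) mult_dvd_mono by blast
    then have "p ^ k * p dvd p ^ k * b" using h o(1) by (simp add: mult.commute order_def)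
    then show False using o(2) p(1) by (simp add: prime_gt_0_nat)
  qed
  have Dn: "cnj u d \<in> ?D" if "u \<in> P" "d \<in> ?D" for u d
    using that cnj_sub[OF P(1)] normalizesD[OF K(2)] ic by blast
  have fx: "?f u (?D #> x) = ?D #> cnj u x" if u: "u \<in> P" and x: "x \<in> P" for u x
  proof
    show "?f u (?D #> x) \<subseteq> ?D #> cnj u x"
    proof
      fix y assume "y \<in> ?f u (?D #> x)"
      then obtain d where d: "d \<in> ?D" "y = cnj u (d \<otimes> x)" by (auto simp: r_coset_def)
      then have "y = cnj u d \<otimes> cnj u x" using u x ic by (simp add: word_simps)
      then show "y \<in> ?D #> cnj u x" using Dn[OF u d(1)] by (auto simp: r_coset_def)
    qed
    show "?D #> cnj u x \<subseteq> ?f u (?D #> x)"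
    proof
      fix y assume "y \<in> ?D #> cnj u x"
      then obtain d where d: "d \<in> ?D" "y = d \<otimes> cnj u x" by (auto simp: r_coset_def)
      have "cnj (inv u) d \<in> ?D" using Dn[OF subgroup.m_inv_closed[OF P(1) u] d(1)] .
      moreover have "y = cnj u (cnj (inv u) d \<otimes> x)" using d u x ic by (simp add: word_simps)
      ultimately show "y \<in> ?f u (?D #> x)" by (auto simp: r_coset_def)
    qed
  qed
  have cO: "card ?\<Omega> * card ?D = p ^ k" using card_cosets[OF P(1) D] P(2) by simp
  then obtain i where i: "card ?\<Omega> = p ^ i"
    using p(1) divides_primepow_nat by (metis dvd_triv_left)
  have "card ?\<Omega> \<noteq> 1"
  proof
    assume "card ?\<Omega> = 1"
    then have "card ?D = card P" using cO P(2) by simp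
    then have "?D = P" using card_subset_eq[OF sub_fin[OF P(1)], of ?D] by blast
    then show False using PK by blast
  qed
  then have pO: "p dvd card ?\<Omega>" using i by (cases i) auto
  let ?F = "{w \<in> ?\<Omega>. \<forall>u\<in>P. ?f u w = w}"
  have "[card ?F = card ?\<Omega>] (mod p)"
  proof (rule p_group_fixed[OF p(1) P])
    show "finite ?\<Omega>" using sub_fin[OF P(1)] by blast
    fix u w assume u: "u \<in> P" and w: "w \<in> ?\<Omega>"
    then obtain x where x: "x \<in> P" "w = ?D #> x" by blast
    show "?f u w \<in> ?\<Omega>" using fx u x cnj_sub[OF P(1)] by blast
    fix v assume v: "v \<in> P"
    have "cnj (u \<otimes> v) x = cnj u (cnj v x)" using u v x ic by (simp add: word_simps)
    then show "?f (u \<otimes> v) w = ?f u (?f v w)"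
      using fx u v x cnj_sub[OF P(1)] subgroup.m_closed[OF P(1)] by metis
  next
    fix w assume "w \<in> ?\<Omega>"
    then obtain x where x: "x \<in> P" "w = ?D #> x" by blast
    then show "?f \<one> w = w" using fx[of \<one> x] ic subgroup.one_closed[OF P(1)] by simp
  qed
  then have pF: "p dvd card ?F" using pO cong_dvd_iff by blast
  have "?D #> \<one> \<in> ?F"
    using fx[of _ \<one>] subgroup.one_closed[OF P(1)] ic by auto
  moreover have "?F \<noteq> {?D #> \<one>}"
  proof
    assume "?F = {?D #> \<one>}"
    then have "p dvd 1" using pF by simp
    then show False using p(1) by simp
  qed
  ultimately obtain w where w: "w \<in> ?F" "w \<noteq> ?D #> \<one>" by blast
  then obtain x where x: "x \<in> P" "w = ?D #> x" by blast
  have xK: "x \<notin> K"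
  proof
    assume "x \<in> K"
    then have "?D #> x = ?D" using coset_join2[of x ?D] D x ic by simp
    moreover have "?D #> \<one> = ?D" using subgroup.subset[OF D] by simp
    ultimately show False using w x by simp
  qed
  let ?T = "{g \<in> carrier G. cmt g x \<in> K}"
  have T: "subgroup ?T G"
  proof (rule sub_closedI)
    fix g h assume gh: "g \<in> ?T" "h \<in> ?T"
    have "cmt (g \<otimes> h) x = cnj g (cmt h x) \<otimes> cmt g x" using gh x ic by (simp add: word_simps)
    moreover have "cnj g (cmt h x) \<in> K" using gh normalizesD[OF K(2)] by blast
    ultimately show "g \<otimes> h \<in> ?T" using gh K(1) by (simp add: subgroup.m_closed)
  qed (use x ic subgroup.one_closed[OF K(1)] in auto)
  have "P \<subseteq> ?T"
  proof
    fix u assume u: "u \<in> P"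
    have "?D #> cnj u x = ?D #> x" using w x u fx by auto
    then have "cnj u x \<in> ?D #> x" using rcos_self[of "cnj u x" ?D] D u x ic by auto
    then obtain d where d: "d \<in> ?D" "cnj u x = d \<otimes> x" by (auto simp: r_coset_def)
    then have "cmt u x = d" using u x ic by (simp add: m_assoc)
    then show "u \<in> ?T" using d u ic by simp
  qed
  then have "p ^ k dvd card ?T" using sub_card_dvd[OF T P(1)] P(2) by simp
  moreover have "v \<in> ?T" if v: "v \<in> carrier G" "v [^] b = \<one>" for v
  proof -
    have "cop_orders G v x" using cop_ordersI[OF v(2), of x "p ^ k"] pow_card[OF P(1) x(1)] P(2) cop_orders
      by (simp add: coprime_commute)
    then have "v \<otimes> x = x \<otimes> v" using c v x ic by blast
    then have "cmt v x = \<one>" using commute_iff_cmt v x ic by blast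
    then show ?thesis using v subgroup.one_closed[OF K(1)] by simp
  qed
  ultimately have "?T = carrier G" using eq_carrier_of_parts[OF T o(1) cop_orders] by blast
  then show ?thesis using that x xK ic by blast
qed

text \<open>The upper central series is climbed: \<open>?K\<close> is the preimage of the centre
  modulo \<open>K\<close>, and once a term of the lower central series lies in \<open>?K\<close>,
  the next one lies in \<open>K\<close>. The induction is on |G| - |K|, since
  \<open>cop_orders_commute_central_mod\<close> makes \<open>?K\<close> strictly larger than
  \<open>K\<close>.\<close>

lemma cop_orders_commute_nilpotent:
  assumes c: "\<And>x y. x \<in> carrier G \<Longrightarrow> y \<in> carrier G \<Longrightarrow> cop_orders G x y \<Longrightarrow> x \<otimes> y = y \<otimes> x"
  shows "nilpotent_grp G"
proof -
  have "\<exists>n. lower_central G n \<subseteq> K" if "subgroup K G" "normalizes (carrier G) K" for K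
    using that
  proof (induction "card (carrier G) - card K" arbitrary: K rule: less_induct)
    case less
    note K = less.prems
    show ?case
    proof (cases "K = carrier G")
      case True
      then show ?thesis by (intro exI[of _ 0]) (simp add: lower_central_def)
    next
      case False
      let ?K = "{x \<in> carrier G. \<forall>g\<in>carrier G. cmt g x \<in> K}"
      note ic = sub_in[OF K(1)]
      have K': "subgroup ?K G"
      proof (rule sub_closedI)
        fix x y assume xy: "x \<in> ?K" "y \<in> ?K"
        have "cmt g (x \<otimes> y) \<in> K" if g: "g \<in> carrier G" for g
        proof -
          have "cmt g (x \<otimes> y) = cmt g x \<otimes> cnj x (cmt g y)" using g xy by (simp add: word_simps)
          then show ?thesis using g xy K normalizesD[OF K(2)] by (simp add: subgroup.m_closed)
        qed
        then show "x \<otimes> y \<in> ?K" using xy by blast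
      qed (use subgroup.one_closed[OF K(1)] in auto)
      have n': "normalizes (carrier G) ?K"
      proof -
        have "cmt g (cnj h x) \<in> K" if h: "h \<in> carrier G" and x: "x \<in> ?K" and g: "g \<in> carrier G" for h x g
        proof -
          have "cmt g (cnj h x) = cnj h (cmt (cnj (inv h) g) x)" using g h x by (simp add: word_simps)
          moreover have "cmt (cnj (inv h) g) x \<in> K" using g h x by simp
          ultimately show ?thesis using normalizesD[OF K(2) h] by simp
        qed
        then show ?thesis by (simp add: normalizes_def)
      qed
      have sub: "K \<subseteq> ?K"
      proof
        fix x assume x: "x \<in> K"
        then show "x \<in> ?K" using normalizesD[OF K(2)] K(1) ic
          by (simp add: subgroup.m_closed subgroup.m_inv_closed)
      qed
      obtain x where "x \<in> carrier G" "x \<notin> K" "\<And>g. g \<in> carrier G \<Longrightarrow> cmt g x \<in> K"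
        using cop_orders_commute_central_mod[OF c K False] by blast
      then have "K \<subset> ?K" using sub by blast
      then have "card K < card ?K" using psubset_card_mono sub_fin[OF K'] by blast
      moreover have "card ?K \<le> card (carrier G)" by (rule card_mono[OF fin]) auto
      ultimately have "card (carrier G) - card ?K < card (carrier G) - card K" by linarith
      then obtain n where n: "lower_central G n \<subseteq> ?K"
        using less.hyps[OF _ K' n'] by blast
      have "lower_central G (Suc n) \<subseteq> K"
        unfolding lower_central_Suc comm_subgroup_def
        by (rule generate_subgroup_incl) (use n K in auto)
      then show ?thesis by blast
    qed
  qed
  from this[OF triv_subgroup normalizes_one] obtain n where "lower_central G n \<subseteq> {\<one>}" by blast
  moreover have "\<one> \<in> lower_central G n"
    using lower_central_normal normal_imp_subgroup subgroup.one_closed by blast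
  ultimately have "lower_central G n = {\<one>}" by blast
  then show ?thesis by (auto simp: nilpotent_grp_def)
qed

text \<open>The transfer homomorphism \<open>V\<close> into the central Sylow subgroup \<open>Z\<close> kills the generators,
  but is the \<open>r\<close>-th power map on \<open>Z\<close>, where \<open>r\<close> is the index of \<open>Z\<close>.\<close>

lemma central_sylow_trivial:
  assumes p: "prime (p::nat)" and S: "S \<subseteq> carrier G"
    and ps: "\<And>s. s \<in> S \<Longrightarrow> \<exists>m. \<not> p dvd m \<and> s [^] (m::nat) = \<one>"
    and central: "\<And>z g i. z \<in> generate G S \<Longrightarrow> z [^] (p ^ i) = \<one> \<Longrightarrow> g \<in> generate G S \<Longrightarrow> z \<otimes> g = g \<otimes> z"
  shows "\<not> p dvd card (generate G S)"
proof -
  let ?E = "generate G S"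
  have E: "subgroup ?E G" by (rule generate_is_subgroup[OF S])
  obtain Z k r where Z: "subgroup Z G" "Z \<subseteq> ?E" "card Z = p ^ k" and r: "card ?E = p ^ k * r" "\<not> p dvd r"
    using sylow_exists[OF p E] .
  note ic = sub_in[OF Z(1)] sub_in[OF E]
  have zE: "z \<in> ?E" if "z \<in> Z" for z using that Z(2) by blast
  have comm: "z \<otimes> g = g \<otimes> z" if "z \<in> Z" "g \<in> ?E" for z g
    using central[OF zE[OF that(1)]] pow_card[OF Z(1) that(1)] Z(3) that(2) by simp
  let ?Z = "Sub Z"
  interpret Z: fin_group ?Z by (rule fin_sub[OF Z(1)])
  interpret Z: comm_group ?Z
    by (rule Z.group_comm_groupI) (simp add: comm zE)
  let ?\<Omega> = "(\<lambda>x. Z #> x) ` ?E"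
  have fin\<Omega>: "finite ?\<Omega>" using sub_fin[OF E] by blast
  have "card ?\<Omega> * p ^ k = p ^ k * r" using card_cosets[OF E Z(1,2)] Z(3) r(1) by simp
  then have c\<Omega>: "card ?\<Omega> = r" using p by (simp add: prime_gt_0_nat)
  \<comment> \<open>An arbitrary transversal of the cosets of \<open>Z\<close>.\<close>
  define rep where "rep C = (SOME y. y \<in> C)" for C :: "'a set"
  have Zc: "Z \<subseteq> carrier G" using ic by blast
  have rep: "rep (Z #> x) \<in> Z #> x" if "x \<in> ?E" for x
    unfolding rep_def using someI[of "\<lambda>y. y \<in> Z #> x" x] rcos_self[of x Z] Z(1) ic that by blast
  have shift: "Z #> x #> g = Z #> (x \<otimes> g)" if "x \<in> ?E" "g \<in> ?E" for x g
    using coset_mult_assoc[OF Zc] that ic by simp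
  have shift\<Omega>: "C #> g \<in> ?\<Omega>" if "C \<in> ?\<Omega>" "g \<in> ?E" for C g
    using that shift E by (auto simp: subgroup.m_closed)
  have repE: "rep C \<in> ?E" if "C \<in> ?\<Omega>" for C
    using that rep E zE by (force simp: r_coset_def subgroup.m_closed)
  \<comment> \<open>Chosen so that \<open>rep C \<otimes> g = q g C \<otimes> rep (C #> g)\<close>.
    Both \<open>rep C \<otimes> g\<close> and \<open>rep (C #> g)\<close> lie in the coset
    \<open>C #> g\<close>, which puts \<open>q g C\<close> in \<open>Z\<close>.\<close>
  define q where "q g C = rep C \<otimes> g \<otimes> inv (rep (C #> g))" for g C
  have q: "q g C \<in> Z" if C: "C \<in> ?\<Omega>" and g: "g \<in> ?E" for g C
  proof -
    obtain x where x: "x \<in> ?E" "C = Z #> x" using C by blast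
    obtain z where z: "z \<in> Z" "rep C = z \<otimes> x" using rep[OF x(1)] x(2) by (auto simp: r_coset_def)
    have "rep (C #> g) \<in> Z #> (x \<otimes> g)"
      using rep[of "x \<otimes> g"] x g shift E by (simp add: subgroup.m_closed)
    then obtain z' where z': "z' \<in> Z" "rep (C #> g) = z' \<otimes> (x \<otimes> g)" by (auto simp: r_coset_def)
    have "q g C = z \<otimes> inv z'" unfolding q_def using z z' x g ic by (simp add: word_simps)
    then show ?thesis using z z' Z(1) by (simp add: subgroup.m_closed subgroup.m_inv_closed)
  qed
  define V where "V g = finprod ?Z (q g) ?\<Omega>" for g
  have VZ: "V g \<in> Z" if "g \<in> ?E" for g
    unfolding V_def using Z.finprod_closed[of "q g" ?\<Omega>] q that by auto
  have Vmult: "V (g \<otimes> h) = V g \<otimes> V h" if g: "g \<in> ?E" and h: "h \<in> ?E" for g h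
  proof -
    have qq: "q (g \<otimes> h) C = q g C \<otimes> q h (C #> g)" if C: "C \<in> ?\<Omega>" for C
    proof -
      obtain x where x: "x \<in> ?E" "C = Z #> x" using C by blast
      have "C #> g #> h = C #> (g \<otimes> h)"
        using x g h shift ic E by (simp add: subgroup.m_closed m_assoc)
      then show ?thesis
        unfolding q_def using repE[OF C] repE[OF shift\<Omega>[OF C g]]
          repE[OF shift\<Omega>[OF C, of "g \<otimes> h"]] g h ic E
        by (simp add: word_simps subgroup.m_closed)
    qed
    \<comment> \<open>Translation by \<open>g\<close> permutes the cosets, so the product of the
      factors \<open>q h (C #> g)\<close> can be reindexed to that of the
      \<open>q h C\<close>.\<close>
    have inj: "inj_on (\<lambda>C. C #> g) ?\<Omega>"
    proof (rule inj_onI)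
      fix C D assume C: "C \<in> ?\<Omega>" and D: "D \<in> ?\<Omega>" and e: "C #> g = D #> g"
      have "C #> g #> inv g = C" if "C \<in> ?\<Omega>" for C
        using that shift g E ic by (auto simp: subgroup.m_closed subgroup.m_inv_closed m_assoc)
      then show "C = D" using C D e by metis
    qed
    have "(\<lambda>C. C #> g) ` ?\<Omega> \<subseteq> ?\<Omega>" using shift\<Omega> g by (intro image_subsetI)
    then have im: "(\<lambda>C. C #> g) ` ?\<Omega> = ?\<Omega>" using endo_inj_surj[OF fin\<Omega> _ inj] by simp
    have "V (g \<otimes> h) = finprod ?Z (\<lambda>C. q g C \<otimes> q h (C #> g)) ?\<Omega>"
      unfolding V_def by (rule Z.finprod_cong') (use qq q shift\<Omega> g h Z(1) in \<open>auto simp: subgroup.m_closed\<close>)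
    also have "\<dots> = finprod ?Z (q g) ?\<Omega> \<otimes> finprod ?Z (\<lambda>C. q h (C #> g)) ?\<Omega>"
      using Z.finprod_multf[of "q g" ?\<Omega> "\<lambda>C. q h (C #> g)"] q shift\<Omega> g h by auto
    also have "finprod ?Z (\<lambda>C. q h (C #> g)) ?\<Omega> = finprod ?Z (q h) ?\<Omega>"
      using Z.finprod_reindex[of "q h" "\<lambda>C. C #> g" ?\<Omega>] im inj q h by auto
    finally show ?thesis unfolding V_def .
  qed
  have oneE: "\<one> \<in> ?E" by (rule generate.one)
  have V1: "V \<one> = \<one>"
  proof -
    have "V \<one> \<otimes> V \<one> = V \<one>" using Vmult[OF oneE oneE] by simp
    then show ?thesis using VZ[OF oneE] ic by (metis l_cancel_one')
  qed
  have Vpow: "V (g [^] n) = V g [^] n" if g: "g \<in> ?E" for g and n :: nat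
    by (induction n) (simp_all add: V1 Vmult g pow_sub[OF E g])
  have Vs: "V s = \<one>" if s: "s \<in> S" for s
  proof -
    have sE: "s \<in> ?E" using s by (rule generate.incl)
    obtain m where m: "\<not> p dvd m" "s [^] (m::nat) = \<one>" using ps s by blast
    have "V s [^] m = \<one>" using Vpow[OF sE, of m] m V1 by simp
    moreover have "V s [^] (p ^ k) = \<one>" using pow_card[OF Z(1) VZ[OF sE]] Z(3) by simp
    moreover have "coprime m (p ^ k)" using m p prime_power_coprime by blast
    ultimately show ?thesis using one_pow_coprime VZ[OF sE] ic by blast
  qed
  let ?T = "{g \<in> ?E. V g = \<one>}"
  have "subgroup ?T G"
    by (rule sub_closedI) (use ic oneE V1 Vmult E in \<open>auto simp: subgroup.m_closed\<close>)
  then have "?E \<subseteq> ?T"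
    using generate_subgroup_incl[of S ?T] Vs by (auto intro: generate.incl)
  have "z = \<one>" if z: "z \<in> Z" for z
  proof -
    \<comment> \<open>A central \<open>z\<close> fixes every coset, so each of the \<open>r\<close>
      factors of its transfer is \<open>z\<close> itself.\<close>
    have "q z C = z" if C: "C \<in> ?\<Omega>" for C
    proof -
      obtain x where x: "x \<in> ?E" "C = Z #> x" using C by blast
      have "C #> z = Z #> (z \<otimes> x)" using shift x z zE comm by simp
      also have "\<dots> = Z #> z #> x" using coset_mult_assoc[OF Zc] x z ic by simp
      also have "Z #> z = Z" using coset_join2 Z(1) z ic by blast
      finally have "C #> z = C" using x by simp
      then show ?thesis unfolding q_def using repE[OF C] comm[OF z] ic z
        by (metis inv_closed m_assoc r_inv r_one)
    qed
    then have "V z = finprod ?Z (\<lambda>_. z) ?\<Omega>"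
      unfolding V_def by (intro Z.finprod_cong') (use z in auto)
    then have "V z = z [^] r" using Z.finprod_const[of z ?\<Omega>] z c\<Omega> by simp
    then have "z [^] r = \<one>" using \<open>?E \<subseteq> ?T\<close> zE[OF z] by auto
    moreover have "z [^] (p ^ k) = \<one>" using pow_card[OF Z(1) z] Z(3) by simp
    moreover have "coprime r (p ^ k)" using r(2) p prime_power_coprime by blast
    ultimately show ?thesis using one_pow_coprime z ic by blast
  qed
  then have "Z = {\<one>}" using subgroup.one_closed[OF Z(1)] by blast
  then have "p ^ k = 1" using Z(3) by simp
  then show ?thesis using r prime_gt_1_nat[OF p] by auto
qed

end

section \<open>Edges of the three graphs\<close>

context fin_group
begin

definition p'elements :: "nat \<Rightarrow> 'a set \<Rightarrow> 'a set" where
  "p'elements p N = {x \<in> N. \<exists>m. \<not> p dvd m \<and> x [^] (m::nat) = \<one>}"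

text \<open>Usually written \<open>O\<^sup>p(N)\<close>.\<close>

definition p_residual :: "nat \<Rightarrow> 'a set \<Rightarrow> 'a set" where
  "p_residual p N = generate G (p'elements p N)"

text \<open>\<open>H\<close> stays inside the ambient group, so that edges of a factor and of the
  whole product speak about the same elements and conjugations.\<close>

definition schmidt_edge :: "'a set \<Rightarrow> nat \<Rightarrow> nat \<Rightarrow> bool" where
  "schmidt_edge H p q \<longleftrightarrow> prime p \<and> prime q \<and> p \<noteq> q \<and>
    (\<exists>P y k j. subgroup P G \<and> P \<subseteq> H \<and> card P = p ^ k \<and> y \<in> H \<and> y [^] (q ^ j) = \<one> \<and>
       normalizes {y} P \<and> (\<exists>u\<in>P. y \<otimes> u \<noteq> u \<otimes> y))"

definition sylow_edge :: "'a set \<Rightarrow> nat \<Rightarrow> nat \<Rightarrow> bool" where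
  "sylow_edge H p q \<longleftrightarrow> prime p \<and> prime q \<and> p \<noteq> q \<and>
    (\<exists>P y k r j. subgroup P G \<and> P \<subseteq> H \<and> card P = p ^ k \<and> card H = p ^ k * r \<and> \<not> p dvd r \<and>
       y \<in> H \<and> y [^] (q ^ j) = \<one> \<and> normalizes {y} P \<and> (\<exists>u\<in>P. y \<otimes> u \<noteq> u \<otimes> y))"

text \<open>Here \<open>p = q\<close> is allowed: unlike the other two graphs, the Hawkes graph can
  have loops, for instance at 2 for the symmetric group of degree 4.\<close>

definition hawkes_edge :: "'a set \<Rightarrow> nat \<Rightarrow> nat \<Rightarrow> bool" where
  "hawkes_edge H p q \<longleftrightarrow> prime p \<and> prime q \<and>
    (\<exists>x\<in>H. \<exists>j. x [^] (q ^ j) = \<one> \<and> x \<notin> O_pp (Sub H) p)"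

definition cop_commuting :: "'a set \<Rightarrow> 'a set \<Rightarrow> bool" where
  "cop_commuting A B \<longleftrightarrow> (\<forall>x\<in>A. \<forall>y\<in>B. cop_orders G x y \<longrightarrow> x \<otimes> y = y \<otimes> x)"

lemma pi_sub: "pi_grp (Sub H) = {p. prime p \<and> p dvd card H}"
  by (simp add: pi_grp_def order_def)

lemma nilpotent_iff_cop_commuting:
  assumes S: "subgroup S G"
  shows "nilpotent_grp (Sub S) \<longleftrightarrow> cop_commuting S S"
proof -
  interpret S: fin_group "Sub S" using fin_sub[OF S] .
  show ?thesis using S.nilpotent_cop_commute S.cop_orders_commute_nilpotent by (auto simp: cop_commuting_def)
qed

lemma mod_order:
  assumes H: "subgroup H G" and K: "subgroup K G" "K \<subseteq> H"
  shows "card H = order (Sub H Mod K) * card K"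
proof -
  interpret H: fin_group "Sub H" using fin_sub[OF H] .
  show ?thesis using H.lagrange[of K] sub_sub_iff[OF H] K by (simp add: order_def FactGroup_def)
qed

text \<open>Otherwise \<open>K\<close> contains every \<open>q\<close>-element of \<open>H\<close>,
  and \<open>coprime_index\<close> applies with the \<open>q\<close>-part of the group order. With
  \<open>el_of_not_dvd_index\<close> as a converse for normal \<open>K\<close>, this turns
  divisibility of an index into the existence of an element.\<close>

lemma index_prime_el:
  assumes H: "subgroup H G" and K: "subgroup K G" "K \<subseteq> H" and h: "card H = h * card K"
    and q: "prime q" "q dvd h"
  obtains x j where "x \<in> H" "x \<notin> K" "x [^] (q ^ j :: nat) = \<one>"
proof -
  obtain k b where o: "order G = q ^ k * b" "coprime (q ^ k) b" "\<not> q dvd b" using prime_split[OF q(1)] .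
  show ?thesis
  proof (rule ccontr)
    assume n: "\<not> thesis"
    have "coprime (q ^ k) h"
      by (rule coprime_index[OF H K o(1,2) _ h]) (use that n in blast)
    moreover have "q dvd card H" using q h by simp
    then have "q dvd order G" using dvd_trans[OF _ card_sub_order[OF H]] by blast
    then have "k \<noteq> 0" using o by (cases k) auto
    ultimately have "coprime q h" by (simp add: coprime_power_left_iff)
    then show False using q coprime_common_divisor[of q h q] by simp
  qed
qed

lemma el_of_not_dvd_index:
  assumes H: "subgroup H G" and K: "subgroup K G" "K \<subseteq> H" "normalizes H K" and h: "card H = h * card K"
    and q: "prime q" "\<not> q dvd h" and x: "x \<in> H" "x [^] (q ^ j :: nat) = \<one>"
  shows "x \<in> K"
proof -
  have "coprime h (q ^ j)" using q prime_power_coprime by blast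
  then show ?thesis
    using mem_of_pow[OF K(1) sub_in[OF H x(1)] index_pow[OF H K h x(1)] x(2)] by blast
qed

section \<open>The p-residual and the largest normal p-nilpotent subgroup\<close>

lemma p'elements_sub: "N \<subseteq> carrier G \<Longrightarrow> p'elements p N \<subseteq> carrier G"
  by (auto simp: p'elements_def)

lemma p_residual_sub: "subgroup N G \<Longrightarrow> subgroup (p_residual p N) G"
  unfolding p_residual_def using generate_is_subgroup p'elements_sub subgroup.subset by blast

lemma p_residual_incl: "subgroup N G \<Longrightarrow> p_residual p N \<subseteq> N"
  unfolding p_residual_def by (rule generate_subgroup_incl) (auto simp: p'elements_def)

lemma p'elements_p_residual: "x \<in> p'elements p N \<Longrightarrow> x \<in> p_residual p N"
  unfolding p_residual_def by (rule generate.incl)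

lemma cnj_p'elements:
  assumes N: "subgroup N G" and n: "normalizes H N" and H: "H \<subseteq> carrier G"
    and h: "h \<in> H" and x: "x \<in> p'elements p N"
  shows "cnj h x \<in> p'elements p N"
proof -
  obtain m where m: "\<not> p dvd m" "x [^] (m::nat) = \<one>" "x \<in> N" using x by (auto simp: p'elements_def)
  have "(cnj h x) [^] m = \<one>" using cnj_pow sub_in[OF N] H h m by auto
  then show ?thesis using normalizesD[OF n h m(3)] m by (auto simp: p'elements_def)
qed

lemma normalizes_p_residual:
  assumes N: "subgroup N G" and n: "normalizes H N" and H: "H \<subseteq> carrier G"
  shows "normalizes H (p_residual p N)"
proof -
  have "normalizes (generate G H) (p_residual p N)"
    unfolding p_residual_def
  proof (rule normalizes_generate[OF _ H])
    show "p'elements p N \<subseteq> carrier G" by (rule p'elements_sub[OF subgroup.subset[OF N]])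
    show "cnj h x \<in> generate G (p'elements p N)" if "h \<in> H" "x \<in> p'elements p N" for h x
      using cnj_p'elements[OF N n H that] by (rule generate.incl)
  qed
  then show ?thesis by (rule normalizes_mono) (blast intro: generate.incl)
qed

text \<open>A normal p-complement contains every p'-element, hence the p-residual. Conversely the
  index of the p-residual is prime to the p'-part \<open>b\<close> of the group order, so it is a
  power of \<open>p\<close>, and the p-residual is itself a normal p-complement.\<close>

lemma p_nilpotent_iff:
  assumes p: "prime p" and N: "subgroup N G"
  shows "p_nilpotent (Sub N) p \<longleftrightarrow> \<not> p dvd card (p_residual p N)"
proof
  assume "p_nilpotent (Sub N) p"
  then obtain M k where M: "M \<lhd> Sub N" "\<not> p dvd card M" "order (Sub N Mod M) = p ^ k"
    by (auto simp: p_nilpotent_def)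
  have M': "subgroup M G" "M \<subseteq> N" "normalizes N M" using M(1) normal_sub_iff[OF N] by auto
  have c: "card N = p ^ k * card M" using mod_order[OF N M'(1,2)] M(3) by simp
  have "p'elements p N \<subseteq> M"
  proof
    fix x assume "x \<in> p'elements p N"
    then obtain m where m: "\<not> p dvd m" "x [^] (m::nat) = \<one>" "x \<in> N" by (auto simp: p'elements_def)
    have "coprime (p ^ k) m" using m p prime_power_coprime by blast
    then show "x \<in> M" using mem_of_pow[OF M'(1) sub_in[OF N m(3)] index_pow[OF N M' c m(3)] m(2)] by blast
  qed
  then have "p_residual p N \<subseteq> M" unfolding p_residual_def using generate_subgroup_incl M'(1) by blast
  then have "card (p_residual p N) dvd card M" by (rule sub_card_dvd[OF M'(1) p_residual_sub[OF N]])
  then show "\<not> p dvd card (p_residual p N)" using M(2) dvd_trans[of p] by blast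
next
  assume E: "\<not> p dvd card (p_residual p N)"
  let ?E = "p_residual p N"
  have Es: "subgroup ?E G" "?E \<subseteq> N" by (rule p_residual_sub[OF N], rule p_residual_incl[OF N])
  have En: "normalizes N ?E"
    using normalizes_p_residual[OF N normalizes_sub[OF N] subgroup.subset[OF N]] .
  obtain k b where o: "order G = p ^ k * b" "coprime (p ^ k) b" "\<not> p dvd b" using prime_split[OF p] .
  have o': "order G = b * p ^ k" "coprime b (p ^ k)" using o by (simp_all add: coprime_commute)
  let ?h = "order (Sub N Mod ?E)"
  have h: "card N = ?h * card ?E" by (rule mod_order[OF N Es])
  have "coprime b ?h"
    by (rule coprime_index[OF N Es o' _ h]) (use o(3) p'elements_p_residual in \<open>auto simp: p'elements_def\<close>)
  moreover have "?h dvd p ^ k * b" using card_sub_order[OF N] h o(1) by (metis dvd_mult_left)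
  ultimately have "?h dvd p ^ k" by (metis coprime_commute coprime_dvd_mult_left_iff)
  then have "\<exists>i. ?h = p ^ i" using divides_primepow_nat[OF p] by blast
  then show "p_nilpotent (Sub N) p"
    unfolding p_nilpotent_def using E normal_sub_iff[OF N] Es En by blast
qed

text \<open>The product \<open>?D\<close> of the two p-residuals is a normal p'-subgroup, and
  \<open>factor_part_mem\<close> places every p'-element of \<open>M <#> N\<close> in it.\<close>

lemma p_nilpotent_set_mult:
  assumes p: "prime p" and H: "subgroup H G"
    and M: "subgroup M G" "M \<subseteq> H" "normalizes H M" "\<not> p dvd card (p_residual p M)"
    and N: "subgroup N G" "N \<subseteq> H" "normalizes H N" "\<not> p dvd card (p_residual p N)"
  shows "subgroup (M <#> N) G" "M <#> N \<subseteq> H" "normalizes H (M <#> N)" "\<not> p dvd card (p_residual p (M <#> N))"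
proof -
  have nsm: "subgroup (A <#> B) G \<and> A <#> B \<subseteq> H \<and> normalizes H (A <#> B)"
    if A: "subgroup A G" "A \<subseteq> H" "normalizes H A" and B: "subgroup B G" "B \<subseteq> H" "normalizes H B" for A B
  proof (intro conjI)
    show "subgroup (A <#> B) G" using set_mult_sub_normalizes[OF A(1) B(1) normalizes_mono[OF B(3) A(2)]] .
    show "A <#> B \<subseteq> H" by (rule set_mult_least[OF H A(2) B(2)])
    show "normalizes H (A <#> B)"
      by (rule normalizes_set_mult[OF subgroup.subset[OF H] subgroup.subset[OF A(1)]
            subgroup.subset[OF B(1)] A(3) B(3)])
  qed
  have MN: "subgroup (M <#> N) G" "M <#> N \<subseteq> H" "normalizes H (M <#> N)"
    using nsm[OF M(1-3) N(1-3)] by auto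
  then show "subgroup (M <#> N) G" "M <#> N \<subseteq> H" "normalizes H (M <#> N)" by auto
  let ?M = "p_residual p M" let ?N = "p_residual p N" let ?D = "?M <#> ?N"
  have Hc: "H \<subseteq> carrier G" by (rule subgroup.subset[OF H])
  have M': "subgroup ?M G" "?M \<subseteq> M" "normalizes H ?M"
    using p_residual_sub p_residual_incl normalizes_p_residual M Hc by auto
  have N': "subgroup ?N G" "?N \<subseteq> N" "normalizes H ?N"
    using p_residual_sub p_residual_incl normalizes_p_residual N Hc by auto
  have D: "subgroup ?D G" "normalizes H ?D" using nsm M' N' M(2) N(2) by auto
  have DMN: "?D \<subseteq> M <#> N" by (rule mono_set_mult[OF M'(2) N'(2)])
  have D1: "?M \<subseteq> ?D" "?N \<subseteq> ?D" using sub_set_mult_left sub_set_mult_right M' N' by auto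
  have "\<not> p dvd card ?M * card ?N" using M(4) N(4) p prime_dvd_mult_iff by blast
  then have pD: "\<not> p dvd card ?D" using card_set_mult[OF M'(1) N'(1)] by (metis dvd_mult2)
  obtain k b where o: "order G = p ^ k * b" "coprime (p ^ k) b" "\<not> p dvd b" using prime_split[OF p] .
  have o': "order G = b * p ^ k" "coprime b (p ^ k)" using o by (simp_all add: coprime_commute)
  have "p'elements p (M <#> N) \<subseteq> ?D"
  proof
    fix x assume "x \<in> p'elements p (M <#> N)"
    then obtain m where m: "\<not> p dvd m" "x [^] (m::nat) = \<one>" "x \<in> M <#> N" by (auto simp: p'elements_def)
    have "coprime m (p ^ k)" using m p prime_power_coprime by blast
    then have xb: "x [^] b = \<one>" using one_pow_part[OF o'(1) sub_in[OF MN(1) m(3)] m(2)] by blast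
    show "x \<in> ?D"
    proof (rule factor_part_mem[OF M(1) N(1) MN(1) D(1) DMN _ _ o' _ _ m(3) xb])
      show "normalizes M ?D" "normalizes N ?D" using normalizes_mono[OF D(2)] M(2) N(2) by auto
      show "y \<in> ?D" if "y \<in> M" "y [^] b = \<one>" for y
        using that D1(1) p'elements_p_residual[of y p M] o(3) by (auto simp: p'elements_def)
      show "y \<in> ?D" if "y \<in> N" "y [^] b = \<one>" for y
        using that D1(2) p'elements_p_residual[of y p N] o(3) by (auto simp: p'elements_def)
    qed
  qed
  then have "p_residual p (M <#> N) \<subseteq> ?D"
    unfolding p_residual_def[of p "M <#> N"] using generate_subgroup_incl D(1) by blast
  then show "\<not> p dvd card (p_residual p (M <#> N))"
    using sub_card_dvd[OF D(1) p_residual_sub[OF MN(1)]] pD dvd_trans[of p] by blast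
qed

text \<open>A normal p-nilpotent subgroup \<open>M\<close> of greatest order absorbs every other
  one, because products are again p-nilpotent; so all of them together generate just
  \<open>M\<close>.\<close>

lemma O_pp_sub:
  assumes p: "prime p" and H: "subgroup H G"
  shows "subgroup (O_pp (Sub H) p) G" "O_pp (Sub H) p \<subseteq> H"
    "normalizes H (O_pp (Sub H) p)" "\<not> p dvd card (p_residual p (O_pp (Sub H) p))"
    "\<And>N. subgroup N G \<Longrightarrow> N \<subseteq> H \<Longrightarrow> normalizes H N \<Longrightarrow> \<not> p dvd card (p_residual p N) \<Longrightarrow>
      N \<subseteq> O_pp (Sub H) p"
proof -
  let ?\<N> = "{N. subgroup N G \<and> N \<subseteq> H \<and> normalizes H N \<and> \<not> p dvd card (p_residual p N)}"
  have "{\<one>} \<in> ?\<N>"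
  proof -
    have "card (p_residual p {\<one>}) dvd card {\<one>}"
      using sub_card_dvd[OF triv_subgroup p_residual_sub[OF triv_subgroup] p_residual_incl[OF triv_subgroup]] .
    then have "\<not> p dvd card (p_residual p {\<one>})" using prime_gt_1_nat[OF p] by auto
    moreover have "normalizes H {\<one>}" using normalizes_mono[OF normalizes_one] subgroup.subset[OF H] .
    ultimately show ?thesis using triv_subgroup subgroup.one_closed[OF H] by simp
  qed
  moreover have "\<forall>N. N \<in> ?\<N> \<longrightarrow> card N < Suc (card H)"
    using card_mono[OF sub_fin[OF H]] by (simp add: less_Suc_eq_le)
  ultimately obtain M where M: "M \<in> ?\<N>" "\<And>N. N \<in> ?\<N> \<Longrightarrow> card N \<le> card M"
    using ex_has_greatest_nat[of "\<lambda>N. N \<in> ?\<N>" "{\<one>}" card "Suc (card H)"] by blast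
  have max: "N \<subseteq> M" if N: "N \<in> ?\<N>" for N
  proof -
    have "M <#> N \<in> ?\<N>" using p_nilpotent_set_mult[OF p H, of M N] M(1) N by blast
    then have "card (M <#> N) \<le> card M" using M(2) by blast
    moreover have "M \<subseteq> M <#> N" "N \<subseteq> M <#> N" using sub_set_mult_left sub_set_mult_right M(1) N by auto
    moreover have "finite (M <#> N)" using \<open>M <#> N \<in> ?\<N>\<close> sub_fin by blast
    ultimately show ?thesis using card_seteq by blast
  qed
  have "{N. N \<lhd> Sub H \<and> p_nilpotent (G\<lparr>carrier := H, carrier := N\<rparr>) p} = ?\<N>"
    using normal_sub_iff[OF H] p_nilpotent_iff[OF p] by auto
  then have "O_pp (Sub H) p = generate (Sub H) (\<Union>?\<N>)"
    by (simp add: O_pp_def)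
  also have "\<dots> = generate G (\<Union>?\<N>)" by (rule generate_consistent[OF _ H]) blast
  also have "\<dots> = M"
  proof
    show "generate G (\<Union>?\<N>) \<subseteq> M" by (rule generate_subgroup_incl) (use max M in blast)+
    show "M \<subseteq> generate G (\<Union>?\<N>)" using M(1) by (blast intro: generate.incl)
  qed
  finally have e: "O_pp (Sub H) p = M" .
  show "subgroup (O_pp (Sub H) p) G" "O_pp (Sub H) p \<subseteq> H"
    "normalizes H (O_pp (Sub H) p)" "\<not> p dvd card (p_residual p (O_pp (Sub H) p))"
    using M(1) e by auto
  show "N \<subseteq> O_pp (Sub H) p" if "subgroup N G" "N \<subseteq> H" "normalizes H N" "\<not> p dvd card (p_residual p N)" for N
    using that max e by blast
qed

lemma hawkes_edge_iff:
  assumes H: "subgroup H G"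
  shows "(p, q) \<in> snd (hawkes_graph (Sub H)) \<longleftrightarrow> hawkes_edge H p q"
proof
  let ?O = "O_pp (Sub H) p"
  assume "(p, q) \<in> snd (hawkes_graph (Sub H))"
  then have p: "prime p" and q: "prime q" "q dvd order (Sub H Mod ?O)"
    by (auto simp: hawkes_graph_def pi_sub)
  note O = O_pp_sub[OF p H]
  obtain x j where "x \<in> H" "x \<notin> ?O" "x [^] (q ^ j) = \<one>"
    using index_prime_el[OF H O(1,2) mod_order[OF H O(1,2)] q] .
  then show "hawkes_edge H p q" using p q by (auto simp: hawkes_edge_def)
next
  let ?O = "O_pp (Sub H) p"
  assume "hawkes_edge H p q"
  then obtain x j where p: "prime p" and q: "prime q"
    and x: "x \<in> H" "x [^] (q ^ j) = \<one>" "x \<notin> ?O" by (auto simp: hawkes_edge_def)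
  note O = O_pp_sub[OF p H]
  have qd: "q dvd order (Sub H Mod ?O)"
    using el_of_not_dvd_index[OF H O(1-3) mod_order[OF H O(1,2)] q _ x(1,2)] x(3) by blast
  then have "q dvd card H" using mod_order[OF H O(1,2)] by simp
  \<comment> \<open>Otherwise \<open>H\<close> is itself p-nilpotent, \<open>?O\<close> is all of
    \<open>H\<close>, and \<open>x\<close> cannot lie outside.\<close>
  moreover have "p dvd card H"
  proof (rule ccontr)
    assume "\<not> p dvd card H"
    then have "\<not> p dvd card (p_residual p H)"
      using sub_card_dvd[OF H p_residual_sub[OF H] p_residual_incl[OF H]] dvd_trans[of p] by blast
    then have "H \<subseteq> ?O" using O(5)[OF H _ normalizes_sub[OF H]] by blast
    then show False using x by blast
  qed
  ultimately show "(p, q) \<in> snd (hawkes_graph (Sub H))"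
    using p q qd by (simp add: hawkes_graph_def pi_sub)
qed

section \<open>Edges of the Sylow graph in terms of elements\<close>

lemma normalizer_iff:
  assumes H: "subgroup H G" and P: "subgroup P G" "P \<subseteq> H"
  shows "normalizer (Sub H) P = {g \<in> H. normalizes {g} P}"
proof -
  have "g <# P #> inv g = P \<longleftrightarrow> normalizes {g} P" if g: "g \<in> H" for g
  proof -
    have im: "g <# P #> inv g = cnj g ` P" by (auto simp: l_coset_def r_coset_def)
    have "cnj g ` P = P" if n: "normalizes {g} P"
    proof (rule endo_inj_surj[OF sub_fin[OF P(1)]])
      show "cnj g ` P \<subseteq> P" using n by (auto simp: normalizes_def)
      show "inj_on (cnj g) P" using sub_in[OF P(1)] sub_in[OF H] g by (auto intro!: inj_onI)
    qed
    then show ?thesis using im by (auto simp: normalizes_def)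
  qed
  moreover have "normalizer (Sub H) P = {g \<in> H. g <# P #> inv g = P}"
    using P(2) by (auto simp: normalizer_def stabilizer_def m_inv_consistent[OF H])
  ultimately show ?thesis by blast
qed

lemma sylow_graph_quotient:
  assumes H: "subgroup H G" and P: "subgroup P G" "P \<subseteq> H"
  defines "N \<equiv> {g \<in> H. normalizes {g} P}" and "K \<equiv> P <#> (H \<inter> centralizer G P)"
  shows "subgroup N G" "subgroup K G" "K \<subseteq> N" "normalizes N K" "P \<subseteq> N"
    "order ((Sub H)\<lparr>carrier := normalizer (Sub H) P\<rparr>
       Mod (P <#>\<^bsub>Sub H\<^esub> centralizer (Sub H) P)) = order (Sub N Mod K)"
proof -
  let ?C = "H \<inter> centralizer G P"
  note ic = sub_in[OF H] sub_in[OF P(1)]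
  have Pc: "P \<subseteq> carrier G" by (rule subgroup.subset[OF P(1)])
  have C: "subgroup ?C G" using sub_Int[OF H centralizer_sub[OF Pc]] .
  have "N = H \<inter> {g \<in> carrier G. normalizes {g} P}" unfolding N_def using ic by blast
  then show N: "subgroup N G" using sub_Int[OF H normalizer_sub[OF Pc]] by simp
  have NC: "normalizes N ?C"
  proof -
    have "normalizes N (centralizer G P)"
      by (rule centralizer_normal[OF N Pc]) (auto simp: N_def normalizes_def)
    then show ?thesis using cnj_sub[OF H] by (auto simp: N_def normalizes_def)
  qed
  show PN: "P \<subseteq> N" using P cnj_sub[OF P(1)] by (auto simp: N_def normalizes_def)
  have CN: "?C \<subseteq> N"
  proof
    fix c assume c: "c \<in> ?C"
    have "cnj c u \<in> P" if u: "u \<in> P" for u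
      using c u ic commute_iff_cnj[of c u] by (auto simp: centralizer_def)
    then show "c \<in> N" using c by (simp add: N_def normalizes_def)
  qed
  show "subgroup K G" unfolding K_def
    by (rule set_mult_sub_normalizes[OF P(1) C normalizes_mono[OF NC PN]])
  show "K \<subseteq> N" unfolding K_def by (rule set_mult_least[OF N PN CN])
  have "normalizes N P" by (auto simp: N_def normalizes_def)
  then show "normalizes N K"
    unfolding K_def using normalizes_set_mult NC subgroup.subset[OF N] Pc subgroup.subset[OF C] by blast
  have "centralizer (Sub H) P = ?C" using ic by (auto simp: centralizer_def)
  then show "order ((Sub H)\<lparr>carrier := normalizer (Sub H) P\<rparr>
       Mod (P <#>\<^bsub>Sub H\<^esub> centralizer (Sub H) P)) = order (Sub N Mod K)"
    using normalizer_iff[OF H P] unfolding N_def K_def by simp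
qed

lemma sylow_edge_iff:
  assumes H: "subgroup H G"
  shows "(p, q) \<in> snd (sylow_graph (Sub H)) \<longleftrightarrow> sylow_edge H p q"
proof
  assume "(p, q) \<in> snd (sylow_graph (Sub H))"
  then obtain P where p: "prime p" and q: "prime q"
    and S: "Sylow_subgroup (Sub H) p P"
    and d: "q dvd order ((Sub H)\<lparr>carrier := normalizer (Sub H) P\<rparr>
       Mod (P <#>\<^bsub>Sub H\<^esub> centralizer (Sub H) P))"
    by (auto simp: sylow_graph_def pi_sub)
  obtain k where P: "subgroup P G" "P \<subseteq> H" "card P = p ^ k" "\<not> p dvd card H div card P"
    using S sub_sub_iff[OF H] by (auto simp: Sylow_subgroup_def order_def)
  obtain r where "card H = r * card P" using sub_index[OF H P(1,2)] .
  then have r: "card H = p ^ k * r" "\<not> p dvd r" using P p by (simp_all add: prime_gt_0_nat)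
  let ?N = "{g \<in> H. normalizes {g} P}" let ?K = "P <#> (H \<inter> centralizer G P)"
  note NK = sylow_graph_quotient[OF H P(1,2)]
  obtain y j where y: "y \<in> ?N" "y \<notin> ?K" "y [^] (q ^ j) = \<one>"
    using index_prime_el[OF NK(1-3) mod_order[OF NK(1-3)] q] d NK(6) by auto
  have CK: "P \<subseteq> ?K" "H \<inter> centralizer G P \<subseteq> ?K"
    using sub_set_mult_left sub_set_mult_right P(1) sub_Int[OF H centralizer_sub] subgroup.subset[OF P(1)]
    by blast+
  have yc: "y \<in> carrier G" "y \<in> H" using y sub_in[OF H] by auto
  have "\<exists>u\<in>P. y \<otimes> u \<noteq> u \<otimes> y"
  proof (rule ccontr)
    assume "\<not> (\<exists>u\<in>P. y \<otimes> u \<noteq> u \<otimes> y)"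
    then have "y \<in> H \<inter> centralizer G P" using yc by (auto simp: centralizer_def)
    then show False using y CK by blast
  qed
  \<comment> \<open>A \<open>p\<close>-element normalising the Sylow subgroup \<open>P\<close> lies
    in \<open>P\<close>, hence in \<open>?K\<close>.\<close>
  moreover have "p \<noteq> q"
  proof
    assume e: "p = q"
    obtain h where h: "card ?N = h * card P" using sub_index[OF NK(1) P(1) NK(5)] .
    have "\<not> p dvd h" using not_dvd_sub_index[OF p H r NK(1)] h P(3) by simp
    moreover have "normalizes ?N P" by (auto simp: normalizes_def)
    ultimately have "y \<in> P" using el_of_not_dvd_index[OF NK(1) P(1) NK(5) _ h p _ y(1)] y(3) e by blast
    then show False using y CK by blast
  qed
  ultimately show "sylow_edge H p q" unfolding sylow_edge_def using p q P r y yc by blast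
next
  assume "sylow_edge H p q"
  then obtain P y k r j u where p: "prime p" and q: "prime q" and pq: "p \<noteq> q"
    and P: "subgroup P G" "P \<subseteq> H" "card P = p ^ k" and r: "card H = p ^ k * r" "\<not> p dvd r"
    and y: "y \<in> H" "y [^] (q ^ j) = \<one>" "normalizes {y} P" and u: "u \<in> P" "y \<otimes> u \<noteq> u \<otimes> y"
    by (auto simp: sylow_edge_def)
  note ic = sub_in[OF H] sub_in[OF P(1)]
  have "Sylow_subgroup (Sub H) p P"
    using P r p sub_sub_iff[OF H] by (auto simp: Sylow_subgroup_def order_def prime_gt_0_nat)
  moreover have "p dvd card H"
  proof -
    have "k \<noteq> 0"
    proof
      assume "k = 0"
      then have "card P = 1" using P by simp
      then have "P = {\<one>}" using subgroup.one_closed[OF P(1)] by (metis card_1_singletonE singletonD)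
      then show False using u y ic by simp
    qed
    then show ?thesis using r by simp
  qed
  moreover have "q dvd card H"
  proof (rule ccontr)
    assume "\<not> q dvd card H"
    then have "coprime (q ^ j) (card H)" using q prime_power_coprime by blast
    then have "y = \<one>" using one_pow_coprime[OF ic(1)[OF y(1)] y(2) pow_card[OF H y(1)]] by blast
    then show False using u ic by simp
  qed
  moreover have "q dvd order (G\<lparr>carrier := {g \<in> H. normalizes {g} P}\<rparr> Mod (P <#> (H \<inter> centralizer G P)))"
  proof (rule ccontr)
    assume n: "\<not> q dvd order (G\<lparr>carrier := {g \<in> H. normalizes {g} P}\<rparr> Mod (P <#> (H \<inter> centralizer G P)))"
    note NK = sylow_graph_quotient[OF H P(1,2)]
    have "y \<in> P <#> (H \<inter> centralizer G P)"
      using el_of_not_dvd_index[OF NK(1-4) mod_order[OF NK(1-3)] q n _ y(2)] y by blast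
    then obtain v c where vc: "v \<in> P" "c \<in> H" "c \<in> centralizer G P" "y = v \<otimes> c"
      by (auto simp: set_mult_def)
    have C: "subgroup (centralizer G P) G" using centralizer_sub subgroup.subset[OF P(1)] by blast
    have "v \<otimes> c = c \<otimes> v" using vc by (auto simp: centralizer_def)
    \<comment> \<open>The exponent \<open>p ^ k\<close> kills the factor \<open>v\<close> in
      \<open>P\<close> and is prime to the order of \<open>y\<close>; so \<open>y\<close> itself
      falls into the centraliser.\<close>
    then have "y [^] (p ^ k) = v [^] (p ^ k) \<otimes> c [^] (p ^ k)"
      unfolding vc(4) using pow_mult_distrib vc(1,2) ic by blast
    also have "\<dots> = c [^] (p ^ k)" using pow_card[OF P(1) vc(1)] P(3) vc ic by simp
    finally have "y [^] (p ^ k) \<in> centralizer G P" using pow_sub[OF C vc(3)] by simp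
    moreover have "coprime (p ^ k) (q ^ j)" using p q pq by (simp add: primes_coprime)
    ultimately have "y \<in> centralizer G P" using mem_of_pow[OF C _ _ y(2)] y ic by blast
    then show False using u by (auto simp: centralizer_def)
  qed
  ultimately show "(p, q) \<in> snd (sylow_graph (Sub H))"
    using p q sylow_graph_quotient(6)[OF H P(1,2)] by (auto simp: sylow_graph_def pi_sub)
qed

section \<open>Edges of the Schmidt graph in terms of elements\<close>

lemma prime_power_cop_commuting:
  assumes S: "subgroup S G" "card S = p ^ i" and p: "prime p"
  shows "cop_commuting S S"
  unfolding cop_commuting_def
proof (intro ballI impI)
  fix x y assume x: "x \<in> S" and y: "y \<in> S" and "cop_orders G x y"
  then obtain m n :: nat where mn: "coprime m n" "x [^] m = \<one>" "y [^] n = \<one>" by (auto simp: cop_orders_def)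
  note ic = sub_in[OF S(1)]
  have *: "z = \<one>" if "z \<in> S" "z [^] (l::nat) = \<one>" "\<not> p dvd l" for z l
  proof -
    have "coprime l (p ^ i)" using that p prime_power_coprime by blast
    then show ?thesis using one_pow_coprime[OF ic[OF that(1)] that(2)] pow_card[OF S(1) that(1)] S(2) by simp
  qed
  have "\<not> p dvd m \<or> \<not> p dvd n" using mn(1) p coprime_common_divisor not_prime_unit by blast
  then have "x = \<one> \<or> y = \<one>" using * x y mn by blast
  then show "x \<otimes> y = y \<otimes> x" using ic x y by auto
qed

text \<open>A Schmidt subgroup is not nilpotent, so it has non-commuting elements of coprime orders;
  as its order is p^k q^l, these are an element of the normal \<open>P\<close> and a
  \<open>q\<close>-element. Conversely, let \<open>U\<close> be the product of the cyclic group of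
  \<open>y\<close> with \<open>P\<close>. A non-nilpotent subgroup of \<open>U\<close> of least
  order is a Schmidt group; both primes divide its order since groups of prime power order are
  nilpotent, and \<open>P\<close> contains all its \<open>p\<close>-elements.\<close>

lemma schmidt_edge_iff:
  assumes H: "subgroup H G"
  shows "(p, q) \<in> snd (Nc_graph (Sub H)) \<longleftrightarrow> schmidt_edge H p q"
proof
  assume "(p, q) \<in> snd (Nc_graph (Sub H))"
  then obtain S where p: "prime p" and q: "prime q"
    and S: "schmidt_pq_subgroup (Sub H) p q S" by (auto simp: Nc_graph_def pi_sub)
  have S1: "subgroup S G" "S \<subseteq> H" using S sub_sub_iff[OF H] by (auto simp: schmidt_pq_subgroup_def)
  have nc: "\<not> cop_commuting S S"
    using S nilpotent_iff_cop_commuting[OF S1(1)] by (auto simp: schmidt_pq_subgroup_def schmidt_grp_def)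
  have pi: "{l. prime l \<and> l dvd card S} = {p, q}"
    using S by (simp add: schmidt_pq_subgroup_def pi_sub)
  obtain P k where P: "subgroup P G" "P \<subseteq> S" "normalizes S P" "card P = p ^ k" "\<not> p dvd card S div card P"
    using S sub_sub_iff[OF S1(1)] normal_sub_iff[OF S1(1)]
    by (auto simp: schmidt_pq_subgroup_def Sylow_subgroup_def order_def)
  obtain r where "card S = r * card P" using sub_index[OF S1(1) P(1,2)] .
  then have r: "card S = r * card P" "\<not> p dvd r" using P p by (simp_all add: prime_gt_0_nat)
  have "r \<noteq> 0" using r sub_card_pos[OF S1(1)] by (metis mult_0 not_less_zero)
  then obtain l r' where r': "r = q ^ l * r'" "\<not> q dvd r'"
    using multiplicity_decompose'[of r q] q not_prime_unit by metis
  have "r' = 1"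
  proof (rule ccontr)
    assume "r' \<noteq> 1"
    then obtain s where s: "prime s" "s dvd r'" using prime_factor_nat by blast
    then have "s dvd card S" using r(1) r'(1) by simp
    then have "s \<in> {p, q}" using s(1) unfolding pi[symmetric] by blast
    then show False using s r(2) r' by auto
  qed
  then have cS: "card S = p ^ k * q ^ l" using r r' P(4) by simp
  have pq: "p \<noteq> q"
  proof
    assume "p = q"
    then have "card S = p ^ (k + l)" using cS by (simp add: power_add)
    then show False using nc prime_power_cop_commuting S1(1) p by blast
  qed
  note ic = sub_in[OF S1(1)]
  have main: "schmidt_edge H p q"
    if x: "x \<in> S" "x [^] (m::nat) = \<one>" and y: "y \<in> S" "y [^] (n::nat) = \<one>" and mn: "coprime m n"
      and ne: "y \<otimes> x \<noteq> x \<otimes> y" and pm: "p dvd m" and qn: "q dvd n" for x y m n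
  proof -
    have qm: "\<not> q dvd m" using mn q qn coprime_common_divisor not_prime_unit by blast
    have pn: "\<not> p dvd n" using mn p pm coprime_common_divisor not_prime_unit by blast
    have "coprime m (q ^ l)" using qm q prime_power_coprime by blast
    moreover have "x [^] (p ^ k * q ^ l) = \<one>" using pow_card[OF S1(1) x(1)] cS by simp
    ultimately have "x [^] (p ^ k) = \<one>" using one_pow_factor[OF ic[OF x(1)] _ x(2)] by blast
    then have xP: "x \<in> P" using el_of_not_dvd_index[OF S1(1) P(1-3) r(1) p r(2) x(1)] by blast
    have "coprime n (p ^ k)" using pn p prime_power_coprime by blast
    moreover have "y [^] (q ^ l * p ^ k) = \<one>" using pow_card[OF S1(1) y(1)] cS by (simp add: mult.commute)
    ultimately have "y [^] (q ^ l) = \<one>" using one_pow_factor[OF ic[OF y(1)] _ y(2)] by blast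
    moreover have "normalizes {y} P" using normalizes_mono[OF P(3)] y by blast
    ultimately show ?thesis
      unfolding schmidt_edge_def using p q pq P S1 y ne xP by blast
  qed
  obtain x y where xy: "x \<in> S" "y \<in> S" "cop_orders G x y" "x \<otimes> y \<noteq> y \<otimes> x" using nc by (auto simp: cop_commuting_def)
  then obtain m n :: nat where mn: "coprime m n" "x [^] m = \<one>" "y [^] n = \<one>" by (auto simp: cop_orders_def)
  \<comment> \<open>An exponent killing a non-trivial element of \<open>S\<close> is divisible by
    \<open>p\<close> or \<open>q\<close>. As \<open>m\<close> and \<open>n\<close> are coprime, one
    takes \<open>p\<close> and the other \<open>q\<close>, which is the situation of
    \<open>main\<close> up to exchanging \<open>x\<close> and \<open>y\<close>.\<close>
  have *: "p dvd i \<or> q dvd i" if "z \<in> S" "z [^] (i::nat) = \<one>" "z \<noteq> \<one>" for z i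
  proof (rule ccontr)
    assume "\<not> (p dvd i \<or> q dvd i)"
    then have "coprime i (p ^ k)" "coprime i (q ^ l)" using p q prime_power_coprime by blast+
    then have "coprime i (card S)" using cS by simp
    then show False using one_pow_coprime[OF ic[OF that(1)] that(2) pow_card[OF S1(1) that(1)]] that(3) by blast
  qed
  have "x \<noteq> \<one>" "y \<noteq> \<one>" using xy ic by auto
  then have "p dvd m \<or> q dvd m" "p dvd n \<or> q dvd n" using * xy mn by blast+
  moreover have "\<not> (p dvd m \<and> p dvd n)" "\<not> (q dvd m \<and> q dvd n)"
    using mn(1) p q coprime_common_divisor not_prime_unit by blast+
  ultimately consider "p dvd m" "q dvd n" | "p dvd n" "q dvd m" by blast
  then show "schmidt_edge H p q"
  proof cases
    case 1
    then show ?thesis using main[of x m y n] xy mn by metis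
  next
    case 2
    then show ?thesis using main[of y n x m] xy mn by (metis coprime_commute)
  qed
next
  assume "schmidt_edge H p q"
  then obtain P y k j u where p: "prime p" and q: "prime q" and pq: "p \<noteq> q"
    and P: "subgroup P G" "P \<subseteq> H" "card P = p ^ k"
    and y: "y \<in> H" "y [^] (q ^ j) = \<one>" "normalizes {y} P" and u: "u \<in> P" "y \<otimes> u \<noteq> u \<otimes> y"
    by (auto simp: schmidt_edge_def)
  note ic = sub_in[OF H] sub_in[OF P(1)]
  have yc: "y \<in> carrier G" using ic y by blast
  have Pc: "P \<subseteq> carrier G" by (rule subgroup.subset[OF P(1)])
  let ?Y = "generate G {y}" let ?U = "?Y <#> P"
  have Y: "subgroup ?Y G" using generate_is_subgroup yc by simp
  have YP: "normalizes ?Y P"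
  proof -
    have "?Y \<subseteq> {g \<in> carrier G. normalizes {g} P}"
      using generate_subgroup_incl[OF _ normalizer_sub[OF Pc]] y yc by simp
    then show ?thesis by (auto simp: normalizes_def)
  qed
  have U: "subgroup ?U G" by (rule set_mult_sub_normalizes[OF Y P(1) YP])
  have yY: "y \<in> ?Y" by (simp add: generate.incl)
  have UH: "?U \<subseteq> H" using set_mult_least[OF H _ P(2)] generate_subgroup_incl[OF _ H] y by simp
  have UP: "normalizes ?U P"
    by (rule set_mult_normalizes[OF subgroup.subset[OF Y] Pc Pc YP normalizes_sub[OF P(1)]])
  have PU: "P \<subseteq> ?U" "?Y \<subseteq> ?U" using sub_set_mult_left sub_set_mult_right Y P(1) by blast+
  have "card ?Y = ord y" using generate_pow_card[OF yc] by simp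
  then have "card ?Y dvd q ^ j" using pow_eq_id[OF yc] y(2) by simp
  then obtain i where i: "card ?Y = q ^ i" using divides_primepow_nat[OF q] by blast
  obtain h where h: "card ?U = h * card P" using sub_index[OF U P(1) PU(1)] .
  have "h * card (?Y \<inter> P) * card P = q ^ i * card P" using card_set_mult[OF Y P(1)] h i by (simp add: mult_ac)
  then have "h * card (?Y \<inter> P) = q ^ i" using sub_card_pos[OF P(1)] by simp
  then have hq: "h dvd q ^ i" by (metis dvd_triv_left)
  have ph: "\<not> p dvd h"
  proof
    assume "p dvd h"
    then have "p dvd q" using dvd_trans[OF _ hq] p prime_dvd_power by blast
    then show False using p q pq primes_dvd_imp_eq by blast
  qed
  have dU: "card ?U dvd q ^ i * p ^ k" using h hq P(3) by simp
  have ncU: "\<not> cop_commuting ?U ?U"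
  proof
    assume "cop_commuting ?U ?U"
    moreover have "cop_orders G y u"
      using cop_ordersI[OF y(2), of u "p ^ k"] pow_card[OF P(1) u(1)] P(3) p q pq by (simp add: primes_coprime)
    ultimately show False using PU yY u by (auto simp: cop_commuting_def)
  qed
  \<comment> \<open>By \<open>nilpotent_iff_cop_commuting\<close> these are the non-nilpotent
    subgroups of \<open>?U\<close>; least order makes all proper subgroups nilpotent.\<close>
  let ?good = "\<lambda>S. subgroup S G \<and> S \<subseteq> ?U \<and> \<not> cop_commuting S S"
  obtain S where S: "?good S" and min: "\<And>T. ?good T \<Longrightarrow> card S \<le> card T"
    using ex_has_least_nat[of ?good ?U card] U ncU by blast
  then have S1: "subgroup S G" "S \<subseteq> ?U" "\<not> cop_commuting S S" by auto
  have "schmidt_grp (Sub S)"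
  proof -
    have "cop_commuting T T" if T: "subgroup T G" "T \<subseteq> S" "T \<noteq> S" for T
    proof (rule ccontr)
      assume "\<not> cop_commuting T T"
      then have "card S \<le> card T" using min T S1 by blast
      then show False using card_seteq[OF sub_fin[OF S1(1)] T(2)] T(3) by blast
    qed
    then show ?thesis
      using nilpotent_iff_cop_commuting S1 sub_sub_iff[OF S1(1)] by (auto simp: schmidt_grp_def)
  qed
  moreover have dS: "card S dvd q ^ i * p ^ k" using dvd_trans[OF sub_card_dvd[OF U S1(1,2)] dU] .
  have pS: "p dvd card S"
  proof (rule ccontr)
    assume "\<not> p dvd card S"
    then have "coprime (card S) (p ^ k)" using p prime_power_coprime by blast
    then have "card S dvd q ^ i" using dS coprime_dvd_mult_left_iff by blast
    then show False using divides_primepow_nat[OF q] prime_power_cop_commuting[OF S1(1) _ q] S1(3) by blast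
  qed
  have qS: "q dvd card S"
  proof (rule ccontr)
    assume "\<not> q dvd card S"
    then have "coprime (card S) (q ^ i)" using q prime_power_coprime by blast
    then have "card S dvd p ^ k" using dS coprime_dvd_mult_right_iff by blast
    then show False using divides_primepow_nat[OF p] prime_power_cop_commuting[OF S1(1) _ p] S1(3) by blast
  qed
  have "pi_grp (Sub S) = {p, q}"
  proof -
    have "s = p \<or> s = q" if s: "prime s" "s dvd card S" for s
    proof -
      have "s dvd q ^ i \<or> s dvd p ^ k" using s dvd_trans[OF s(2) dS] prime_dvd_mult_iff by blast
      then have "s dvd q \<or> s dvd p" using s(1) prime_dvd_power by blast
      then show ?thesis using s(1) p q primes_dvd_imp_eq by blast
    qed
    then show ?thesis using p q pS qS by (auto simp: pi_sub)
  qed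
  moreover have "Sylow_subgroup (Sub S) p (P \<inter> S)"
  proof -
    have PS: "subgroup (P \<inter> S) G" by (rule sub_Int[OF P(1) S1(1)])
    have "card (P \<inter> S) dvd p ^ k" using sub_card_dvd[OF P(1) PS] P(3) by simp
    then have "\<exists>e. card (P \<inter> S) = p ^ e" using divides_primepow_nat[OF p] by blast
    moreover obtain r where r: "card S = r * card (P \<inter> S)" using sub_index[OF S1(1) PS] by blast
    have "\<not> p dvd r"
    proof
      assume "p dvd r"
      then obtain x e where x: "x \<in> S" "x \<notin> P \<inter> S" "x [^] (p ^ e) = \<one>"
        using index_prime_el[OF S1(1) PS _ r p] by blast
      then have "x \<in> P" using el_of_not_dvd_index[OF U P(1) PU(1) UP h p ph] S1(2) by blast
      then show False using x by blast
    qed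
    ultimately show ?thesis
      using r sub_card_pos[OF PS] PS sub_sub_iff[OF S1(1)] by (auto simp: Sylow_subgroup_def order_def)
  qed
  moreover have "P \<inter> S \<lhd> Sub S"
  proof -
    have "normalizes S (P \<inter> S)"
      using UP S1(2) cnj_sub[OF S1(1)] by (auto simp: normalizes_def subset_iff)
    then show ?thesis using normal_sub_iff[OF S1(1)] sub_Int[OF P(1) S1(1)] by blast
  qed
  ultimately have "schmidt_pq_subgroup (Sub H) p q S"
    using S1 UH sub_sub_iff[OF H] by (auto simp: schmidt_pq_subgroup_def)
  moreover have "p dvd card H" "q dvd card H"
    using dvd_trans[OF pS] dvd_trans[OF qS] sub_card_dvd[OF H S1(1)] S1(2) UH by auto
  ultimately show "(p, q) \<in> snd (Nc_graph (Sub H))"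
    using p q by (auto simp: Nc_graph_def pi_sub)
qed

end

section \<open>The nilpotent residual in a product of two subgroups\<close>

context fin_group
begin

definition nil_residual :: "'a set \<Rightarrow> 'a set" where
  "nil_residual H = generate G {cmt x y | x y. x \<in> H \<and> y \<in> H \<and> cop_orders G x y}"

lemma nil_residual_gens: "subgroup H G \<Longrightarrow> {cmt x y | x y. x \<in> H \<and> y \<in> H \<and> cop_orders G x y} \<subseteq> H"
  using cmt_sub by blast

lemma nil_residual_incl: "subgroup H G \<Longrightarrow> nil_residual H \<subseteq> H"
  unfolding nil_residual_def by (rule generate_subgroup_incl[OF nil_residual_gens])

lemma nil_residual_sub: "subgroup H G \<Longrightarrow> subgroup (nil_residual H) G"
  unfolding nil_residual_def by (rule generate_is_subgroup) (use nil_residual_gens subgroup.subset in blast)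

lemma cop_orders_cmt_nil_residual: "x \<in> H \<Longrightarrow> y \<in> H \<Longrightarrow> cop_orders G x y \<Longrightarrow> cmt x y \<in> nil_residual H"
  unfolding nil_residual_def by (rule generate.incl) blast

lemma cop_orders_cnj:
  assumes "g \<in> carrier G" "x \<in> carrier G" "y \<in> carrier G" "cop_orders G x y"
  shows "cop_orders G (cnj g x) (cnj g y)"
proof -
  obtain m n :: nat where mn: "coprime m n" "x [^] m = \<one>" "y [^] n = \<one>"
    using assms(4) by (auto simp: cop_orders_def)
  have "(cnj g x) [^] m = \<one>" "(cnj g y) [^] n = \<one>" using cnj_pow mn assms by auto
  then show ?thesis using cop_ordersI mn(1) by blast
qed

lemma normalizes_nil_residual:
  assumes H: "subgroup H G"
  shows "normalizes H (nil_residual H)"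
proof -
  note ic = sub_in[OF H]
  have "normalizes (generate G H) (nil_residual H)"
    unfolding nil_residual_def
  proof (rule normalizes_generate)
    show "{cmt x y | x y. x \<in> H \<and> y \<in> H \<and> cop_orders G x y} \<subseteq> carrier G"
      using nil_residual_gens[OF H] subgroup.subset[OF H] by blast
    show "H \<subseteq> carrier G" by (rule subgroup.subset[OF H])
    fix h c assume h: "h \<in> H" and "c \<in> {cmt x y | x y. x \<in> H \<and> y \<in> H \<and> cop_orders G x y}"
    then obtain x y where c: "c = cmt x y" "x \<in> H" "y \<in> H" "cop_orders G x y" by blast
    have "cnj h c = cmt (cnj h x) (cnj h y)" using c h ic by (simp add: word_simps)
    moreover have "cop_orders G (cnj h x) (cnj h y)" using cop_orders_cnj c h ic by blast
    ultimately show "cnj h c \<in> generate G {cmt x y | x y. x \<in> H \<and> y \<in> H \<and> cop_orders G x y}"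
      using cnj_sub[OF H h] c by (intro generate.incl) blast
  qed
  then show ?thesis by (rule normalizes_mono) (blast intro: generate.incl)
qed

lemma nil_residual_centralized:
  assumes A: "subgroup A G" and B: "subgroup B G" and cc: "cop_commuting A B"
    and r: "r \<in> nil_residual A" and g: "g \<in> B"
  shows "r \<otimes> g = g \<otimes> r"
proof -
  note ic = sub_in[OF A] sub_in[OF B]
  have "c \<otimes> g = g \<otimes> c" if "c \<in> {cmt x y | x y. x \<in> A \<and> y \<in> A \<and> cop_orders G x y}" "g \<in> B" for c g
  proof -
    obtain x y where c: "c = cmt x y" "x \<in> A" "y \<in> A" "cop_orders G x y" using \<open>c \<in> _\<close> by blast
    have xyc: "x \<in> carrier G" "y \<in> carrier G" "g \<in> carrier G" using c ic that by auto
    obtain a b where ab: "order G = a * b" "coprime a b" "x [^] a = \<one>" "y [^] b = \<one>"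
      using cop_orders_parts[OF c(4) xyc(1,2)] .
    obtain s t :: nat where st: "g = g [^] s \<otimes> g [^] t" "(g [^] s) [^] a = \<one>" "(g [^] t) [^] b = \<one>"
      using part_exponents[OF ab(1,2)] xyc by metis
    \<comment> \<open>The commutator \<open>c\<close> has two readings: \<open>x\<close> times a
      conjugate of x^-1, which commutes with \<open>g [^] t\<close>, and a conjugate of
      \<open>y\<close> times y^-1, which commutes with \<open>g [^] s\<close>.\<close>
    let ?x = "y \<otimes> inv x \<otimes> inv y" let ?y = "cnj x y"
    have "cmt x y \<in> A" using cmt_sub[OF A] c by blast
    have gB: "g [^] s \<in> B" "g [^] t \<in> B" using pow_sub[OF B] that by auto
    have inA: "?x \<in> A" "?y \<in> A" using c A by (simp_all add: subgroup.m_closed subgroup.m_inv_closed)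
    have "(inv x) [^] a = \<one>" using ab xyc by (metis inv_one nat_pow_inv)
    then have pw: "?x [^] a = \<one>" "?y [^] b = \<one>" using cnj_pow ab xyc by auto
    have ba: "coprime b a" using ab(2) by (simp add: coprime_commute)
    have comm: "u \<otimes> w = w \<otimes> u" if "cop_orders G u w" "u \<in> A" "w \<in> B" for u w
      using cc that unfolding cop_commuting_def by blast
    have t: "x \<otimes> g [^] t = g [^] t \<otimes> x" "?x \<otimes> g [^] t = g [^] t \<otimes> ?x"
      by (rule comm[OF cop_ordersI[OF ab(3) st(3) ab(2)] c(2) gB(2)],
          rule comm[OF cop_ordersI[OF pw(1) st(3) ab(2)] inA(1) gB(2)])
    have s: "y \<otimes> g [^] s = g [^] s \<otimes> y" "?y \<otimes> g [^] s = g [^] s \<otimes> ?y"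
      by (rule comm[OF cop_ordersI[OF ab(4) st(2) ba] c(3) gB(1)],
          rule comm[OF cop_ordersI[OF pw(2) st(2) ba] inA(2) gB(1)])
    let ?C = "centralizer G {g [^] t}" let ?D = "centralizer G {g [^] s}"
    have CD: "subgroup ?C G" "subgroup ?D G" using xyc centralizer_sub by auto
    have xC: "x \<in> ?C" "?x \<in> ?C" using t xyc by (auto simp: centralizer_def)
    have "x \<otimes> ?x \<in> ?C" by (rule subgroup.m_closed[OF CD(1) xC])
    then have 1: "c \<in> ?C" using c xyc by (simp add: m_assoc)
    have yD: "y \<in> ?D" "?y \<in> ?D" using s xyc by (auto simp: centralizer_def)
    have "?y \<otimes> inv y \<in> ?D"
      by (rule subgroup.m_closed[OF CD(2) yD(2) subgroup.m_inv_closed[OF CD(2) yD(1)]])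
    then have 2: "c \<in> ?D" using c by simp
    have "c \<in> carrier G" using c xyc by simp
    then have "g [^] s \<in> centralizer G {c}" "g [^] t \<in> centralizer G {c}"
      using 1 2 xyc by (auto simp: centralizer_def)
    then have "g [^] s \<otimes> g [^] t \<in> centralizer G {c}"
      using subgroup.m_closed[OF centralizer_sub[of "{c}"]] \<open>c \<in> carrier G\<close> by simp
    then have "g \<in> centralizer G {c}" using st(1) by simp
    then show ?thesis by (auto simp: centralizer_def)
  qed
  moreover have "{cmt x y | x y. x \<in> A \<and> y \<in> A \<and> cop_orders G x y} \<subseteq> carrier G"
    using nil_residual_gens[OF A] subgroup.subset[OF A] by blast
  ultimately show ?thesis
    using commute_generate[OF _ subgroup.subset[OF B]] r g generate.incl[of g B G]
    unfolding nil_residual_def by blast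
qed

section \<open>Commutators modulo a normal subgroup, coprime action and Sylow counting\<close>

lemma cmt_left_sub:
  assumes N: "subgroup N G" "normalizes (carrier G) N" and v: "v \<in> carrier G"
  shows "subgroup {u \<in> carrier G. cmt u v \<in> N} G"
proof (rule sub_closedI)
  fix g h assume gh: "g \<in> {u \<in> carrier G. cmt u v \<in> N}" "h \<in> {u \<in> carrier G. cmt u v \<in> N}"
  have "cmt (g \<otimes> h) v = cnj g (cmt h v) \<otimes> cmt g v" using gh v by (simp add: word_simps)
  moreover have "cnj g (cmt h v) \<in> N" using gh normalizesD[OF N(2)] by blast
  ultimately show "g \<otimes> h \<in> {u \<in> carrier G. cmt u v \<in> N}" using gh N(1) by (simp add: subgroup.m_closed)
qed (use v subgroup.one_closed[OF N(1)] in auto)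

lemma cmt_right_sub:
  assumes N: "subgroup N G" "normalizes (carrier G) N" and v: "v \<in> carrier G"
  shows "subgroup {u \<in> carrier G. cmt v u \<in> N} G"
proof (rule sub_closedI)
  fix g h assume gh: "g \<in> {u \<in> carrier G. cmt v u \<in> N}" "h \<in> {u \<in> carrier G. cmt v u \<in> N}"
  have "cmt v (g \<otimes> h) = cmt v g \<otimes> cnj g (cmt v h)" using gh v by (simp add: word_simps)
  moreover have "cnj g (cmt v h) \<in> N" using gh normalizesD[OF N(2)] by blast
  ultimately show "g \<otimes> h \<in> {u \<in> carrier G. cmt v u \<in> N}" using gh N(1) by (simp add: subgroup.m_closed)
qed (use v subgroup.one_closed[OF N(1)] in auto)

lemma cmt_generate:
  assumes N: "subgroup N G" "normalizes (carrier G) N" and S: "S \<subseteq> carrier G" and T: "T \<subseteq> carrier G"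
    and st: "\<And>s t. s \<in> S \<Longrightarrow> t \<in> T \<Longrightarrow> cmt s t \<in> N"
    and u: "u \<in> generate G S" and v: "v \<in> generate G T"
  shows "cmt u v \<in> N"
proof -
  have uc: "u \<in> carrier G" using u generate_incl[OF S] by blast
  have "cmt u t \<in> N" if "t \<in> T" for t
  proof -
    have "generate G S \<subseteq> {u \<in> carrier G. cmt u t \<in> N}"
      by (rule generate_subgroup_incl[OF _ cmt_left_sub[OF N]]) (use S T st that in auto)
    then show ?thesis using u by blast
  qed
  then have "generate G T \<subseteq> {t \<in> carrier G. cmt u t \<in> N}"
    by (intro generate_subgroup_incl[OF _ cmt_right_sub[OF N uc]]) (use T in auto)
  then show ?thesis using v by blast
qed

lemma cmt_normal_mem:
  assumes N: "subgroup N G" "normalizes (carrier G) N" and n: "n \<in> N" and g: "g \<in> carrier G"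
  shows "cmt n g \<in> N" "cmt g n \<in> N"
proof -
  have nc: "n \<in> carrier G" using sub_in[OF N(1) n] .
  have "cmt n g = n \<otimes> cnj g (inv n)" using nc g by (simp add: word_simps)
  then show "cmt n g \<in> N" using normalizesD[OF N(2) g] N(1) n by (simp add: subgroup.m_closed subgroup.m_inv_closed)
  show "cmt g n \<in> N" using normalizesD[OF N(2) g n] N(1) n by (simp add: subgroup.m_closed subgroup.m_inv_closed)
qed

text \<open>Normality keeps y r y^-1 inside \<open>K\<close>, where \<open>x\<close> and
  \<open>y\<close> again act alike.\<close>

lemma act_pow:
  assumes K: "subgroup K G" "normalizes (carrier G) K" and x: "x \<in> carrier G" and y: "y \<in> carrier G"
    and e: "\<And>r. r \<in> K \<Longrightarrow> cnj x r = cnj y r" and r: "r \<in> K"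
  shows "cnj (x [^] (n::nat)) r = cnj (y [^] n) r"
  using r
proof (induction n arbitrary: r)
  case 0 then show ?case by simp
next
  case (Suc n)
  have rc: "r \<in> carrier G" using sub_in[OF K(1) Suc.prems] .
  have "cnj (x [^] Suc n) r = cnj (x [^] n) (cnj x r)" using x rc by (simp add: word_simps)
  also have "\<dots> = cnj (x [^] n) (cnj y r)" using e Suc.prems by simp
  also have "\<dots> = cnj (y [^] n) (cnj y r)" using Suc.IH normalizesD[OF K(2) y Suc.prems] by blast
  also have "\<dots> = cnj (y [^] Suc n) r" using y rc by (simp add: word_simps)
  finally show ?case .
qed

text \<open>This is \<open>part_exponents\<close> for the full \<open>q\<close>-part of the group
  order. Because \<open>s\<close> is uniform, elements that act alike have \<open>q\<close>-parts
  that act alike.\<close>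

lemma q_part:
  assumes q: "prime (q::nat)"
  obtains s k :: nat where "\<And>x. x \<in> carrier G \<Longrightarrow> (x [^] s) [^] (q ^ k) = \<one>"
    "\<And>x j. x \<in> carrier G \<Longrightarrow> x [^] (q ^ j) = \<one> \<Longrightarrow> x [^] s = x"
proof -
  obtain k b where o: "order G = q ^ k * b" "coprime (q ^ k) b" "\<not> q dvd b" using prime_split[OF q] .
  obtain s t :: nat where st: "\<And>x. x \<in> carrier G \<Longrightarrow> (x [^] s) [^] (q ^ k) = \<one>"
    "\<And>x. x \<in> carrier G \<Longrightarrow> x [^] (q ^ k) = \<one> \<Longrightarrow> x [^] s = x"
    using part_exponents[OF o(1,2)] by metis
  have "x [^] s = x" if x: "x \<in> carrier G" "x [^] (q ^ j) = \<one>" for x j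
  proof -
    have "coprime (q ^ j) b" using o q prime_power_coprime by blast
    then show ?thesis using st(2) x one_pow_part[OF o(1) x] by blast
  qed
  then show ?thesis using that st(1) by blast
qed

text \<open>If \<open>y\<close> commuted with \<open>v = [y, u]\<close>, then conjugation by \<open>y\<^sup>n\<close> would map \<open>u\<close> to \<open>v\<^sup>n u\<close>.\<close>

lemma coprime_action_cmt:
  assumes P: "subgroup P G" "card P = p ^ k" and p: "prime p"
    and q: "prime q" and pq: "p \<noteq> q"
    and y: "y \<in> carrier G" "y [^] (q ^ j) = \<one>" "normalizes {y} P" and u: "u \<in> P" "y \<otimes> u \<noteq> u \<otimes> y"
  shows "cop_orders G y u" "cmt y u \<in> P" "y \<otimes> cmt y u \<noteq> cmt y u \<otimes> y"
proof -
  define v where "v = cmt y u"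
  have uc: "u \<in> carrier G" using sub_in[OF P(1) u(1)] .
  have c: "coprime (q ^ j) (p ^ k)" using p q pq by (simp add: primes_coprime)
  show "cop_orders G y u" using cop_ordersI[OF y(2), of u "p ^ k"] pow_card[OF P(1) u(1)] P(2) c by simp
  have vP: "v \<in> P" unfolding v_def using y(3) u P(1) by (simp add: normalizes_def subgroup.m_closed subgroup.m_inv_closed)
  have vc: "v \<in> carrier G" using sub_in[OF P(1) vP] .
  show "cmt y u \<in> P" using vP by (simp add: v_def)
  show "y \<otimes> cmt y u \<noteq> cmt y u \<otimes> y"
    unfolding v_def[symmetric]
  proof
    assume yv: "y \<otimes> v = v \<otimes> y"
    have e: "cnj y u = v \<otimes> u" unfolding v_def using uc y by (simp add: word_simps)
    have "cnj (y [^] n) u = v [^] n \<otimes> u" for n :: nat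
    proof (induction n)
      case 0 then show ?case using uc by simp
    next
      case (Suc n)
      have "cnj (y [^] Suc n) u = cnj y (cnj (y [^] n) u)"
        using y uc nat_pow_Suc2[OF y(1)] by (simp add: word_simps del: nat_pow_Suc)
      also have "\<dots> = cnj y (v [^] n \<otimes> u)" using Suc.IH by simp
      also have "\<dots> = cnj y (v [^] n) \<otimes> cnj y u" using y uc vc by (simp add: word_simps del: nat_pow_Suc)
      also have "cnj y (v [^] n) = v [^] n"
      proof -
        have "v [^] n \<otimes> y = y \<otimes> v [^] n" using commute_pow[OF vc y(1)] yv by simp
        then show ?thesis using commute_iff_cnj y(1) vc nat_pow_closed by metis
      qed
      also have "v [^] n \<otimes> cnj y u = v [^] Suc n \<otimes> u" unfolding e using vc uc by (simp add: m_assoc)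
      finally show ?case .
    qed
    \<comment> \<open>As \<open>y [^] (q ^ j)\<close> is trivial, the \<open>p\<close>-element
      \<open>v\<close> is killed by a power of \<open>q\<close>.\<close>
    from this[of "q ^ j"] have "v [^] (q ^ j) \<otimes> u = u" using y uc by simp
    then have "v [^] (q ^ j) = \<one>" using vc uc by (metis nat_pow_closed r_cancel_one')
    moreover have "v [^] (p ^ k) = \<one>" using pow_card[OF P(1) vP] P(2) by simp
    ultimately have "v = \<one>" using one_pow_coprime[OF vc] c by blast
    then show False using u commute_iff_cmt[OF y(1) uc] by (simp add: v_def)
  qed
qed

text \<open>The index of \<open>P \<inter> N\<close> in \<open>N\<close> equals that of
  \<open>P\<close> in \<open>P <#> N\<close>, which is prime to \<open>p\<close>.\<close>

lemma sylow_normal_Int: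
  assumes p: "prime (p::nat)"
    and P: "subgroup P G" "card P = p ^ k" "order G = p ^ k * r" "\<not> p dvd r"
    and N: "subgroup N G" "normalizes (carrier G) N"
  obtains e d where "card (P \<inter> N) = p ^ e" "card N = p ^ e * d" "\<not> p dvd d"
proof -
  have PN: "subgroup (P \<inter> N) G" by (rule sub_Int[OF P(1) N(1)])
  have U: "subgroup (P <#> N) G"
    using set_mult_sub_normalizes[OF P(1) N(1) normalizes_mono[OF N(2) subgroup.subset[OF P(1)]]] .
  obtain d where d: "card (P <#> N) = d * card P"
    using sub_index[OF U P(1)] sub_set_mult_left[OF P(1) N(1)] by blast
  have pd: "\<not> p dvd d"
    using not_dvd_sub_index[where k = k and d = d, OF p subgroup_self _ P(4) U subgroup.subset[OF U]] d P
    by (simp add: order_def)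
  have "p ^ k * (d * card (P \<inter> N)) = p ^ k * card N"
    using card_set_mult[OF P(1) N(1)] d P(2) by (simp add: mult_ac)
  then have "card N = card (P \<inter> N) * d" using p by (simp add: prime_gt_0_nat mult.commute)
  moreover have "card (P \<inter> N) dvd p ^ k" using sub_card_dvd[OF P(1) PN] P(2) by simp
  then obtain e where "card (P \<inter> N) = p ^ e" using divides_primepow_nat[OF p] by blast
  ultimately show ?thesis using that[of e d] pd by simp
qed

text \<open>In |A| |B| = |AB| |A \<inter> B| the p-part of the left side is p^(e+f), and the right
  side is divisible by p^(k+i), where p^i is the order of the intersection of the two factors. Hence
  their product, of order p^(e+f-i), is at least as large as \<open>P\<close>.\<close>

lemma sylow_factorization:
  assumes p: "prime (p::nat)" and A: "subgroup A G" and B: "subgroup B G"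
    and H: "subgroup (A <#> B) G"
    and P: "subgroup P G" "card P = p ^ k" "card (A <#> B) = p ^ k * r"
    and PA: "card (P \<inter> A) = p ^ e" "card A = p ^ e * ra" "\<not> p dvd ra"
    and PB: "card (P \<inter> B) = p ^ f" "card B = p ^ f * rb" "\<not> p dvd rb"
  shows "P = (P \<inter> A) <#> (P \<inter> B)"
proof -
  let ?X = "(P \<inter> A) <#> (P \<inter> B)"
  have sA: "subgroup (P \<inter> A) G" and sB: "subgroup (P \<inter> B) G" and sAB: "subgroup (A \<inter> B) G"
    using sub_Int P A B by auto
  have I: "subgroup (P \<inter> A \<inter> (P \<inter> B)) G" by (rule sub_Int[OF sA sB])
  have XP: "?X \<subseteq> P" by (rule set_mult_least[OF P(1)]) auto
  have "card (P \<inter> A \<inter> (P \<inter> B)) dvd p ^ e" using sub_card_dvd[OF sA I] PA(1) by auto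
  then obtain i where i: "card (P \<inter> A \<inter> (P \<inter> B)) = p ^ i" using divides_primepow_nat[OF p] by blast
  have "p ^ i dvd card (A \<inter> B)" using sub_card_dvd[OF sAB I] i by auto
  then obtain c where c: "card (A \<inter> B) = p ^ i * c" by blast
  have "p ^ k * r * (p ^ i * c) = p ^ e * ra * (p ^ f * rb)"
    using card_set_mult[OF A B] P(3) c PA(2) PB(2) by simp
  then have "p ^ (k + i) * (r * c) = p ^ (e + f) * (ra * rb)" by (simp add: power_add mult_ac)
  then have "p ^ (k + i) dvd p ^ (e + f) * (ra * rb)" by (metis dvd_triv_left)
  moreover have "coprime (p ^ (k + i)) (ra * rb)"
    using PA(3) PB(3) p prime_power_coprime prime_dvd_mult_iff by blast
  ultimately have "p ^ (k + i) dvd p ^ (e + f)" using coprime_dvd_mult_left_iff by blast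
  then have le: "p ^ (k + i) \<le> p ^ (e + f)" using p by (simp add: dvd_imp_le prime_gt_0_nat)
  have "card ?X * p ^ i = p ^ (e + f)"
    using card_set_mult[OF sA sB] i PA(1) PB(1) by (simp add: power_add)
  then have "p ^ k * p ^ i \<le> card ?X * p ^ i" using le by (simp add: power_add)
  then have "card P \<le> card ?X" using P(2) p by (simp add: prime_gt_0_nat)
  then show ?thesis using card_seteq[OF sub_fin[OF P(1)] XP] by simp
qed

lemma cop_commuting_sym: "cop_commuting A B \<Longrightarrow> cop_commuting B A"
  using cop_orders_sym by (auto simp: cop_commuting_def)

lemma set_mult_comm:
  assumes A: "subgroup A G" and B: "subgroup B G" and AB: "subgroup (A <#> B) G"
  shows "B <#> A = A <#> B"
proof -
  have inv: "B' <#> A' \<subseteq> A' <#> B'" if A: "subgroup A' G" and B: "subgroup B' G" and H: "subgroup (A' <#> B') G" for A' B'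
    by (rule set_mult_least[OF H sub_set_mult_right[OF A B] sub_set_mult_left[OF A B]])
  have "A <#> B \<subseteq> B <#> A"
  proof
    fix x assume x: "x \<in> A <#> B"
    then have "inv x \<in> A <#> B" using AB by (simp add: subgroup.m_inv_closed)
    then obtain a b where ab: "a \<in> A" "b \<in> B" "inv x = a \<otimes> b" by (rule set_multE)
    then have "x = inv b \<otimes> inv a"
      using sub_in[OF A] sub_in[OF B] sub_in[OF AB x] by (metis inv_inv inv_mult_group)
    then show "x \<in> B <#> A" using ab A B set_multI subgroup.m_inv_closed by metis
  qed
  then show ?thesis using inv[OF A B AB] by blast
qed

end

section \<open>Residuals and coprime commutators in a product of two subgroups\<close>

locale cop_product = fin_group +
  fixes A B :: "'a set"
  assumes A: "subgroup A G" and B: "subgroup B G" and AB: "carrier G = A <#> B" and cc: "cop_commuting A B"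
begin

abbreviation "RA \<equiv> nil_residual A"
abbreviation "RB \<equiv> nil_residual B"
abbreviation "R \<equiv> RA <#> RB"
abbreviation "CA \<equiv> centralizer G RA"

lemma AB_sub: "subgroup (A <#> B) G"
  using subgroup_self AB by simp

text \<open>The hypotheses are symmetric; interpreting this instance yields for \<open>B\<close>
  every fact proved for \<open>A\<close>.\<close>

lemma swap: "cop_product G B A"
  by (intro cop_product.intro fin_group_axioms cop_product_axioms.intro B A cop_commuting_sym[OF cc]
      trans[OF AB set_mult_comm[OF A B AB_sub, symmetric]])

lemmas Ain = sub_in[OF A] and Bin = sub_in[OF B]

lemma RA: "subgroup RA G" "RA \<subseteq> A"
  using nil_residual_sub nil_residual_incl A by auto

lemma RA_B: "r \<in> RA \<Longrightarrow> b \<in> B \<Longrightarrow> r \<otimes> b = b \<otimes> r"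
  using nil_residual_centralized[OF A B cc] .

lemma decompose:
  assumes "g \<in> carrier G"
  obtains a b where "a \<in> A" "b \<in> B" "g = a \<otimes> b"
  using assms unfolding AB by (rule set_multE)

lemma cnj_RA_B: "r \<in> RA \<Longrightarrow> b \<in> B \<Longrightarrow> cnj b r = r"
  using RA_B commute_iff_cnj sub_in[OF RA(1)] Bin by metis

lemma normalizes_carrierI:
  assumes K: "K \<subseteq> carrier G" and a: "normalizes A K" and b: "normalizes B K"
  shows "normalizes (carrier G) K"
  using set_mult_normalizes[OF subgroup.subset[OF A] subgroup.subset[OF B] assms] AB by simp

lemma RA_normal: "normalizes (carrier G) RA"
proof (rule normalizes_carrierI)
  show "RA \<subseteq> carrier G" using RA subgroup.subset by blast
  show "normalizes A RA" by (rule normalizes_nil_residual[OF A])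
  show "normalizes B RA" using cnj_RA_B by (simp add: normalizes_def)
qed

lemma RB: "subgroup RB G" "RB \<subseteq> B" "normalizes (carrier G) RB"
proof -
  interpret sw: cop_product G B A by (rule swap)
  show "subgroup RB G" "RB \<subseteq> B" "normalizes (carrier G) RB" using sw.RA sw.RA_normal by auto
qed

lemma RB_A: "r \<in> RB \<Longrightarrow> a \<in> A \<Longrightarrow> r \<otimes> a = a \<otimes> r"
  using nil_residual_centralized[OF B A cop_commuting_sym[OF cc]] .

lemma RA_RB: "a \<in> RA \<Longrightarrow> b \<in> RB \<Longrightarrow> a \<otimes> b = b \<otimes> a"
  using RA_B RB(2) by blast

lemma R: "subgroup R G" "normalizes (carrier G) R"
proof -
  show "subgroup R G"
    by (rule set_mult_sub_normalizes[OF RA(1) RB(1) normalizes_mono[OF RB(3)]])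
       (use RA(1) subgroup.subset in blast)
  show "normalizes (carrier G) R"
    by (rule normalizes_set_mult) (use RA(1) RB(1,3) RA_normal subgroup.subset in auto)
qed

lemma RAB_R: "RA \<subseteq> R" "RB \<subseteq> R"
  using sub_set_mult_left sub_set_mult_right RA RB by blast+

lemma cmt_parts:
  assumes x: "x \<in> A \<union> B" and y: "y \<in> A \<union> B" and c: "cop_orders G x y"
  shows "cmt x y \<in> R"
proof -
  have one: "\<one> \<in> R" by (rule subgroup.one_closed[OF R(1)])
  consider "x \<in> A \<and> y \<in> A" | "x \<in> B \<and> y \<in> B" | "x \<in> A \<and> y \<in> B" | "x \<in> B \<and> y \<in> A" using x y by blast
  then show ?thesis
  proof cases
    case 1 then show ?thesis using cop_orders_cmt_nil_residual[OF _ _ c] RAB_R by blast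
  next
    case 2 then show ?thesis using cop_orders_cmt_nil_residual[OF _ _ c] RAB_R by blast
  next
    case 3
    then have "x \<otimes> y = y \<otimes> x" using cc c by (auto simp: cop_commuting_def)
    then show ?thesis using commute_iff_cmt Ain Bin 3 one by metis
  next
    case 4
    then have "x \<otimes> y = y \<otimes> x" using cop_commuting_sym[OF cc] c by (auto simp: cop_commuting_def)
    then show ?thesis using commute_iff_cmt Ain Bin 4 one by metis
  qed
qed

text \<open>The generated subgroup is normalised by all of \<open>A\<close> and \<open>B\<close>: by
  their elements killed by \<open>a\<close>, which belong to it, and by those killed by
  \<open>b\<close>, whose commutators with the generators lie in \<open>R\<close>. So
  \<open>factor_part_mem\<close> applies to it.\<close>

lemma part_generated:
  assumes ab: "order G = a * b" "coprime a b" and x: "x \<in> carrier G" "x [^] a = \<one>"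
  shows "x \<in> generate G ({z \<in> A \<union> B. z [^] a = \<one>} \<union> R)" (is "_ \<in> generate G ?S")
proof -
  let ?T = "{z \<in> A \<union> B. z [^] a = \<one>} \<union> {z \<in> A \<union> B. z [^] b = \<one>}"
  have Sc: "?S \<subseteq> carrier G" using Ain Bin subgroup.subset[OF R(1)] by blast
  have Tc: "?T \<subseteq> carrier G" using Ain Bin by blast
  have Sg: "subgroup (generate G ?S) G" by (rule generate_is_subgroup[OF Sc])
  have inS: "z \<in> generate G ?S" if "z \<in> ?S" for z using that by (rule generate.incl)
  have n: "normalizes (generate G ?T) (generate G ?S)"
  proof (rule normalizes_generate[OF Sc Tc])
    fix t s assume t: "t \<in> ?T" and s: "s \<in> ?S"
    show "cnj t s \<in> generate G ?S"
    proof (cases "t [^] a = \<one>")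
      case True
      then have "t \<in> ?S" using t by blast
      then show ?thesis using cnj_sub[OF Sg] inS s by blast
    next
      case False
      then have tb: "t \<in> A \<union> B" "t [^] b = \<one>" using t by auto
      have tc: "t \<in> carrier G" "s \<in> carrier G" using t s Tc Sc by auto
      show ?thesis
      proof (cases "s \<in> R")
        case True
        then have "cnj t s \<in> R" using normalizesD[OF R(2) tc(1)] by blast
        then show ?thesis using inS by blast
      next
        case False
        then have sa: "s \<in> A \<union> B" "s [^] a = \<one>" using s by auto
        have "cop_orders G t s" using cop_ordersI[OF tb(2) sa(2)] ab by (simp add: coprime_commute)
        then have "cmt t s \<in> generate G ?S" using cmt_parts tb sa inS by blast
        then have "cmt t s \<otimes> s \<in> generate G ?S" using inS[OF s] subgroup.m_closed[OF Sg] by blast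
        then show ?thesis using tc by (simp add: word_simps)
      qed
    qed
  qed
  have "z \<in> generate G ?T" if z: "z \<in> A \<union> B" for z
  proof -
    have zc: "z \<in> carrier G" using z Ain Bin by blast
    obtain s t :: nat where st: "z = z [^] s \<otimes> z [^] t" "(z [^] s) [^] a = \<one>" "(z [^] t) [^] b = \<one>"
      using part_exponents[OF ab] zc by metis
    have "z [^] s \<in> ?T" "z [^] t \<in> ?T" using z st pow_sub[OF A] pow_sub[OF B] by auto
    then have "z [^] s \<otimes> z [^] t \<in> generate G ?T" by (blast intro: generate.incl generate.eng)
    then show ?thesis using st(1) by simp
  qed
  then have nA: "normalizes A (generate G ?S)" and nB: "normalizes B (generate G ?S)"
    using normalizes_mono[OF n] by blast+
  show ?thesis
    by (rule factor_part_mem[OF A B AB_sub Sg _ nA nB ab _ _ _ x(2)])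
       (use subgroup.subset[OF Sg] AB x inS in auto)
qed

text \<open>Both elements are words in the generators given by \<open>part_generated\<close>, and on
  generators the claim is \<open>cmt_parts\<close> or normality of \<open>R\<close>.\<close>

lemma cmt_R:
  assumes u: "u \<in> carrier G" and v: "v \<in> carrier G" and c: "cop_orders G u v"
  shows "cmt u v \<in> R"
proof -
  obtain a b where ab: "order G = a * b" "coprime a b" "u [^] a = \<one>" "v [^] b = \<one>"
    using cop_orders_parts[OF c u v] .
  have ba: "order G = b * a" "coprime b a" using ab by (simp_all add: coprime_commute)
  have Rc: "R \<subseteq> carrier G" by (rule subgroup.subset[OF R(1)])
  show ?thesis
  proof (rule cmt_generate[OF R _ _ _ part_generated[OF ab(1,2) u ab(3)] part_generated[OF ba v ab(4)]])
    fix s t assume s: "s \<in> {z \<in> A \<union> B. z [^] a = \<one>} \<union> R" and t: "t \<in> {z \<in> A \<union> B. z [^] b = \<one>} \<union> R"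
    have sc: "s \<in> carrier G" "t \<in> carrier G" using s t Ain Bin Rc by auto
    consider "s \<in> R" | "t \<in> R" | "s \<in> A \<union> B" "s [^] a = \<one>" "t \<in> A \<union> B" "t [^] b = \<one>" using s t by blast
    then show "cmt s t \<in> R"
    proof cases
      case 3 then show ?thesis using cmt_parts cop_ordersI[OF 3(2,4) ab(2)] by blast
    qed (use cmt_normal_mem[OF R] sc in blast)+
  qed (use Ain Bin Rc in blast)+
qed

end

section \<open>Schmidt and Sylow edges of a product\<close>

context cop_product
begin

lemma CA: "subgroup CA G" "normalizes (carrier G) CA" "B \<subseteq> CA"
proof -
  show "subgroup CA G" using centralizer_sub RA(1) subgroup.subset by blast
  show "normalizes (carrier G) CA" 
    by (rule centralizer_normal[OF subgroup_self subgroup.subset[OF RA(1)] RA_normal])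
  show "B \<subseteq> CA" using RA_B Bin by (auto simp: centralizer_def)
qed

lemma cnj_CA: "c \<in> CA \<Longrightarrow> r \<in> RA \<Longrightarrow> cnj c r = r"
  using commute_iff_cnj sub_in[OF RA(1)] unfolding centralizer_def by blast

lemma CA_iff_cnj: "g \<in> carrier G \<Longrightarrow> (\<And>r. r \<in> RA \<Longrightarrow> cnj g r = r) \<Longrightarrow> g \<in> CA"
  using commute_iff_cnj sub_in[OF RA(1)] by (auto simp: centralizer_def)

lemma cnj_mult_CA:
  assumes "a \<in> carrier G" "c \<in> CA" "r \<in> RA"
  shows "cnj (a \<otimes> c) r = cnj a r"
proof -
  have cr: "c \<in> carrier G" "r \<in> carrier G" using assms sub_in[OF CA(1)] sub_in[OF RA(1)] by auto
  have "cnj (a \<otimes> c) r = cnj a (cnj c r)" using assms(1) cr by (simp add: word_simps)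
  then show ?thesis using cnj_CA assms by simp
qed

lemma act_A:
  assumes y: "y \<in> carrier G"
  obtains y1 y2 where "y1 \<in> A" "y2 \<in> B" "y = y1 \<otimes> y2" "\<And>r. r \<in> RA \<Longrightarrow> cnj y r = cnj y1 r"
proof -
  obtain a b where ab: "a \<in> A" "b \<in> B" "y = a \<otimes> b" using decompose[OF y] .
  have "b \<in> CA" using ab CA(3) by blast
  then have "cnj y r = cnj a r" if "r \<in> RA" for r using cnj_mult_CA[of a b r] ab that Ain by simp
  then show ?thesis using that ab by blast
qed

text \<open>As \<open>a\<close> and \<open>b\<close> commute, v = v^s = a^s b^s for the uniform
  exponent \<open>s\<close> of p-parts. The new factors are recorded as powers of the old ones, so
  that they stay in every subgroup containing these, such as a centraliser.\<close>

lemma p_parts: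
  assumes v: "v \<in> RA <#> RB" "v [^] (p ^ k) = \<one>" and p: "prime (p::nat)"
    and S: "subgroup S G" "subgroup T G" "v = a \<otimes> b" "a \<in> S" "b \<in> T" "a \<otimes> b = b \<otimes> a"
  obtains a' b' l where "a' \<in> S" "b' \<in> T" "v = a' \<otimes> b'" "a' [^] (p ^ l) = \<one>" "b' [^] (p ^ l) = \<one>"
    "\<exists>n::nat. a' = a [^] n" "\<exists>n::nat. b' = b [^] n"
proof -
  have ab: "a \<in> carrier G" "b \<in> carrier G" "v \<in> carrier G"
    using S sub_in[OF S(1)] sub_in[OF S(2)] sub_in[OF R(1) v(1)] by auto
  obtain s l :: nat where s: "\<And>x. x \<in> carrier G \<Longrightarrow> (x [^] s) [^] (p ^ l) = \<one>"
    "\<And>x j. x \<in> carrier G \<Longrightarrow> x [^] (p ^ j) = \<one> \<Longrightarrow> x [^] s = x" using q_part[OF p] by metis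
  have "v = v [^] s" using s(2) v ab by simp
  also have "\<dots> = a [^] s \<otimes> b [^] s" unfolding S(3) using pow_mult_distrib S(6) ab by blast
  finally show ?thesis using that s(1) ab pow_sub S by blast
qed

lemma commute_mult:
  assumes "y \<in> carrier G" "a \<in> carrier G" "b \<in> carrier G" "y \<otimes> a = a \<otimes> y" "y \<otimes> b = b \<otimes> y"
  shows "y \<otimes> (a \<otimes> b) = (a \<otimes> b) \<otimes> y"
  using assms by (metis m_assoc)

text \<open>\<open>a\<close> need not lie in \<open>P\<close>, but it lies in \<open>?H\<close>, the
  part of \<open>RA\<close> inside \<open>P <#> RB\<close>. A p'-element of \<open>?H\<close> lies
  in \<open>RB\<close>, over which \<open>P <#> RB\<close> has \<open>p\<close>-power index, and so
  is central in \<open>?H\<close>. Hence \<open>?H\<close> is nilpotent; its Sylow subgroup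
  \<open>Q\<close> contains all its \<open>p\<close>-elements, among them \<open>a\<close>, and is
  preserved by the action of \<open>y\<close>.\<close>

lemma schmidt_edge_factor:
  assumes p: "prime p" and q: "prime q" and pq: "p \<noteq> q"
    and P: "subgroup P G" "card P = p ^ k"
    and y: "y \<in> carrier G" "y [^] (q ^ j) = \<one>" "normalizes {y} P"
    and v: "a \<otimes> b \<in> P" and a: "a \<in> RA" "a [^] (p ^ l) = \<one>" "y \<otimes> a \<noteq> a \<otimes> y" and b: "b \<in> RB"
  shows "schmidt_edge A p q"
proof -
  let ?U = "P <#> RB" let ?H = "RA \<inter> ?U"
  note ic = sub_in[OF P(1)] sub_in[OF RB(1)] sub_in[OF RA(1)]
  have Pc: "P \<subseteq> carrier G" by (rule subgroup.subset[OF P(1)])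
  have U: "subgroup ?U G" by (rule set_mult_sub_normalizes[OF P(1) RB(1) normalizes_mono[OF RB(3) Pc]])
  have H: "subgroup ?H G" by (rule sub_Int[OF RA(1) U])
  have PU: "P \<subseteq> ?U" "RB \<subseteq> ?U" using sub_set_mult_left sub_set_mult_right P(1) RB(1) by blast+
  obtain c where c: "card ?U = c * card RB" using sub_index[OF U RB(1) PU(2)] .
  have "c * card (P \<inter> RB) * card RB = p ^ k * card RB"
    using card_set_mult[OF P(1) RB(1)] c P(2) by (simp add: mult_ac)
  then have "c * card (P \<inter> RB) = p ^ k" using sub_card_pos[OF RB(1)] by simp
  then have cp: "c dvd p ^ k" by (metis dvd_triv_left)
  have nU: "normalizes ?U RB" using normalizes_mono[OF RB(3) subgroup.subset[OF U]] .
  have central: "h \<otimes> g = g \<otimes> h"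
    if h: "h \<in> ?H" "h [^] (m::nat) = \<one>" "\<not> p dvd m" and g: "g \<in> ?H" for h g m
  proof -
    have "coprime (p ^ k) m" using h p prime_power_coprime by blast
    then have "coprime c m" using cp by (meson coprime_divisors dvd_refl)
    then have "h \<in> RB" using mem_of_pow[OF RB(1) _ index_pow[OF U RB(1) PU(2) nU c] h(2)] h(1) ic by blast
    then show ?thesis using RA_RB[of g h] g by simp
  qed
  have ccH: "cop_commuting ?H ?H"
    unfolding cop_commuting_def
  proof (intro ballI impI)
    fix x z assume x: "x \<in> ?H" and z: "z \<in> ?H" and "cop_orders G x z"
    then obtain m n :: nat where mn: "coprime m n" "x [^] m = \<one>" "z [^] n = \<one>" by (auto simp: cop_orders_def)
    have "\<not> p dvd m \<or> \<not> p dvd n" using mn(1) p coprime_common_divisor not_prime_unit by blast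
    then show "x \<otimes> z = z \<otimes> x"
    proof
      assume "\<not> p dvd m" then show ?thesis using central[OF x mn(2) _ z] by simp
    next
      assume "\<not> p dvd n" then show ?thesis using central[OF z mn(3) _ x] by simp
    qed
  qed
  obtain Q e r where Q: "subgroup Q G" "Q \<subseteq> ?H" "card Q = p ^ e" "card ?H = p ^ e * r" "\<not> p dvd r"
    using sylow_exists[OF p H] .
  have inQ: "x \<in> Q" if "x \<in> ?H" "x [^] (p ^ i) = \<one>" for x i
  proof -
    interpret H: fin_group "Sub ?H" using fin_sub[OF H] .
    have c: "x \<otimes>\<^bsub>Sub ?H\<^esub> z = z \<otimes>\<^bsub>Sub ?H\<^esub> x"
      if "x \<in> carrier (Sub ?H)" "z \<in> carrier (Sub ?H)" "cop_orders (Sub ?H) x z" for x z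
    proof -
      have "x \<in> ?H" "z \<in> ?H" "cop_orders G x z" using that by simp_all
      then have "x \<otimes> z = z \<otimes> x" using ccH unfolding cop_commuting_def by blast
      then show ?thesis by simp
    qed
    have "order (Sub ?H) = p ^ e * r" using Q(4) by (simp add: order_def)
    from H.cop_orders_commute_sylow(2)[OF c p this Q(5) _ Q(3), of x i] show ?thesis
      using that sub_sub_iff[OF H] Q by simp
  qed
  obtain y1 y2 where y12: "y1 \<in> A" "y2 \<in> B" "y = y1 \<otimes> y2" "\<And>r. r \<in> RA \<Longrightarrow> cnj y r = cnj y1 r"
    using act_A[OF y(1)] by blast
  obtain s i :: nat where s: "\<And>x. x \<in> carrier G \<Longrightarrow> (x [^] s) [^] (q ^ i) = \<one>"
    "\<And>x j. x \<in> carrier G \<Longrightarrow> x [^] (q ^ j) = \<one> \<Longrightarrow> x [^] s = x" using q_part[OF q] by metis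
  let ?y = "y1 [^] s"
  have y1: "?y \<in> A" "?y [^] (q ^ i) = \<one>" using pow_sub[OF A] y12 s Ain by auto
  \<comment> \<open>\<open>y [^] s = y\<close> because \<open>y\<close> is a
    \<open>q\<close>-element, so passing from \<open>y1\<close> to its \<open>q\<close>-part keeps
    the action on \<open>RA\<close>.\<close>
  have act: "cnj ?y r = cnj y r" if "r \<in> RA" for r
    using act_pow[OF RA(1) RA_normal y(1) Ain[OF y12(1)] y12(4) that, of s] s(2)[OF y(1,2)] by simp
  have yU: "cnj y x \<in> ?U" if x: "x \<in> ?U" for x
  proof -
    obtain u w where uw: "u \<in> P" "w \<in> RB" "x = u \<otimes> w" using x by (rule set_multE)
    then have "cnj y x = cnj y u \<otimes> cnj y w" using y ic by (simp add: word_simps)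
    moreover have "cnj y u \<in> P" using y(3) uw by (simp add: normalizes_def)
    moreover have "cnj y w \<in> RB" using normalizesD[OF RB(3) y(1) uw(2)] .
    ultimately show ?thesis using set_multI by metis
  qed
  have "normalizes {?y} Q"
    unfolding normalizes_def
  proof (intro ballI)
    fix t x assume "t \<in> {?y}" and x: "x \<in> Q"
    then have t: "t = ?y" by simp
    have xH: "x \<in> RA" "x \<in> ?U" using x Q by auto
    have "cnj ?y x \<in> ?H" using act[OF xH(1)] yU[OF xH(2)] normalizesD[OF RA_normal y(1) xH(1)] by simp
    moreover have "(cnj ?y x) [^] (p ^ e) = \<one>"
      using cnj_pow[of ?y x "p ^ e"] pow_card[OF Q(1) x] Q(3) y1 Ain ic xH by simp
    ultimately show "cnj t x \<in> Q" using inQ t by blast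
  qed
  moreover have "a \<in> Q"
  proof -
    have "a = (a \<otimes> b) \<otimes> inv b" using a b ic by (simp add: word_simps)
    then have "a \<in> ?U" using v subgroup.m_inv_closed[OF RB(1) b] set_multI by metis
    then show ?thesis using inQ a by blast
  qed
  moreover have "?y \<otimes> a \<noteq> a \<otimes> ?y"
    using act[OF a(1)] a commute_iff_cnj y(1) y1 Ain ic by metis
  moreover have "Q \<subseteq> A" using Q RA by blast
  ultimately show ?thesis unfolding schmidt_edge_def using p q pq Q y1 by blast
qed

lemma schmidt_edge_product: "schmidt_edge (carrier G) p q \<longleftrightarrow> schmidt_edge A p q \<or> schmidt_edge B p q"
proof
  assume "schmidt_edge (carrier G) p q"
  then obtain P y k j u where p: "prime p" and q: "prime q" and pq: "p \<noteq> q"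
    and P: "subgroup P G" "card P = p ^ k"
    and y: "y \<in> carrier G" "y [^] (q ^ j) = \<one>" "normalizes {y} P" and u: "u \<in> P" "y \<otimes> u \<noteq> u \<otimes> y"
    by (auto simp: schmidt_edge_def)
  define v where "v = cmt y u"
  have uc: "u \<in> carrier G" using sub_in[OF P(1) u(1)] .
  note ca = coprime_action_cmt[OF P p q pq y u]
  have vR: "v \<in> R" using cmt_R[OF y(1) uc ca(1)] by (simp add: v_def)
  have vP: "v \<in> P" "y \<otimes> v \<noteq> v \<otimes> y" using ca(2,3) by (simp_all add: v_def)
  have vp: "v [^] (p ^ k) = \<one>" using pow_card[OF P(1) vP(1)] P(2) by simp
  obtain a0 b0 where ab0: "a0 \<in> RA" "b0 \<in> RB" "v = a0 \<otimes> b0" using vR by (rule set_multE)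
  obtain a b l where ab: "a \<in> RA" "b \<in> RB" "v = a \<otimes> b" "a [^] (p ^ l) = \<one>" "b [^] (p ^ l) = \<one>"
    using p_parts[OF vR vp p RA(1) RB(1) ab0(3,1,2) RA_RB[OF ab0(1,2)]] by metis
  have "y \<otimes> a \<noteq> a \<otimes> y \<or> y \<otimes> b \<noteq> b \<otimes> y"
    using vP(2) commute_mult[OF y(1)] sub_in[OF RA(1) ab(1)] sub_in[OF RB(1) ab(2)] ab(3) by blast
  then show "schmidt_edge A p q \<or> schmidt_edge B p q"
  proof
    assume "y \<otimes> a \<noteq> a \<otimes> y"
    then show ?thesis using schmidt_edge_factor[OF p q pq P y _ ab(1,4) _ ab(2)] vP ab by blast
  next
    assume n: "y \<otimes> b \<noteq> b \<otimes> y"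
    interpret sw: cop_product G B A by (rule swap)
    have "b \<otimes> a \<in> P" using vP(1) ab(3) RA_RB[OF ab(1,2)] by metis
    then show ?thesis using sw.schmidt_edge_factor[OF p q pq P y _ ab(2,5) n ab(1)] by blast
  qed
next
  assume "schmidt_edge A p q \<or> schmidt_edge B p q"
  then show "schmidt_edge (carrier G) p q"
    using subgroup.subset[OF A] subgroup.subset[OF B] unfolding schmidt_edge_def by blast
qed

text \<open>All \<open>p\<close>-elements lie in \<open>P R\<close>, so a Sylow subgroup of \<open>A\<close> is conjugate into \<open>P\<close> by some \<open>ab\<close>
  with \<open>a \<in> RA\<close> and \<open>b \<in> RB\<close>; here \<open>b\<close> centralises \<open>A\<close>.\<close>

lemma sylow_A:
  assumes p: "prime (p::nat)"
    and P: "subgroup P G" "card P = p ^ k" "order G = p ^ k * r" "\<not> p dvd r"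
  obtains e ra where "card (P \<inter> A) = p ^ e" "card A = p ^ e * ra" "\<not> p dvd ra"
proof -
  let ?U = "P <#> R"
  have U: "subgroup ?U G" "\<And>x j. x \<in> carrier G \<Longrightarrow> x [^] (p ^ j) = \<one> \<Longrightarrow> x \<in> ?U"
    using sylow_mod(1,3)[OF p P(3,4,1,2) R] cmt_R by blast+
  have PU: "P \<subseteq> ?U" using sub_set_mult_left P(1) R(1) by blast
  obtain Q e ra where Q: "subgroup Q G" "Q \<subseteq> A" "card Q = p ^ e" "card A = p ^ e * ra" "\<not> p dvd ra"
    using sylow_exists[OF p A] .
  have QU: "Q \<subseteq> ?U"
  proof
    fix x assume x: "x \<in> Q"
    show "x \<in> ?U" using U(2)[OF sub_in[OF Q(1) x], of e] pow_card[OF Q(1) x] Q(3) by simp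
  qed
  obtain d where d: "card ?U = d * card P" using sub_index[OF U(1) P(1) PU] .
  have pd: "\<not> p dvd d"
    using not_dvd_sub_index[where k = k and d = d, OF p subgroup_self _ P(4) U(1)
        subgroup.subset[OF U(1)]] d P
    by (simp add: order_def)
  have dU: "card ?U = p ^ k * d" using d P by simp
  obtain h where h: "h \<in> ?U" "\<And>u. u \<in> Q \<Longrightarrow> cnj h u \<in> P"
    using sylow_conj[OF p U(1) Q(1) QU Q(3) P(1) PU P(2) dU pd] by blast
  obtain w x where wx: "w \<in> P" "x \<in> R" "h = w \<otimes> x" using h(1) by (rule set_multE)
  obtain a b where ab: "a \<in> RA" "b \<in> RB" "x = a \<otimes> b" using wx(2) by (rule set_multE)
  have wab: "w \<in> carrier G" "a \<in> carrier G" "b \<in> carrier G"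
    using wx ab sub_in P(1) RA(1) RB(1) by auto
  have aA: "a \<in> A" using ab RA by blast
  have im: "cnj a ` Q \<subseteq> P \<inter> A"
  proof
    fix z assume "z \<in> cnj a ` Q"
    then obtain u where u: "u \<in> Q" "z = cnj a u" by blast
    have uA: "u \<in> A" using u Q by blast
    \<comment> \<open>\<open>b\<close> centralises \<open>A\<close> and \<open>w\<close> normalises
      \<open>P\<close>, so only \<open>a\<close> matters: it conjugates \<open>Q\<close> into
      \<open>P\<close> and, being in \<open>A\<close>, also into \<open>A\<close>.\<close>
    have "cnj b u = u" using commute_iff_cnj RB_A[OF ab(2) uA] wab Ain[OF uA] by blast
    then have "cnj h u = cnj w z" using wx ab u wab Ain[OF uA]
    proof -
      have "cnj h u = cnj w (cnj a (cnj b u))" using wx ab u wab Ain[OF uA] by (simp add: word_simps)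
      then show ?thesis using \<open>cnj b u = u\<close> u by simp
    qed
    then have "cnj w z \<in> P" using h(2)[OF u(1)] by simp
    then have "cnj (inv w) (cnj w z) \<in> P" using cnj_sub[OF P(1) subgroup.m_inv_closed[OF P(1) wx(1)]] by blast
    moreover have "z \<in> A" using cnj_sub[OF A aA uA] u by simp
    moreover have "cnj (inv w) (cnj w z) = z" using wab Ain[OF \<open>z \<in> A\<close>] by (simp add: word_simps)
    ultimately show "z \<in> P \<inter> A" by simp
  qed
  have PA: "subgroup (P \<inter> A) G" by (rule sub_Int[OF P(1) A])
  have "inj_on (cnj a) Q" using wab sub_in[OF Q(1)] by (auto intro!: inj_onI)
  then have "p ^ e \<le> card (P \<inter> A)" using card_inj_on_le[OF _ im sub_fin[OF PA]] Q(3) by simp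
  have "card (P \<inter> A) dvd p ^ k" using sub_card_dvd[OF P(1) PA] P(2) by simp
  then obtain i where i: "card (P \<inter> A) = p ^ i" using divides_primepow_nat[OF p] by blast
  have "p ^ i dvd p ^ e * ra" using sub_card_dvd[OF A PA] i Q(4) by simp
  moreover have "coprime (p ^ i) ra" using Q(5) p prime_power_coprime by blast
  ultimately have "p ^ i dvd p ^ e" using coprime_dvd_mult_left_iff by blast
  then have "p ^ i \<le> p ^ e" using p by (simp add: dvd_imp_le prime_gt_0_nat)
  then have "card (P \<inter> A) = p ^ e" using i \<open>p ^ e \<le> card (P \<inter> A)\<close> by simp
  then show ?thesis using that Q by blast
qed

lemma sylow_AB:
  assumes p: "prime (p::nat)"
    and P: "subgroup P G" "card P = p ^ k" "order G = p ^ k * r" "\<not> p dvd r"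
  shows "P = (P \<inter> A) <#> (P \<inter> B)"
proof -
  interpret sw: cop_product G B A by (rule swap)
  obtain e ra where a: "card (P \<inter> A) = p ^ e" "card A = p ^ e * ra" "\<not> p dvd ra" using sylow_A[OF p P] .
  obtain f rb where b: "card (P \<inter> B) = p ^ f" "card B = p ^ f * rb" "\<not> p dvd rb" using sw.sylow_A[OF p P] .
  have "card (A <#> B) = p ^ k * r" using P(3) by (simp add: order_def flip: AB)
  then show ?thesis using sylow_factorization[OF p A B AB_sub P(1,2) _ a b] by blast
qed

lemma sylow_R:
  assumes p: "prime (p::nat)"
    and P: "subgroup P G" "card P = p ^ k" "order G = p ^ k * r" "\<not> p dvd r"
  shows "P \<inter> R = (P \<inter> RA) <#> (P \<inter> RB)"
proof -
  obtain e ra where a: "card (P \<inter> RA) = p ^ e" "card RA = p ^ e * ra" "\<not> p dvd ra"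
    using sylow_normal_Int[OF p P RA(1) RA_normal] .
  obtain f rb where b: "card (P \<inter> RB) = p ^ f" "card RB = p ^ f * rb" "\<not> p dvd rb"
    using sylow_normal_Int[OF p P RB(1) RB(3)] .
  obtain g rr where g: "card (P \<inter> R) = p ^ g" "card R = p ^ g * rr" "\<not> p dvd rr"
    using sylow_normal_Int[OF p P R] .
  have e: "P \<inter> R \<inter> RA = P \<inter> RA" "P \<inter> R \<inter> RB = P \<inter> RB" using RAB_R by auto
  show ?thesis
    using sylow_factorization[OF p RA(1) RB(1) R(1) sub_Int[OF P(1) R(1)] g(1,2), of e ra f rb] a b
    unfolding e by blast
qed

text \<open>The component \<open>y\<^sub>1\<close> of \<open>y\<close> in \<open>A\<close> normalises only \<open>(P \<inter> A) D\<close>, where \<open>D\<close> centralises \<open>RA\<close>. A Frattini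
  argument corrects it by an element of \<open>D\<close>, which does not change the action on \<open>RA\<close>.\<close>

lemma sylow_edge_factor:
  assumes p: "prime p" and q: "prime q" and pq: "p \<noteq> q"
    and P: "subgroup P G" "card P = p ^ k" "order G = p ^ k * r" "\<not> p dvd r"
    and y: "y \<in> carrier G" "y [^] (q ^ j) = \<one>" "normalizes {y} P"
    and a: "a \<in> P \<inter> RA" "y \<otimes> a \<noteq> a \<otimes> y"
  shows "sylow_edge A p q"
proof -
  let ?PA = "P \<inter> A" let ?D = "A \<inter> CA" let ?L = "?PA <#> ?D"
  have PA: "subgroup ?PA G" by (rule sub_Int[OF P(1) A])
  have D: "subgroup ?D G" by (rule sub_Int[OF A CA(1)])
  note ic = Ain Bin sub_in[OF P(1)] sub_in[OF CA(1)] sub_in[OF RA(1)]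
  have AD: "normalizes A ?D"
    using normalizesD[OF CA(2)] cnj_sub[OF A] Ain by (auto simp: normalizes_def)
  have L: "subgroup ?L G" by (rule set_mult_sub_normalizes[OF PA D normalizes_mono[OF AD]]) blast
  have LA: "?L \<subseteq> A" by (rule set_mult_least[OF A]) auto
  have PAL: "?PA \<subseteq> ?L" using sub_set_mult_left[OF PA D] .
  obtain e ra where e: "card ?PA = p ^ e" "card A = p ^ e * ra" "\<not> p dvd ra" using sylow_A[OF p P] .
  obtain d where d: "card ?L = d * card ?PA" using sub_index[OF L PA PAL] .
  have pd: "\<not> p dvd d" using not_dvd_sub_index[OF p A e(2,3) L LA] d e(1) by simp
  have cL: "card ?L = p ^ e * d" using d e by simp
  obtain y1 y2 where y12: "y1 \<in> A" "y2 \<in> B" "y = y1 \<otimes> y2" "\<And>r. r \<in> RA \<Longrightarrow> cnj y r = cnj y1 r"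
    using act_A[OF y(1)] by blast
  have yc: "y1 \<in> carrier G" "y2 \<in> carrier G" "y2 \<in> CA" using y12 ic CA(3) by auto
  have y1L: "cnj y1 u \<in> ?L" if u: "u \<in> ?PA" for u
  proof -
    have uc: "u \<in> carrier G" "u \<in> A" using u ic by auto
    \<comment> \<open>With y1 = y y2^-1, conjugating \<open>u\<close> by \<open>y1\<close> amounts
      to conjugating cu by \<open>y\<close>. Both \<open>c\<close> and \<open>P \<inter> B\<close>
      lie in \<open>CA\<close>, so the result is in \<open>?PA\<close> modulo
      \<open>CA\<close>.\<close>
    let ?c = "cmt (inv y2) u"
    have "?c = inv y2 \<otimes> cnj u y2" using yc uc by (simp add: word_simps)
    moreover have "cnj u y2 \<in> CA" using normalizesD[OF CA(2) uc(1) yc(3)] .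
    ultimately have c: "?c \<in> CA" using CA(1) yc(3) by (simp add: subgroup.m_closed subgroup.m_inv_closed)
    then have cc: "?c \<in> carrier G" using ic by blast
    let ?c' = "cnj y ?c"
    have c': "?c' \<in> CA" using normalizesD[OF CA(2) y(1) c] .
    have "cnj y1 u = ?c' \<otimes> cnj y u" unfolding y12(3) using yc uc by (simp add: word_simps)
    moreover have "cnj y u \<in> P" using y(3) u by (simp add: normalizes_def)
    then have "cnj y u \<in> ?PA <#> (P \<inter> B)" using sylow_AB[OF p P] by simp
    then obtain v w where vw: "v \<in> ?PA" "w \<in> P \<inter> B" "cnj y u = v \<otimes> w" by (rule set_multE)
    ultimately have e1: "cnj y1 u = ?c' \<otimes> (v \<otimes> w)" by simp
    have vwc: "v \<in> carrier G" "w \<in> carrier G" "w \<in> CA" "?c' \<in> carrier G"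
      using vw ic CA(3) c' by auto
    have "inv v \<otimes> cnj y1 u = cnj (inv v) ?c' \<otimes> w"
      unfolding e1 using vwc by (simp only: inv_inv m_assoc m_closed inv_closed inv_cancel)
    moreover have "cnj (inv v) ?c' \<in> CA" by (rule normalizesD[OF CA(2) inv_closed[OF vwc(1)] c'])
    ultimately have "inv v \<otimes> cnj y1 u \<in> CA" using vwc subgroup.m_closed[OF CA(1)] by simp
    moreover have "inv v \<otimes> cnj y1 u \<in> A"
      using vw cnj_sub[OF A y12(1) uc(2)] subgroup.m_closed[OF A subgroup.m_inv_closed[OF A]] by blast
    ultimately have "v \<otimes> (inv v \<otimes> cnj y1 u) \<in> ?L" using vw(1) set_multI by blast
    then show ?thesis using vwc yc uc by (simp add: inv_cancel)
  qed
  let ?Q = "cnj y1 ` ?PA"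
  have Q: "subgroup ?Q G"
  proof (rule sub_closedI)
    show "?Q \<subseteq> carrier G" using yc ic by auto
    show "\<one> \<in> ?Q" using yc subgroup.one_closed[OF PA] by (force simp: image_iff)
    fix x z assume "x \<in> ?Q" "z \<in> ?Q"
    then obtain u v where uv: "u \<in> ?PA" "v \<in> ?PA" "x = cnj y1 u" "z = cnj y1 v" by blast
    then have "x \<otimes> z = cnj y1 (u \<otimes> v)" using yc ic by (simp add: word_simps)
    then show "x \<otimes> z \<in> ?Q" using uv subgroup.m_closed[OF PA] by blast
  qed
  have "inj_on (cnj y1) ?PA" using yc ic by (auto intro!: inj_onI)
  then have cQ: "card ?Q = p ^ e" using e by (simp add: card_image)
  have QL: "?Q \<subseteq> ?L" using y1L by blast
  obtain h where h: "h \<in> ?L" "\<And>u. u \<in> ?Q \<Longrightarrow> cnj h u \<in> ?PA"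
    using sylow_conj[OF p L Q QL cQ PA PAL e(1) cL pd] by blast
  \<comment> \<open>\<open>?PA\<close> and its image under \<open>y1\<close> are both Sylow in
    \<open>?L\<close>. Dropping from \<open>h\<close> the factor \<open>w\<close>, which normalises
    \<open>?PA\<close>, leaves \<open>x\<close> in \<open>?D\<close> such that
    \<open>x \<otimes> y1\<close> normalises \<open>?PA\<close>.\<close>
  obtain w x where wx: "w \<in> ?PA" "x \<in> ?D" "h = w \<otimes> x" using h(1) by (rule set_multE)
  have wxc: "w \<in> carrier G" "x \<in> carrier G" using wx ic by auto
  let ?m = "x \<otimes> y1"
  have mA: "?m \<in> A" using wx y12 A by (simp add: subgroup.m_closed)
  have mPA: "cnj ?m u \<in> ?PA" if u: "u \<in> ?PA" for u
  proof -
    have uc: "u \<in> carrier G" using u ic by blast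
    have "cnj h (cnj y1 u) \<in> ?PA" using h(2) u by blast
    then have "cnj (inv w) (cnj h (cnj y1 u)) \<in> ?PA"
      using cnj_sub[OF PA subgroup.m_inv_closed[OF PA wx(1)]] by blast
    moreover have "cnj (inv w) (cnj h (cnj y1 u)) = cnj ?m u"
      using wx(3) wxc uc yc by (simp add: word_simps)
    ultimately show ?thesis by simp
  qed
  obtain s i :: nat where s: "\<And>x. x \<in> carrier G \<Longrightarrow> (x [^] s) [^] (q ^ i) = \<one>"
    "\<And>x j. x \<in> carrier G \<Longrightarrow> x [^] (q ^ j) = \<one> \<Longrightarrow> x [^] s = x" using q_part[OF q] by metis
  let ?y = "?m [^] s"
  have mc: "?m \<in> carrier G" using mA ic by blast
  have yA: "?y \<in> A" "?y [^] (q ^ i) = \<one>" using pow_sub[OF A mA] s(1)[OF mc] by auto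
  have "?m \<in> {g \<in> carrier G. normalizes {g} ?PA}" using mc mPA by (simp add: normalizes_def)
  then have "?y \<in> {g \<in> carrier G. normalizes {g} ?PA}"
    by (rule pow_sub[OF normalizer_sub[OF subgroup.subset[OF PA]]])
  then have yn: "normalizes {?y} ?PA" by simp
  have "cnj y r = cnj ?m r" if r: "r \<in> RA" for r
  proof -
    have rc: "r \<in> carrier G" using r ic by blast
    have "cnj ?m r = cnj x (cnj y1 r)" using wxc yc rc by (simp add: word_simps)
    also have "\<dots> = cnj y1 r"
    proof (rule cnj_CA)
      show "x \<in> CA" using wx by simp
      show "cnj y1 r \<in> RA" using normalizesD[OF RA_normal yc(1) r] .
    qed
    finally show ?thesis using y12(4)[OF r] by simp
  qed
  then have "cnj ?y a = cnj y a"
    using act_pow[OF RA(1) RA_normal y(1) mc, of a s] s(2)[OF y(1,2)] a(1) by simp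
  then have "?y \<otimes> a \<noteq> a \<otimes> ?y"
    using a commute_iff_cnj[OF y(1), of a] commute_iff_cnj[of ?y a] yA ic by simp
  moreover have "a \<in> ?PA" using a RA by blast
  ultimately show ?thesis
    unfolding sylow_edge_def using p q pq PA e yA yn by (metis inf_le2)
qed

text \<open>Inside \<open>A\<close> the Sylow subgroup \<open>Q\<close> is conjugate to
  \<open>P \<inter> A\<close>. The conjugated \<open>q\<close>-element normalises
  \<open>P \<inter> A\<close> and commutes with \<open>P \<inter> B\<close> by coprimality, so it
  normalises their product, which is \<open>P\<close>.\<close>

lemma sylow_edge_of_factor:
  assumes "sylow_edge A p q"
  shows "sylow_edge (carrier G) p q"
proof -
  obtain Q y k r j u where p: "prime p" and q: "prime q" and pq: "p \<noteq> q"
    and Q: "subgroup Q G" "Q \<subseteq> A" "card Q = p ^ k" and r: "card A = p ^ k * r" "\<not> p dvd r"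
    and y: "y \<in> A" "y [^] (q ^ j) = \<one>" "normalizes {y} Q" and u: "u \<in> Q" "y \<otimes> u \<noteq> u \<otimes> y"
    using assms by (auto simp: sylow_edge_def)
  obtain P n m where P: "subgroup P G" "card P = p ^ n" "order G = p ^ n * m" "\<not> p dvd m"
    using sylow_exists[OF p subgroup_self] unfolding order_def by metis
  let ?PA = "P \<inter> A"
  have PA: "subgroup ?PA G" by (rule sub_Int[OF P(1) A])
  obtain e ra where e: "card ?PA = p ^ e" "card A = p ^ e * ra" "\<not> p dvd ra" using sylow_A[OF p P] .
  obtain h where h: "h \<in> A" "\<And>u. u \<in> Q \<Longrightarrow> cnj h u \<in> ?PA"
    using sylow_conj[OF p A Q PA _ e] by blast
  note ic = Ain Bin sub_in[OF Q(1)] sub_in[OF P(1)]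
  have hy: "h \<in> carrier G" "y \<in> carrier G" "u \<in> carrier G" using h y u ic by auto
  have "inj_on (cnj h) Q" using hy ic by (auto intro!: inj_onI)
  moreover have "p ^ e = p ^ k"
  proof -
    have 1: "coprime (p ^ k) ra" "coprime (p ^ e) r"
      using p e(3) r(2) prime_power_coprime by blast+
    have "p ^ k dvd p ^ e * ra" "p ^ e dvd p ^ k * r" using e r by (metis dvd_triv_left)+
    then have "p ^ k dvd p ^ e" "p ^ e dvd p ^ k" using 1 coprime_dvd_mult_left_iff by blast+
    then show ?thesis by (rule dvd_antisym[rotated])
  qed
  ultimately have im: "cnj h ` Q = ?PA"
    using card_subset_eq[OF sub_fin[OF PA], of "cnj h ` Q"] h(2) e Q(3) by (auto simp: card_image)
  let ?y = "cnj h y"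
  have yA: "?y \<in> A" using cnj_sub[OF A] h y by blast
  have yq: "?y [^] (q ^ j) = \<one>" using cnj_pow[OF hy(1,2)] y(2) hy by simp
  have yPA: "cnj ?y x \<in> ?PA" if x: "x \<in> ?PA" for x
  proof -
    obtain z where z: "z \<in> Q" "x = cnj h z" using x unfolding im[symmetric] by blast
    have "z \<in> carrier G" using z ic by blast
    then have "cnj ?y x = cnj h (cnj y z)" using z hy by (simp add: word_simps)
    moreover have "cnj y z \<in> Q" using y(3) z by (simp add: normalizes_def)
    ultimately show ?thesis using im by blast
  qed
  have "normalizes {?y} P"
    unfolding normalizes_def
  proof (intro ballI)
    fix g x assume g: "g \<in> {?y}" and x: "x \<in> P"
    have yc: "?y \<in> carrier G" using hy by simp
    have "x \<in> ?PA <#> (P \<inter> B)" using sylow_AB[OF p P] x by simp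
    then obtain v w where vw: "v \<in> ?PA" "w \<in> P \<inter> B" "x = v \<otimes> w" by (rule set_multE)
    have vwc: "v \<in> carrier G" "w \<in> carrier G" using vw ic by auto
    have "w [^] (p ^ n) = \<one>" using pow_card[OF P(1)] P(2) vw by force
    then have "cop_orders G ?y w" using cop_ordersI[OF yq] p q pq by (simp add: primes_coprime)
    then have "?y \<otimes> w = w \<otimes> ?y" using cc yA vw by (simp add: cop_commuting_def)
    then have "cnj ?y w = w" using commute_iff_cnj[OF yc vwc(2)] by simp
    moreover have "cnj ?y x = cnj ?y v \<otimes> cnj ?y w"
      using vw(3) vwc hy by (simp add: word_simps)
    ultimately show "cnj g x \<in> P" using g yPA[OF vw(1)] vw P(1) by (simp add: subgroup.m_closed)
  qed
  moreover have "cnj h u \<in> P" using h(2) u by blast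
  moreover have "?y \<otimes> cnj h u \<noteq> cnj h u \<otimes> ?y"
  proof
    assume "?y \<otimes> cnj h u = cnj h u \<otimes> ?y"
    then have "cnj h (y \<otimes> u) = cnj h (u \<otimes> y)" using hy by (simp add: word_simps)
    then show False using u(2) hy by simp
  qed
  moreover have "?y \<in> carrier G" using hy by simp
  moreover have "card (carrier G) = p ^ n * m" using P(3) by (simp add: order_def)
  ultimately show ?thesis
    unfolding sylow_edge_def using p q pq P(1,2,4) yq subgroup.subset[OF P(1)] by blast
qed

lemma sylow_edge_product: "sylow_edge (carrier G) p q \<longleftrightarrow> sylow_edge A p q \<or> sylow_edge B p q"
proof
  interpret sw: cop_product G B A by (rule swap)
  assume "sylow_edge (carrier G) p q"
  then obtain P y k r j u where p: "prime p" and q: "prime q" and pq: "p \<noteq> q"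
    and P: "subgroup P G" "card P = p ^ k" "order G = p ^ k * r" "\<not> p dvd r"
    and y: "y \<in> carrier G" "y [^] (q ^ j) = \<one>" "normalizes {y} P" and u: "u \<in> P" "y \<otimes> u \<noteq> u \<otimes> y"
    by (auto simp: sylow_edge_def order_def)
  define v where "v = cmt y u"
  have uc: "u \<in> carrier G" using sub_in[OF P(1) u(1)] .
  note ca = coprime_action_cmt[OF P(1,2) p q pq y u]
  have "v \<in> R" using cmt_R[OF y(1) uc ca(1)] by (simp add: v_def)
  moreover have vP: "v \<in> P" "y \<otimes> v \<noteq> v \<otimes> y" using ca(2,3) by (simp_all add: v_def)
  ultimately have "v \<in> (P \<inter> RA) <#> (P \<inter> RB)" using sylow_R[OF p P] by blast
  then obtain a b where ab: "a \<in> P \<inter> RA" "b \<in> P \<inter> RB" "v = a \<otimes> b" by (rule set_multE)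
  then have "y \<otimes> a \<noteq> a \<otimes> y \<or> y \<otimes> b \<noteq> b \<otimes> y"
    using vP(2) commute_mult[OF y(1)] sub_in[OF P(1)] by blast
  then show "sylow_edge A p q \<or> sylow_edge B p q"
    using sylow_edge_factor[OF p q pq P y ab(1)] sw.sylow_edge_factor[OF p q pq P y ab(2)] by blast
next
  interpret sw: cop_product G B A by (rule swap)
  assume "sylow_edge A p q \<or> sylow_edge B p q"
  then show "sylow_edge (carrier G) p q" using sylow_edge_of_factor sw.sylow_edge_of_factor by blast
qed

end

section \<open>Hawkes edges of a product\<close>

context cop_product
begin

text \<open>\<open>B\<close> lies in \<open>CA\<close>, hence inside the product, and so normalises
  it; a normal subgroup of \<open>A\<close> thus becomes one of the whole group.\<close>

lemma set_mult_CA: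
  assumes K: "subgroup K G" "K \<subseteq> A" "normalizes A K"
  shows "subgroup (K <#> CA) G" "normalizes (carrier G) (K <#> CA)" "K \<subseteq> K <#> CA" "CA \<subseteq> K <#> CA"
proof -
  have Kc: "K \<subseteq> carrier G" by (rule subgroup.subset[OF K(1)])
  show S: "subgroup (K <#> CA) G"
    by (rule set_mult_sub_normalizes[OF K(1) CA(1) normalizes_mono[OF CA(2) Kc]])
  show "K \<subseteq> K <#> CA" and CK: "CA \<subseteq> K <#> CA"
    using sub_set_mult_left[OF K(1) CA(1)] sub_set_mult_right[OF K(1) CA(1)] by auto
  show "normalizes (carrier G) (K <#> CA)"
  proof (rule normalizes_carrierI)
    show "K <#> CA \<subseteq> carrier G" by (rule subgroup.subset[OF S])
    show "normalizes B (K <#> CA)" using normalizes_mono[OF normalizes_sub[OF S]] CA(3) CK by blast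
    show "normalizes A (K <#> CA)"
      using normalizes_set_mult[OF _ Kc _ K(3) normalizes_mono[OF CA(2)]] subgroup.subset A CA(1) by blast
  qed
qed

lemma act_set_mult_CA:
  assumes K: "K \<subseteq> carrier G" and g: "g \<in> K <#> CA"
  obtains n where "n \<in> K" "\<And>r. r \<in> RA \<Longrightarrow> cnj g r = cnj n r"
proof -
  obtain n c where nc: "n \<in> K" "c \<in> CA" "g = n \<otimes> c" using g by (rule set_multE)
  then have "cnj g r = cnj n r" if "r \<in> RA" for r using cnj_mult_CA[of n c r] K that by blast
  then show ?thesis using that nc by blast
qed

section \<open>The largest normal p-nilpotent subgroup of a factor\<close>

context
  fixes p :: nat
  assumes p: "prime p"
begin

abbreviation "FA \<equiv> O_pp (Sub A) p"
abbreviation "NA \<equiv> p_residual p FA"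
abbreviation "UA \<equiv> FA <#> CA"

lemmas FA = O_pp_sub[OF p A]

lemma NA: "subgroup NA G" "NA \<subseteq> A" "normalizes A NA"
  using p_residual_sub[OF FA(1)] p_residual_incl[OF FA(1)] FA(2)
    normalizes_p_residual[OF FA(1,3) subgroup.subset[OF A]] by auto

lemmas UA_sub = set_mult_CA[OF FA(1-3)]
lemmas VA_sub = set_mult_CA[OF NA]

text \<open>The normal subgroup \<open>NA <#> CA\<close> contains \<open>CA\<close> and the
  p'-elements of \<open>FA\<close>, so \<open>factor_part_mem\<close> applies with the p'-part
  \<open>b\<close> of the group order.\<close>

lemma p'el_UA:
  assumes v: "v \<in> UA" "v [^] (m::nat) = \<one>" "\<not> p dvd m"
  shows "v \<in> NA <#> CA"
proof -
  obtain k b where o: "order G = p ^ k * b" "coprime (p ^ k) b" "\<not> p dvd b" using prime_split[OF p] .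
  have o': "order G = b * p ^ k" "coprime b (p ^ k)" using o by (simp_all add: coprime_commute)
  have "coprime m (p ^ k)" using v p prime_power_coprime by blast
  then have vb: "v [^] b = \<one>" using one_pow_part[OF o'(1) sub_in[OF UA_sub(1) v(1)] v(2)] by blast
  show ?thesis
  proof (rule factor_part_mem[OF FA(1) CA(1) UA_sub(1) VA_sub(1) _ _ _ o' _ _ v(1) vb])
    show "NA <#> CA \<subseteq> UA" using mono_set_mult p_residual_incl[OF FA(1)] by blast
    show "normalizes FA (NA <#> CA)" "normalizes CA (NA <#> CA)"
      using normalizes_mono[OF VA_sub(2)] subgroup.subset FA(1) CA(1) by blast+
    show "x \<in> NA <#> CA" if "x \<in> FA" "x [^] b = \<one>" for x
    proof -
      have "x \<in> p'elements p FA" using that o(3) by (auto simp: p'elements_def)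
      then show ?thesis using p'elements_p_residual VA_sub(3) by blast
    qed
    show "x \<in> NA <#> CA" if "x \<in> CA" for x using that VA_sub(4) by blast
  qed
qed

text \<open>On \<open>RA\<close> the element acts like some \<open>n\<close> in \<open>NA\<close>. A
  \<open>p\<close>-power of \<open>n\<close> acts trivially and \<open>NA\<close> is a p'-group, so
  \<open>n\<close> acts trivially too.\<close>

lemma p_el_CA:
  assumes z: "z \<in> NA <#> CA" "z [^] (p ^ i) = \<one>"
  shows "z \<in> CA"
proof -
  have zc: "z \<in> carrier G" using sub_in[OF VA_sub(1) z(1)] .
  obtain n where n: "n \<in> NA" "\<And>r. r \<in> RA \<Longrightarrow> cnj z r = cnj n r"
    using act_set_mult_CA[OF subgroup.subset[OF NA(1)] z(1)] by blast
  have nc: "n \<in> carrier G" using sub_in[OF NA(1) n(1)] .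
  have "cnj (n [^] (p ^ i)) r = r" if r: "r \<in> RA" for r
    using act_pow[OF RA(1) RA_normal zc nc n(2) r, of "p ^ i"] z(2) sub_in[OF RA(1) r] by simp
  then have "n [^] (p ^ i) \<in> CA" using CA_iff_cnj nc by blast
  moreover have "n [^] card NA = \<one>" by (rule pow_card[OF NA(1) n(1)])
  moreover have "coprime (p ^ i) (card NA)" using FA(4) p prime_power_coprime by blast
  ultimately have "n \<in> CA" using mem_of_pow[OF CA(1) nc] by blast
  then show ?thesis using CA_iff_cnj[OF zc] n(2) cnj_CA by simp
qed

text \<open>\<open>v\<close> acts on \<open>RA\<close> like some \<open>n\<close> in
  \<open>NA\<close>. The commutator [n, a] lies in \<open>NA\<close>, a p'-group normal in
  \<open>A\<close>; it is also the product of the commuting \<open>p\<close>-elements n a n^-1 and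
  a^-1, hence trivial.\<close>

lemma p'el_commute:
  assumes v: "v \<in> UA" "v [^] (m::nat) = \<one>" "\<not> p dvd m" and a: "a \<in> RA" "a \<in> CA" "a [^] (p ^ l) = \<one>"
  shows "v \<otimes> a = a \<otimes> v"
proof -
  obtain n where n: "n \<in> NA" "\<And>r. r \<in> RA \<Longrightarrow> cnj v r = cnj n r"
    using act_set_mult_CA[OF subgroup.subset[OF NA(1)] p'el_UA[OF v]] by blast
  have nc: "n \<in> carrier G" "a \<in> carrier G" "v \<in> carrier G"
    using sub_in[OF NA(1) n(1)] sub_in[OF RA(1) a(1)] sub_in[OF UA_sub(1) v(1)] by auto
  let ?w = "cmt n a" let ?c = "cnj n a"
  have aA: "a \<in> A" using a RA by blast
  have "?w = n \<otimes> cnj a (inv n)" using nc by (simp add: word_simps)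
  then have wN: "?w \<in> NA"
    using normalizesD[OF NA(3) aA subgroup.m_inv_closed[OF NA(1) n(1)]] subgroup.m_closed[OF NA(1) n(1)] by simp
  have c: "?c \<in> RA" "?c [^] (p ^ l) = \<one>"
    using normalizesD[OF RA_normal nc(1) a(1)] cnj_pow[OF nc(1,2)] a(3) nc by auto
  have ia: "inv a \<in> CA" "(inv a) [^] (p ^ l) = \<one>"
    using subgroup.m_inv_closed[OF CA(1) a(2)] a(3) nc by (auto simp: nat_pow_inv)
  have "?c \<otimes> inv a = inv a \<otimes> ?c" using ia(1) c(1) by (auto simp: centralizer_def)
  then have "?w [^] (p ^ l) = ?c [^] (p ^ l) \<otimes> inv a [^] (p ^ l)"
    using pow_mult_distrib nc by (meson inv_closed m_closed)
  then have "?w [^] (p ^ l) = \<one>" using c ia by simp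
  moreover have "?w [^] card NA = \<one>" by (rule pow_card[OF NA(1) wN])
  moreover have "coprime (p ^ l) (card NA)" using FA(4) p prime_power_coprime by blast
  moreover have "?w \<in> carrier G" using nc by simp
  ultimately have "?w = \<one>" using one_pow_coprime by blast
  then have "?c = a" using commute_iff_cmt commute_iff_cnj nc by blast
  then have "cnj v a = a" using n(2)[OF a(1)] by simp
  then show ?thesis using commute_iff_cnj nc by blast
qed

lemma p_residual_UA:
  assumes M: "subgroup M G" "M \<subseteq> UA"
  shows "p_residual p M \<subseteq> NA <#> CA"
  unfolding p_residual_def[of p M]
proof (rule generate_subgroup_incl[OF _ VA_sub(1)], rule subsetI)
  fix x assume "x \<in> p'elements p M"
  then obtain m where "\<not> p dvd m" "x [^] (m::nat) = \<one>" "x \<in> UA" using M by (auto simp: p'elements_def)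
  then show "x \<in> NA <#> CA" using p'el_UA by blast
qed

end

text \<open>A \<open>p\<close>-element \<open>z\<close> of \<open>O\<^sup>p(M)\<close> centralises \<open>R\<close>, so for a \<open>p'\<close>-element \<open>v\<close> the commutator \<open>[z, v]\<close> is a
  \<open>p\<close>-element of the centre of \<open>R\<close>, on which \<open>v\<close> acts trivially.\<close>

lemma p_residual_Int_trivial:
  assumes p: "prime p"
    and M: "subgroup M G" "M \<subseteq> O_pp (Sub A) p <#> centralizer G RA"
      "M \<subseteq> O_pp (Sub B) p <#> centralizer G RB"
  shows "\<not> p dvd card (p_residual p M)"
  unfolding p_residual_def
proof (rule central_sylow_trivial[OF p p'elements_sub[OF subgroup.subset[OF M(1)]]])
  interpret sw: cop_product G B A by (rule swap)
  have pel: "v \<in> M" "\<exists>m::nat. \<not> p dvd m \<and> v [^] m = \<one>" if "v \<in> p'elements p M" for v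
    using that by (auto simp: p'elements_def)
  show "\<exists>m::nat. \<not> p dvd m \<and> s [^] m = \<one>" if "s \<in> p'elements p M" for s using pel(2)[OF that] .
  fix z g i assume z: "z \<in> generate G (p'elements p M)" and zp: "z [^] (p ^ i) = \<one>"
    and g: "g \<in> generate G (p'elements p M)"
  have zE: "z \<in> p_residual p M" using z by (simp add: p_residual_def)
  have zM: "z \<in> M" using zE p_residual_incl[OF M(1)] by blast
  have zc: "z \<in> carrier G" using sub_in[OF M(1) zM] .
  have zCA: "z \<in> CA" using p_el_CA[OF p _ zp] p_residual_UA[OF p M(1,2)] zE by blast
  have zCB: "z \<in> sw.CA" using sw.p_el_CA[OF p _ zp] sw.p_residual_UA[OF p M(1,3)] zE by blast
  have main: "z \<otimes> v = v \<otimes> z" if v: "v \<in> p'elements p M" for v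
  proof -
    obtain m :: nat where m: "\<not> p dvd m" "v [^] m = \<one>" using pel(2)[OF v] by blast
    have vM: "v \<in> M" by (rule pel(1)[OF v])
    have vc: "v \<in> carrier G" using sub_in[OF M(1) vM] .
    have cpm: "coprime (p ^ i) m" using m p prime_power_coprime by blast
    define w where "w = cmt z v"
    have wc: "w \<in> carrier G" using zc vc by (simp add: w_def)
    have wR: "w \<in> R" unfolding w_def by (rule cmt_R[OF zc vc cop_ordersI[OF zp m(2) cpm]])
    have wCA: "w \<in> CA" unfolding w_def by (rule cmt_normal_mem[OF CA(1,2) zCA vc])
    have wCB: "w \<in> sw.CA" unfolding w_def by (rule cmt_normal_mem[OF sw.CA(1,2) zCB vc])
    \<comment> \<open>\<open>b0\<close> lies in \<open>B\<close>, hence in \<open>CA\<close>, and so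
      does \<open>w\<close>; therefore \<open>a0\<close> is in \<open>CA\<close>, and symmetrically
      \<open>b0\<close> is in \<open>sw.CA\<close>.\<close>
    obtain a0 b0 where ab0: "a0 \<in> RA" "b0 \<in> RB" "w = a0 \<otimes> b0" using wR by (rule set_multE)
    have ab0c: "a0 \<in> carrier G" "b0 \<in> carrier G" using ab0 sub_in RA(1) RB(1) by auto
    have "b0 \<in> CA" using ab0 RB(2) CA(3) by blast
    moreover have "a0 = w \<otimes> inv b0" using ab0 ab0c by (simp add: m_assoc)
    ultimately have a0CA: "a0 \<in> CA" using wCA CA(1) by (simp add: subgroup.m_closed subgroup.m_inv_closed)
    have "a0 \<in> sw.CA" using ab0 RA(2) sw.CA(3) by blast
    moreover have "b0 = inv a0 \<otimes> w" using ab0 ab0c by (simp add: inv_cancel)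
    ultimately have b0CB: "b0 \<in> sw.CA"
      using wCB sw.CA(1) by (simp add: subgroup.m_closed subgroup.m_inv_closed)
    have "z \<otimes> a0 = a0 \<otimes> z" using zCA ab0(1) by (auto simp: centralizer_def)
    moreover have "z \<otimes> b0 = b0 \<otimes> z" using zCB ab0(2) by (auto simp: centralizer_def)
    ultimately have zw: "z \<otimes> w = w \<otimes> z" using commute_mult[OF zc ab0c] ab0(3) by simp
    \<comment> \<open>v z v^-1 = w^-1 z with commuting factors, so \<open>w\<close> is killed by the
      same power of \<open>p\<close> as \<open>z\<close>.\<close>
    have wp: "w [^] (p ^ i) = \<one>"
    proof -
      have "cnj v z = inv w \<otimes> z" using zc vc by (simp add: w_def word_simps)
      then have e: "(inv w \<otimes> z) [^] (p ^ i) = cnj v (z [^] (p ^ i))" using cnj_pow[OF vc zc] by metis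
      have "w \<in> centralizer G {z}" using zw wc by (simp add: centralizer_def)
      then have "inv w \<in> centralizer G {z}" using centralizer_sub[of "{z}"] zc by (simp add: subgroup.m_inv_closed)
      then have "inv w \<otimes> z = z \<otimes> inv w" by (simp add: centralizer_def)
      then have "inv w [^] (p ^ i) = \<one>" using e zp zc wc vc by (simp add: pow_mult_distrib)
      then show ?thesis using wc by (metis inv_eq_1_iff nat_pow_closed nat_pow_inv)
    qed
    have ab_comm: "a0 \<otimes> b0 = b0 \<otimes> a0" by (rule RA_RB[OF ab0(1,2)])
    obtain a b l where ab: "a \<in> RA" "b \<in> RB" "w = a \<otimes> b" "a [^] (p ^ l) = \<one>" "b [^] (p ^ l) = \<one>"
      "\<exists>n::nat. a = a0 [^] n" "\<exists>n::nat. b = b0 [^] n"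
      using p_parts[OF wR wp p RA(1) RB(1) ab0(3,1,2) ab_comm] by metis
    have "a \<in> CA" using ab(6) pow_sub[OF CA(1) a0CA] by blast
    then have va: "v \<otimes> a = a \<otimes> v" using p'el_commute[OF p _ m(2,1) ab(1) _ ab(4)] vM M(2) by blast
    have "b \<in> sw.CA" using ab(7) pow_sub[OF sw.CA(1) b0CB] by blast
    then have vb: "v \<otimes> b = b \<otimes> v" using sw.p'el_commute[OF p _ m(2,1) ab(2) _ ab(5)] vM M(3) by blast
    have "a \<in> carrier G" "b \<in> carrier G" using ab sub_in RA(1) RB(1) by auto
    then have vw: "v \<otimes> w = w \<otimes> v" using commute_mult[OF vc _ _ va vb] ab(3) by simp
    show ?thesis using central_cmt_coprime[OF zc zp vc m(2) cpm w_def zw[symmetric] vw[symmetric]] .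
  qed
  show "z \<otimes> g = g \<otimes> z"
    by (rule commute_generate[of "{z}" "p'elements p M"])
       (use zc main g p'elements_sub[OF subgroup.subset[OF M(1)]] in \<open>auto intro: generate.incl\<close>)
qed

lemma O_pp_factor:
  assumes p: "prime p"
  shows "O_pp (Sub A) p \<subseteq> O_pp (Sub (carrier G)) p"
proof -
  interpret sw: cop_product G B A by (rule swap)
  let ?F = "O_pp (Sub A) p" let ?E = "O_pp (Sub B) p"
  let ?U = "?F <#> centralizer G RA" let ?V = "?E <#> centralizer G RB"
  note FA = O_pp_sub[OF p A] and FB = O_pp_sub[OF p B]
  note U = set_mult_CA[OF FA(1-3)] and V = sw.set_mult_CA[OF FB(1-3)]
  have M: "subgroup (?U \<inter> ?V) G" by (rule sub_Int[OF U(1) V(1)])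
  have "normalizes (carrier G) (?U \<inter> ?V)"
    using U(2) V(2) by (auto simp: normalizes_def)
  moreover have "\<not> p dvd card (p_residual p (?U \<inter> ?V))" by (rule p_residual_Int_trivial[OF p M]) auto
  ultimately have "?U \<inter> ?V \<subseteq> O_pp (Sub (carrier G)) p"
    using O_pp_sub(5)[OF p subgroup_self M subgroup.subset[OF M]] by blast
  \<comment> \<open>\<open>?F\<close> lies in \<open>A\<close>, which centralises \<open>RB\<close>
    and is therefore contained in \<open>?V\<close>.\<close>
  moreover have "?F \<subseteq> ?U \<inter> ?V" using U(3) FA(2) sw.CA(3) V(4) by blast
  ultimately show ?thesis by blast
qed

text \<open>Intersecting the largest normal p-nilpotent subgroup of the group with \<open>A\<close>
  gives a normal p-nilpotent subgroup of \<open>A\<close>, so an element outside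
  \<open>O_pp (Sub A) p\<close> stays outside.\<close>

lemma hawkes_edge_of_factor:
  assumes "hawkes_edge A p q"
  shows "hawkes_edge (carrier G) p q"
proof -
  obtain x j where p: "prime p" and q: "prime q"
    and x: "x \<in> A" "x [^] (q ^ j) = \<one>" "x \<notin> O_pp (Sub A) p"
    using assms by (auto simp: hawkes_edge_def)
  let ?O = "O_pp (Sub (carrier G)) p"
  note O = O_pp_sub[OF p subgroup_self]
  have I: "subgroup (?O \<inter> A) G" by (rule sub_Int[OF O(1) A])
  have "p_residual p (?O \<inter> A) \<subseteq> p_residual p ?O"
    unfolding p_residual_def by (rule mono_generate) (auto simp: p'elements_def)
  then have "\<not> p dvd card (p_residual p (?O \<inter> A))"
    using sub_card_dvd[OF p_residual_sub[OF O(1)] p_residual_sub[OF I]] O(4) dvd_trans[of p] by blast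
  moreover have "normalizes A (?O \<inter> A)"
    using normalizesD[OF O(3)] cnj_sub[OF A] Ain by (auto simp: normalizes_def)
  ultimately have "?O \<inter> A \<subseteq> O_pp (Sub A) p" using O_pp_sub(5)[OF p A I] by blast
  then have "x \<notin> ?O" using x by blast
  then show ?thesis unfolding hawkes_edge_def using p q x Ain by blast
qed

text \<open>Without edges in the factors, all \<open>q\<close>-elements of \<open>A\<close> and
  \<open>B\<close> lie in the \<open>O_pp\<close> of their factor, hence by
  \<open>O_pp_factor\<close> in that of the group; \<open>factor_part_mem\<close> then captures all
  \<open>q\<close>-elements of the group.\<close>

lemma hawkes_edge_product: "hawkes_edge (carrier G) p q \<longleftrightarrow> hawkes_edge A p q \<or> hawkes_edge B p q"
proof
  interpret sw: cop_product G B A by (rule swap)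
  assume h: "hawkes_edge (carrier G) p q"
  then obtain x j where p: "prime p" and q: "prime q"
    and x: "x \<in> carrier G" "x [^] (q ^ j) = \<one>" "x \<notin> O_pp (Sub (carrier G)) p"
    by (auto simp: hawkes_edge_def)
  let ?O = "O_pp (Sub (carrier G)) p"
  note O = O_pp_sub[OF p subgroup_self]
  show "hawkes_edge A p q \<or> hawkes_edge B p q"
  proof (rule ccontr)
    assume n: "\<not> (hawkes_edge A p q \<or> hawkes_edge B p q)"
    obtain k b where o: "order G = q ^ k * b" "coprime (q ^ k) b" "\<not> q dvd b" using prime_split[OF q] .
    have "coprime (q ^ j) b" using o q prime_power_coprime by blast
    then have xk: "x [^] (q ^ k) = \<one>" using one_pow_part[OF o(1) x(1,2)] by blast
    have "x \<in> ?O"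
    proof (rule factor_part_mem[OF A B AB_sub O(1) _ _ _ o(1,2) _ _ _ xk])
      show "?O \<subseteq> A <#> B" "x \<in> A <#> B" using O(2) x(1) AB by auto
      show "normalizes A ?O" "normalizes B ?O"
        using normalizes_mono[OF O(3)] subgroup.subset A B by blast+
      show "y \<in> ?O" if "y \<in> A" "y [^] (q ^ k) = \<one>" for y
        using n that p q O_pp_factor[OF p] by (auto simp: hawkes_edge_def)
      show "y \<in> ?O" if "y \<in> B" "y [^] (q ^ k) = \<one>" for y
        using n that p q sw.O_pp_factor[OF p] by (auto simp: hawkes_edge_def)
    qed
    then show False using x by blast
  qed
next
  interpret sw: cop_product G B A by (rule swap)
  assume "hawkes_edge A p q \<or> hawkes_edge B p q"
  then show "hawkes_edge (carrier G) p q" using hawkes_edge_of_factor sw.hawkes_edge_of_factor by blast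
qed

lemma pi_product:
  assumes p: "prime p"
  shows "p dvd card (carrier G) \<longleftrightarrow> p dvd card A \<or> p dvd card B"
proof
  assume "p dvd card (carrier G)"
  then have "p dvd card A * card B" using card_set_mult[OF A B] AB by (metis dvd_mult2)
  then show "p dvd card A \<or> p dvd card B" using p prime_dvd_mult_iff by blast
next
  assume "p dvd card A \<or> p dvd card B"
  then show "p dvd card (carrier G)"
    using card_sub_order[OF A] card_sub_order[OF B] dvd_trans[of p] by (auto simp: order_def)
qed

lemma graph_product:
  "pi_grp (Sub (carrier G)) = pi_grp (Sub A) \<union> pi_grp (Sub B)"
  "snd (sylow_graph (Sub (carrier G))) =
     snd (sylow_graph (Sub A)) \<union> snd (sylow_graph (Sub B))"
  "snd (hawkes_graph (Sub (carrier G))) =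
     snd (hawkes_graph (Sub A)) \<union> snd (hawkes_graph (Sub B))"
  "snd (Nc_graph (Sub (carrier G))) =
     snd (Nc_graph (Sub A)) \<union> snd (Nc_graph (Sub B))"
proof goal_cases
  case 1 show ?case unfolding pi_sub using pi_product by blast
next
  case 2 show ?case
    using sylow_edge_iff[OF subgroup_self] sylow_edge_iff[OF A] sylow_edge_iff[OF B] sylow_edge_product by auto
next
  case 3 show ?case
    using hawkes_edge_iff[OF subgroup_self] hawkes_edge_iff[OF A] hawkes_edge_iff[OF B] hawkes_edge_product by auto
next
  case 4 show ?case
    using schmidt_edge_iff[OF subgroup_self] schmidt_edge_iff[OF A] schmidt_edge_iff[OF B] schmidt_edge_product
    by auto
qed


end

section \<open>Products of several subgroups\<close>

context fin_group
begin

lemma nil_residual_consistent: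
  assumes H: "subgroup H G" and A: "subgroup A G" "A \<subseteq> H"
  shows "fin_group.nil_residual (Sub H) A = nil_residual A"
proof -
  interpret H: fin_group "Sub H" using fin_sub[OF H] .
  have "{H.cmt x y | x y. x \<in> A \<and> y \<in> A \<and> cop_orders (Sub H) x y} =
    {cmt x y | x y. x \<in> A \<and> y \<in> A \<and> cop_orders G x y}" (is "?L = ?R")
  proof -
    have "H.cmt x y = cmt x y" if "x \<in> A" "y \<in> A" for x y
      using that A(2) by (simp add: m_inv_consistent[OF H] subset_iff)
    then show ?thesis by force
  qed
  moreover have "?R \<subseteq> H" using nil_residual_gens[OF A(1)] A(2) by blast
  ultimately show ?thesis unfolding H.nil_residual_def nil_residual_def using generate_consistent[OF _ H] by simp
qed

lemma cop_product_sub: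
  assumes A: "subgroup A G" and B: "subgroup B G" and H: "subgroup (A <#> B) G" and cc: "cop_commuting A B"
  shows "cop_product (Sub (A <#> B)) A B"
proof -
  interpret H: fin_group "Sub (A <#> B)" using fin_sub[OF H] .
  show ?thesis
  proof (intro cop_product.intro H.fin_group_axioms cop_product_axioms.intro)
    show "subgroup A (Sub (A <#> B))" "subgroup B (Sub (A <#> B))"
      using sub_sub_iff[OF H] A B sub_set_mult_left[OF A B] sub_set_mult_right[OF A B] by auto
    show "H.cop_commuting A B" using cc by (simp add: H.cop_commuting_def cop_commuting_def)
  qed simp
qed

text \<open>By \<open>part_generated\<close>, an element of \<open>A <#> B\<close> killed by
  \<open>a\<close> is a word in elements of \<open>A\<close> and \<open>B\<close> killed by
  \<open>a\<close> and in elements of the residuals. The former commute with \<open>d\<close> by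
  coprimality, the latter centralise all of \<open>D\<close>.\<close>

lemma cop_commuting_set_mult:
  assumes A: "subgroup A G" and B: "subgroup B G" and H: "subgroup (A <#> B) G" and cc: "cop_commuting A B"
    and D: "subgroup D G" and AD: "cop_commuting A D" and BD: "cop_commuting B D"
  shows "cop_commuting (A <#> B) D"
  unfolding cop_commuting_def
proof (intro ballI impI)
  let ?H = "A <#> B"
  interpret H: cop_product "Sub ?H" A B by (rule cop_product_sub[OF A B H cc])
  fix u d assume u: "u \<in> ?H" and d: "d \<in> D" and "cop_orders G u d"
  then obtain m n :: nat where mn: "coprime m n" "u [^] m = \<one>" "d [^] n = \<one>" by (auto simp: cop_orders_def)
  obtain a b where ab: "order (Sub ?H) = a * b" "coprime a b" "coprime m b" "coprime n a"
    using H.coprime_split[OF mn(1)] .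
  have AH: "A \<subseteq> ?H" and BH: "B \<subseteq> ?H" using sub_set_mult_left[OF A B] sub_set_mult_right[OF A B] .
  have nr: "H.RA = nil_residual A" "H.RB = nil_residual B" using nil_residual_consistent[OF H] A B AH BH by auto
  let ?S = "{z \<in> A \<union> B. z [^] a = \<one>} \<union> (nil_residual A <#> nil_residual B)"
  have "u [^] a = \<one>" using H.one_pow_part[OF ab(1) _ _ ab(3)] u mn(2) by simp
  then have "u \<in> generate (Sub ?H) ?S"
    using H.part_generated[OF ab(1,2), of u] u nr by simp
  moreover have SH: "?S \<subseteq> ?H"
    using AH BH nil_residual_incl[OF A] nil_residual_incl[OF B] mono_set_mult[of "nil_residual A" A "nil_residual B" B] by blast
  ultimately have uS: "u \<in> generate G ?S" using generate_consistent[OF _ H] by simp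
  have dc: "d \<in> carrier G" using sub_in[OF D d] .
  have Cd: "subgroup (centralizer G {d}) G" using centralizer_sub dc by simp
  have "?S \<subseteq> centralizer G {d}"
  proof
    fix s assume s: "s \<in> ?S"
    show "s \<in> centralizer G {d}"
    proof (cases "s \<in> nil_residual A <#> nil_residual B")
      case True
      then obtain x y where xy: "x \<in> nil_residual A" "y \<in> nil_residual B" "s = x \<otimes> y" by (rule set_multE)
      have "x \<in> centralizer G {d}" "y \<in> centralizer G {d}"
        using nil_residual_centralized[OF A D AD xy(1) d] nil_residual_centralized[OF B D BD xy(2) d]
          sub_in[OF nil_residual_sub[OF A] xy(1)] sub_in[OF nil_residual_sub[OF B] xy(2)] by (auto simp: centralizer_def)
      then show ?thesis using xy subgroup.m_closed[OF Cd] by simp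
    next
      case False
      then have sab: "s \<in> A \<union> B" "s [^] a = \<one>" using s by auto
      then have "cop_orders G s d" using cop_ordersI[OF _ mn(3)] ab(4) by (simp add: coprime_commute)
      then have "s \<otimes> d = d \<otimes> s" using AD BD d sab unfolding cop_commuting_def by blast
      then show ?thesis using sab sub_in[OF A] sub_in[OF B] by (auto simp: centralizer_def)
    qed
  qed
  then have "generate G ?S \<subseteq> centralizer G {d}" by (rule generate_subgroup_incl[OF _ Cd])
  then show "u \<otimes> d = d \<otimes> u" using uS by (auto simp: centralizer_def)
qed

lemma N_connected_cop_commuting:
  assumes A: "subgroup A G" and B: "subgroup B G" and n: "N_connected G A B"
  shows "cop_commuting A B"
  unfolding cop_commuting_def
proof (intro ballI impI)
  fix x y assume x: "x \<in> A" and y: "y \<in> B" and c: "cop_orders G x y"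
  have xy: "{x, y} \<subseteq> carrier G" using x y sub_in A B by blast
  have "cop_commuting (generate G {x, y}) (generate G {x, y})"
    using n x y nilpotent_iff_cop_commuting[OF generate_is_subgroup[OF xy]] by (simp add: N_connected_def)
  then show "x \<otimes> y = y \<otimes> x" using c by (auto simp: cop_commuting_def intro: generate.incl)
qed

text \<open>Besides the graphs, the induction carries permutability and \<open>cop_commuting\<close>
  of the partial product with each factor still to come: these make the next product a subgroup and
  an instance of \<open>cop_product\<close>. It starts from the trivial subgroup, whose graphs are
  empty.\<close>

lemma set_prod_seq_graphs:
  fixes Gs :: "nat \<Rightarrow> 'a set" and n :: nat
  defines "H \<equiv> set_prod_seq G Gs"
  assumes Gs: "\<And>i. 1 \<le> i \<Longrightarrow> i \<le> n \<Longrightarrow> subgroup (Gs i) G"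
    and permutable: "\<forall>i \<in> {1..n}. \<forall>j \<in> {1..n}. Gs i <#> Gs j = Gs j <#> Gs i"
    and connected: "\<forall>i \<in> {1..n}. \<forall>j \<in> {1..n}. i \<noteq> j \<longrightarrow> N_connected G (Gs i) (Gs j)"
    and k: "k \<le> n"
  shows "subgroup (H k) G \<and> (\<forall>i. k < i \<and> i \<le> n \<longrightarrow> H k <#> Gs i = Gs i <#> H k \<and> cop_commuting (H k) (Gs i))
    \<and> pi_grp (Sub (H k)) = (\<Union>i\<in>{1..k}. pi_grp (Sub (Gs i)))
    \<and> snd (sylow_graph (Sub (H k))) = (\<Union>i\<in>{1..k}. snd (sylow_graph (Sub (Gs i))))
    \<and> snd (hawkes_graph (Sub (H k))) = (\<Union>i\<in>{1..k}. snd (hawkes_graph (Sub (Gs i))))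
    \<and> snd (Nc_graph (Sub (H k))) = (\<Union>i\<in>{1..k}. snd (Nc_graph (Sub (Gs i))))"
  using k unfolding H_def
proof (induction k)
  case 0
  have "{\<one>} <#> Gs i = Gs i <#> {\<one>} \<and> cop_commuting {\<one>} (Gs i)" if "0 < i" "i \<le> n" for i
  proof -
    have "Gs i \<subseteq> carrier G" using Gs[of i] that subgroup.subset by force
    then show ?thesis by (force simp: set_mult_def cop_commuting_def)
  qed
  moreover have "pi_grp (G\<lparr>carrier := {\<one>}\<rparr>) = {}" by (auto simp: pi_sub)
  ultimately show ?case using triv_subgroup
    by (auto simp: sylow_graph_def hawkes_graph_def Nc_graph_def)
next
  case (Suc k)
  let ?A = "set_prod_seq G Gs k" let ?B = "Gs (Suc k)" let ?K = "?A <#> ?B"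
  have A: "subgroup ?A G" and perm: "\<And>i. k < i \<Longrightarrow> i \<le> n \<Longrightarrow> ?A <#> Gs i = Gs i <#> ?A"
    and cc: "\<And>i. k < i \<Longrightarrow> i \<le> n \<Longrightarrow> cop_commuting ?A (Gs i)"
    using Suc by auto
  have B: "subgroup ?B G" using Gs Suc.prems by simp
  have K: "subgroup ?K G" using set_mult_sub[OF A B] perm[of "Suc k"] Suc.prems by simp
  have ccAB: "cop_commuting ?A ?B" using cc Suc.prems by simp
  interpret P: cop_product "Sub ?K" ?A ?B by (rule cop_product_sub[OF A B K ccAB])
  have step: "?K <#> Gs i = Gs i <#> ?K \<and> cop_commuting ?K (Gs i)" if i: "Suc k < i" "i \<le> n" for i
  proof
    have D: "subgroup (Gs i) G" using Gs i by simp
    note sub = subgroup.subset[OF A] subgroup.subset[OF B] subgroup.subset[OF D]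
    have BD: "?B <#> Gs i = Gs i <#> ?B" using permutable i by simp
    have "?K <#> Gs i = ?A <#> (Gs i <#> ?B)" using sub BD by (simp add: set_mult_assoc)
    also have "\<dots> = Gs i <#> ?A <#> ?B" using sub perm[of i] i by (simp flip: set_mult_assoc)
    finally show "?K <#> Gs i = Gs i <#> ?K" using sub by (simp add: set_mult_assoc)
    have "cop_commuting ?B (Gs i)" using N_connected_cop_commuting[OF B D] connected i by simp
    then show "cop_commuting ?K (Gs i)" using cop_commuting_set_mult[OF A B K ccAB D] cc[of i] i by simp
  qed
  have "{1..Suc k} = insert (Suc k) {1..k}" by (simp add: atLeastAtMostSuc_conv)
  then show ?case using Suc K step P.graph_product by (simp add: Un_commute)
qed

end

theorem theorem1:
  fixes G :: "('a, 'b) monoid_scheme" and Gs :: "nat \<Rightarrow> 'a set" and n :: nat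
  assumes "group G" and "finite (carrier G)"
    and "\<forall>i \<in> {1..n}. subgroup (Gs i) G"
    and "carrier G = set_prod_seq G Gs n"
    and "\<forall>i \<in> {1..n}. \<forall>j \<in> {1..n}. Gs i <#>\<^bsub>G\<^esub> Gs j = Gs j <#>\<^bsub>G\<^esub> Gs i"
    and "\<forall>i \<in> {1..n}. \<forall>j \<in> {1..n}. i \<noteq> j \<longrightarrow> N_connected G (Gs i) (Gs j)"
  shows "sylow_graph G = graph_Union {1..n} (\<lambda>i. sylow_graph (G\<lparr>carrier := Gs i\<rparr>))
       \<and> hawkes_graph G = graph_Union {1..n} (\<lambda>i. hawkes_graph (G\<lparr>carrier := Gs i\<rparr>))
       \<and> Nc_graph G = graph_Union {1..n} (\<lambda>i. Nc_graph (G\<lparr>carrier := Gs i\<rparr>))"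
proof -
  interpret fin_group G using assms(1,2) by (simp add: fin_group_def fin_group_axioms_def)
  note ind = set_prod_seq_graphs[of n Gs n, OF _ assms(5,6)]
  have e: "G\<lparr>carrier := set_prod_seq G Gs n\<rparr> = G" using assms(4) by (simp flip: assms(4))
  have "fst (sylow_graph K) = pi_grp K" "fst (hawkes_graph K) = pi_grp K" "fst (Nc_graph K) = pi_grp K"
    for K :: "('a, 'b) monoid_scheme" by (simp_all add: sylow_graph_def hawkes_graph_def Nc_graph_def)
  then show ?thesis using ind assms(3) unfolding e graph_Union_def by (auto simp: prod_eq_iff)
qed

end
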